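(* For any non-zero real number $t$ let $a,b_t\in\mathrm{PGL}_3(\mathbb R)$ be the projective transformations given by $$a=\begin{bmatrix}1/2&0&0\\0&1&0\\0&0&2\end{bmatrix},\qquad b_t=\begin{bmatrix}2t+5&-4t+2&2t-3\\-2t+1&4t+2&-2t+1\\2t-3&-4t+2&2t+5\end{bmatrix}.$$ Let $\{\gamma_1,\gamma_2\}$ be a pair of generators of the free group $F_2$ of rank $2$ and let $\rho_t:F_2\to\mathrm{PGL}_3(\mathbb R)$ be the representation defined by $\rho_t(\gamma_1)=a$ and $\rho_t(\gamma_2)=b_t$. Then: (1) If $t>1$, then $\rho_t$ is primitive stable. (2) If $t<\frac{35}{2}$ and $\cos^{-1}\left(\frac{-35+306t-32t^2}{256t}\right)\in\mathbb Q\cdot\pi$, then $\rho_t$ is non-faithful. (3) If $t<\frac{35}{2}$ and $\cos^{-1}\left(\frac{-35+306t-32t^2}{256t}\right)\notin\mathbb Q\cdot\pi$, then $\rho_t$ is non-discrete. (4) If $t\ne2$, then $\rho_t(F_2)$ does not lie in a conjugate of $\mathrm{PO}(2,1)$.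
   Context: Non-faithful means not injective; non-discrete means that the image is not a discrete subgroup of $\mathrm{PGL}_3(\mathbb R)$. Conjugates of $\mathrm{PO}(2,1)$ are taken in $\mathrm{PGL}_3(\mathbb R)$. Primitive stable. Fix an inner product on $\mathbb R^3$. For $g\in\mathrm{PGL}_3(\mathbb R)$ let $\bar g\in\mathrm{GL}_3(\mathbb R)$ be a representative with $|\det\bar g|=1$ and singular values $\mu_1(\bar g)\ge\mu_2(\bar g)\ge\mu_3(\bar g)$; put $\mu(g)=(\log\mu_1(\bar g),\log\mu_2(\bar g),\log\mu_3(\bar g))$, and let $\alpha_k(x_1,x_2,x_3)=x_k-x_{k+1}$ for $k=1,2$. An element of $F_2$ is primitive if it belongs to a two-element generating set. With a word metric on $F_2$, an axis of a non-identity $\gamma$ is a (bi-infinite) geodesic in $F_2$ invariant under $\gamma$; a primitive geodesic ray is a geodesic ray lying in an axis of a primitive element; it is rooted if it starts at $\mathrm{id}$. $\rho:F_2\to\mathrm{PGL}_3(\mathbb R)$ is primitive stable if for some (equivalently any) word metric on $F_2$ there are $\kappa,\kappa'>0$ such that $\alpha_k(\mu(\rho(\eta_i)))\ge\kappa i-\kappa'$ for all rooted primitive geodesic rays $(\eta_i)_{i=0}^\infty$, all $i\ge0$ and $k=1,2$.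
   Formalization: In (2) the value t = 1/16 is excluded: there the argument of cos^{-1} equals -1, so cos^{-1} = π lies in Q·π, but ρ_{1/16} is faithful by a ping-pong argument; in (2) and (3) the argument of cos^{-1} is required to lie in [-1,1]. *)

theory Defs
  imports "HOL-Analysis.Analysis" "HOL-Algebra.Algebra"
begin

section \<open>The free group of rank two\<close>

text \<open>A word is a list of pairs of an element and an exponent sign; the sign
  \<^const>\<open>True\<close> stands for the exponent \<open>-1\<close>.\<close>

definition word_value :: "('g, 'm) monoid_scheme \<Rightarrow> ('g \<times> bool) list \<Rightarrow> 'g" where
  "word_value G w =
     foldr (\<lambda>(x, s) y. (if s then inv\<^bsub>G\<^esub> x else x) \<otimes>\<^bsub>G\<^esub> y) w \<one>\<^bsub>G\<^esub>"

definition reduced_word :: "('g \<times> bool) list \<Rightarrow> bool" where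
  "reduced_word w \<longleftrightarrow> successively (\<lambda>(x, s) (y, u). x = y \<longrightarrow> s = u) w"

definition free_basis :: "('g, 'm) monoid_scheme \<Rightarrow> 'g set \<Rightarrow> bool" where
  "free_basis G B \<longleftrightarrow>
     B \<subseteq> carrier G \<and> generate G B = carrier G \<and>
     (\<forall>w. w \<noteq> [] \<and> fst ` set w \<subseteq> B \<and> reduced_word w \<longrightarrow> word_value G w \<noteq> \<one>\<^bsub>G\<^esub>)"

definition free_group_rank_two :: "('g, 'm) monoid_scheme \<Rightarrow> bool" where
  "free_group_rank_two G \<longleftrightarrow> group G \<and> (\<exists>B. card B = 2 \<and> free_basis G B)"

definition generating_set :: "('g, 'm) monoid_scheme \<Rightarrow> 'g set \<Rightarrow> bool" where
  "generating_set G S \<longleftrightarrow> S \<subseteq> carrier G \<and> generate G S = carrier G"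

definition primitive_elt :: "('g, 'm) monoid_scheme \<Rightarrow> 'g \<Rightarrow> bool" where
  "primitive_elt G \<gamma> \<longleftrightarrow> (\<exists>T. card T = 2 \<and> generating_set G T \<and> \<gamma> \<in> T)"

section \<open>Word metrics, axes and primitive geodesic rays\<close>

definition word_length :: "('g, 'm) monoid_scheme \<Rightarrow> 'g set \<Rightarrow> 'g \<Rightarrow> nat" where
  "word_length G S g = (LEAST n. \<exists>w. length w = n \<and> fst ` set w \<subseteq> S \<and> word_value G w = g)"

definition word_dist :: "('g, 'm) monoid_scheme \<Rightarrow> 'g set \<Rightarrow> 'g \<Rightarrow> 'g \<Rightarrow> nat" where
  "word_dist G S g h = word_length G S (inv\<^bsub>G\<^esub> g \<otimes>\<^bsub>G\<^esub> h)"

definition geodesic_line :: "('g, 'm) monoid_scheme \<Rightarrow> 'g set \<Rightarrow> (int \<Rightarrow> 'g) \<Rightarrow> bool" where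
  "geodesic_line G S c \<longleftrightarrow>
     range c \<subseteq> carrier G \<and> (\<forall>i j. int (word_dist G S (c i) (c j)) = \<bar>i - j\<bar>)"

definition geodesic_ray :: "('g, 'm) monoid_scheme \<Rightarrow> 'g set \<Rightarrow> (nat \<Rightarrow> 'g) \<Rightarrow> bool" where
  "geodesic_ray G S \<eta> \<longleftrightarrow>
     range \<eta> \<subseteq> carrier G \<and> (\<forall>i j. int (word_dist G S (\<eta> i) (\<eta> j)) = \<bar>int i - int j\<bar>)"

definition axis_of :: "('g, 'm) monoid_scheme \<Rightarrow> 'g set \<Rightarrow> 'g \<Rightarrow> (int \<Rightarrow> 'g) \<Rightarrow> bool" where
  "axis_of G S \<gamma> c \<longleftrightarrow>
     \<gamma> \<in> carrier G \<and> \<gamma> \<noteq> \<one>\<^bsub>G\<^esub> \<and> geodesic_line G S c \<and>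
     (\<lambda>x. \<gamma> \<otimes>\<^bsub>G\<^esub> x) ` range c = range c"

definition primitive_ray :: "('g, 'm) monoid_scheme \<Rightarrow> 'g set \<Rightarrow> (nat \<Rightarrow> 'g) \<Rightarrow> bool" where
  "primitive_ray G S \<eta> \<longleftrightarrow>
     geodesic_ray G S \<eta> \<and>
     (\<exists>\<gamma> c. primitive_elt G \<gamma> \<and> axis_of G S \<gamma> c \<and> range \<eta> \<subseteq> range c)"

definition rooted_primitive_ray :: "('g, 'm) monoid_scheme \<Rightarrow> 'g set \<Rightarrow> (nat \<Rightarrow> 'g) \<Rightarrow> bool" where
  "rooted_primitive_ray G S \<eta> \<longleftrightarrow> primitive_ray G S \<eta> \<and> \<eta> 0 = \<one>\<^bsub>G\<^esub>"

section \<open>The projective linear group and its topology\<close>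

definition GL3 :: "(real^3^3) monoid" where
  "GL3 = \<lparr>carrier = {A. invertible A}, mult = (**), one = mat 1\<rparr>"

definition scalars3 :: "(real^3^3) set" where
  "scalars3 = {c *\<^sub>R mat 1 | c. c \<noteq> 0}"

definition PGL3 :: "(real^3^3) set monoid" where
  "PGL3 = GL3 Mod scalars3"

definition proj :: "real^3^3 \<Rightarrow> (real^3^3) set" where
  "proj A = scalars3 #>\<^bsub>GL3\<^esub> A"

lemma scaleR_mat_mult [simp]:
  "(c *\<^sub>R mat 1) ** A = c *\<^sub>R (A :: real^3^3)" "A ** (c *\<^sub>R mat 1) = c *\<^sub>R (A :: real^3^3)"
  by (simp_all flip: scalar_matrix_assoc add: matrix_scalar_ac)

lemma invertible_scaleR_mat: "c \<noteq> 0 \<Longrightarrow> invertible (c *\<^sub>R mat 1 :: real^3^3)"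
  unfolding invertible_def by (rule exI[of _ "inverse c *\<^sub>R mat 1"]) simp

lemma group_GL3: "group GL3"
proof (rule groupI)
  fix A assume "A \<in> carrier GL3"
  then obtain B where "A ** B = mat 1" "B ** A = mat 1"
    by (auto simp: GL3_def invertible_def)
  then show "\<exists>B\<in>carrier GL3. B \<otimes>\<^bsub>GL3\<^esub> A = \<one>\<^bsub>GL3\<^esub>"
    by (auto simp: GL3_def invertible_def)
next
  show "\<one>\<^bsub>GL3\<^esub> \<in> carrier GL3"
    by (auto simp: GL3_def invertible_def intro!: exI[of _ "mat 1"])
qed (auto simp: GL3_def invertible_mult matrix_mul_assoc)

lemma normal_scalars3: "scalars3 \<lhd> GL3"
proof -
  interpret group GL3 by (rule group_GL3)
  have "subgroup scalars3 GL3"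
  proof (rule subgroupI)
    show "scalars3 \<subseteq> carrier GL3"
      by (auto simp: scalars3_def GL3_def invertible_scaleR_mat)
    show "scalars3 \<noteq> {}"
      by (auto simp: scalars3_def intro!: exI[of _ 1])
  next
    fix A assume "A \<in> scalars3"
    then obtain c where c: "A = c *\<^sub>R mat 1" "c \<noteq> 0" by (auto simp: scalars3_def)
    have "inv\<^bsub>GL3\<^esub> A = inverse c *\<^sub>R mat 1"
      by (rule inv_equality) (use c in \<open>auto simp: GL3_def invertible_scaleR_mat\<close>)
    then show "inv\<^bsub>GL3\<^esub> A \<in> scalars3"
      using c by (auto simp: scalars3_def)
  next
    fix A B assume "A \<in> scalars3" "B \<in> scalars3"
    then obtain c d where "A = c *\<^sub>R mat 1" "c \<noteq> 0" "B = d *\<^sub>R mat 1" "d \<noteq> 0"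
      by (auto simp: scalars3_def)
    then show "A \<otimes>\<^bsub>GL3\<^esub> B \<in> scalars3"
      by (auto simp: scalars3_def GL3_def intro!: exI[of _ "c * d"])
  qed
  moreover have "A \<otimes>\<^bsub>GL3\<^esub> C \<otimes>\<^bsub>GL3\<^esub> inv\<^bsub>GL3\<^esub> A \<in> scalars3"
    if A: "A \<in> carrier GL3" and "C \<in> scalars3" for A C
  proof -
    from \<open>C \<in> scalars3\<close> obtain c where c: "C = c *\<^sub>R mat 1" "c \<noteq> 0" by (auto simp: scalars3_def)
    have C: "C \<in> carrier GL3"
      using c by (simp add: GL3_def invertible_scaleR_mat)
    have "A \<otimes>\<^bsub>GL3\<^esub> C = C \<otimes>\<^bsub>GL3\<^esub> A"
      by (simp add: GL3_def c)
    then have "A \<otimes>\<^bsub>GL3\<^esub> C \<otimes>\<^bsub>GL3\<^esub> inv\<^bsub>GL3\<^esub> A = C"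
      using A C by (simp add: m_assoc)
    then show ?thesis using \<open>C \<in> scalars3\<close> by simp
  qed
  ultimately show ?thesis by (simp add: normal_inv_iff)
qed

lemma group_PGL3: "group PGL3"
  unfolding PGL3_def by (rule normal.factorgroup_is_group[OF normal_scalars3])

text \<open>The quotient topology coming from \<^const>\<open>GL3\<close> with its topology as a subset of the
  space of matrices.\<close>

definition PGL3_topology :: "(real^3^3) set topology" where
  "PGL3_topology = topology (\<lambda>U. U \<subseteq> carrier PGL3 \<and>
     openin (top_of_set (carrier GL3)) {A \<in> carrier GL3. proj A \<in> U})"

lemma openin_PGL3_topology:
  "openin PGL3_topology U \<longleftrightarrow> U \<subseteq> carrier PGL3 \<and>
     openin (top_of_set (carrier GL3)) {A \<in> carrier GL3. proj A \<in> U}"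
proof -
  let ?P = "\<lambda>U. {A \<in> carrier GL3. proj A \<in> U}"
  have "istopology (\<lambda>U. U \<subseteq> carrier PGL3 \<and> openin (top_of_set (carrier GL3)) (?P U))"
    unfolding istopology_def
  proof (intro conjI allI impI)
    fix S T
    assume "S \<subseteq> carrier PGL3 \<and> openin (top_of_set (carrier GL3)) (?P S)"
      and "T \<subseteq> carrier PGL3 \<and> openin (top_of_set (carrier GL3)) (?P T)"
    moreover have "?P (S \<inter> T) = ?P S \<inter> ?P T" by auto
    ultimately show "S \<inter> T \<subseteq> carrier PGL3" "openin (top_of_set (carrier GL3)) (?P (S \<inter> T))"
      by auto
  next
    fix \<K>
    assume *: "\<forall>K\<in>\<K>. K \<subseteq> carrier PGL3 \<and> openin (top_of_set (carrier GL3)) (?P K)"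
    then show "\<Union>\<K> \<subseteq> carrier PGL3" by auto
    have "?P (\<Union>\<K>) = \<Union>(?P ` \<K>)" by auto
    with * show "openin (top_of_set (carrier GL3)) (?P (\<Union>\<K>))"
      by (auto intro!: openin_Union)
  qed
  then show ?thesis unfolding PGL3_topology_def by (simp add: topology_inverse')
qed

lemma carrier_PGL3: "carrier PGL3 = proj ` carrier GL3"
  by (auto simp: PGL3_def FactGroup_def RCOSETS_def proj_def)

lemma topspace_PGL3_topology: "topspace PGL3_topology = carrier PGL3"
proof -
  have "{A \<in> carrier GL3. proj A \<in> carrier PGL3} = carrier GL3"
    by (auto simp: carrier_PGL3)
  then have "openin PGL3_topology (carrier PGL3)"
    unfolding openin_PGL3_topology by simp
  then show ?thesis
    by (meson openin_PGL3_topology openin_subset openin_topspace subset_antisym)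
qed

lemma quotient_map_proj: "quotient_map (top_of_set (carrier GL3)) PGL3_topology proj"
  by (auto simp: quotient_map_def topspace_PGL3_topology carrier_PGL3 openin_PGL3_topology)

definition discrete_subgroup_PGL3 :: "(real^3^3) set set \<Rightarrow> bool" where
  "discrete_subgroup_PGL3 H \<longleftrightarrow>
     subgroup H PGL3 \<and> subtopology PGL3_topology H = discrete_topology H"

definition O21 :: "(real^3^3) set" where
  "O21 = (let J = vector [vector [1, 0, 0], vector [0, 1, 0], vector [0, 0, -1]]
          in {A. transpose A ** J ** A = J})"

definition PO21 :: "(real^3^3) set set" where
  "PO21 = proj ` O21"

definition conjugate_PGL3 :: "(real^3^3) set \<Rightarrow> (real^3^3) set set \<Rightarrow> (real^3^3) set set" where
  "conjugate_PGL3 g H = (\<lambda>h. g \<otimes>\<^bsub>PGL3\<^esub> h \<otimes>\<^bsub>PGL3\<^esub> inv\<^bsub>PGL3\<^esub> g) ` H"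

section \<open>Singular values and primitive stability\<close>

definition inner_product :: "(real^3 \<Rightarrow> real^3 \<Rightarrow> real) \<Rightarrow> bool" where
  "inner_product ip \<longleftrightarrow>
     bilinear ip \<and> (\<forall>x y. ip x y = ip y x) \<and> (\<forall>x. x \<noteq> 0 \<longrightarrow> ip x x > 0)"

definition orthonormal_frame :: "(real^3 \<Rightarrow> real^3 \<Rightarrow> real) \<Rightarrow> (3 \<Rightarrow> real^3) \<Rightarrow> bool" where
  "orthonormal_frame ip u \<longleftrightarrow> (\<forall>i j. ip (u i) (u j) = (if i = j then 1 else 0))"

text \<open>The singular values in decreasing order, read off a singular value decomposition with
  respect to the given inner product; they do not depend on the decomposition.\<close>

definition singular_values :: "(real^3 \<Rightarrow> real^3 \<Rightarrow> real) \<Rightarrow> real^3^3 \<Rightarrow> real^3" where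
  "singular_values ip A = (THE s. s$1 \<ge> s$2 \<and> s$2 \<ge> s$3 \<and> s$3 \<ge> 0 \<and>
     (\<exists>u v. orthonormal_frame ip u \<and> orthonormal_frame ip v \<and>
            (\<forall>i. A *v v i = s$i *\<^sub>R u i)))"

text \<open>A class in \<^const>\<open>PGL3\<close> has exactly two representatives of determinant \<open>1\<close> or \<open>-1\<close>;
  they differ by a sign, so they have the same singular values.\<close>

definition normalized_rep :: "(real^3^3) set \<Rightarrow> real^3^3" where
  "normalized_rep g = (SOME A. A \<in> g \<and> \<bar>det A\<bar> = 1)"

definition cartan_proj :: "(real^3 \<Rightarrow> real^3 \<Rightarrow> real) \<Rightarrow> (real^3^3) set \<Rightarrow> real^3" where
  "cartan_proj ip g = (\<chi> i. ln (singular_values ip (normalized_rep g) $ i))"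

definition simple_root :: "3 \<Rightarrow> real^3 \<Rightarrow> real" where
  "simple_root k x = x $ k - x $ (k + 1)"

definition primitive_stable ::
  "(real^3 \<Rightarrow> real^3 \<Rightarrow> real) \<Rightarrow> ('g, 'm) monoid_scheme \<Rightarrow> ('g \<Rightarrow> (real^3^3) set) \<Rightarrow> bool" where
  "primitive_stable ip G \<rho> \<longleftrightarrow>
     (\<exists>S. finite S \<and> generating_set G S \<and>
       (\<exists>\<kappa> > 0. \<exists>\<kappa>' > 0. \<forall>\<eta>. rooted_primitive_ray G S \<eta> \<longrightarrow>
          (\<forall>i. \<forall>k\<in>{1, 2}.
             simple_root k (cartan_proj ip (\<rho> (\<eta> i))) \<ge> \<kappa> * real i - \<kappa>')))"

section \<open>The family of representations\<close>

definition mat_a :: "real^3^3" where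
  "mat_a = vector [vector [1/2, 0, 0],
                   vector [0,   1, 0],
                   vector [0,   0, 2]]"

definition mat_b :: "real \<Rightarrow> real^3^3" where
  "mat_b t = vector [vector [ 2*t + 5, -4*t + 2,  2*t - 3],
                     vector [-2*t + 1,  4*t + 2, -2*t + 1],
                     vector [ 2*t - 3, -4*t + 2,  2*t + 5]]"

text \<open>The commutator of \<^const>\<open>mat_a\<close> and \<^term>\<open>mat_b t\<close> has trace
  \<^term>\<open>1 + 2 * comm_cos t\<close>.  For \<open>t \<noteq> 0\<close>, \<^term>\<open>comm_cos t\<close> lies in the domain \<open>[-1, 1]\<close> of
  \<^const>\<open>arccos\<close> exactly when \<open>1/16 \<le> t \<le> 35/2\<close>; it equals \<open>-1\<close> at both end points, where the
  commutator is not diagonalisable and has infinite order.  For \<open>t = 1/16\<close> the representation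
  is faithful, by a ping-pong argument in the projective plane.\<close>

definition comm_cos :: "real \<Rightarrow> real" where
  "comm_cos t = (- 35 + 306 * t - 32 * t\<^sup>2) / (256 * t)"

end

theory Submission
  imports Defs "HOL-Library.Sublist"
begin

text \<open>
  Part (1) combines a fact about the free group with a fact about the matrices.  A primitive
  element is conjugate to a word in which each generator occurs with exponents of one sign only,
  and this forces the steps of any axis of a primitive element to be letters \<open>\<gamma>\<^sub>1\<^sup>\<plusminus>\<close>, \<open>\<gamma>\<^sub>2\<^sup>\<plusminus>\<close> with
  constant signs (\<open>axis_steps\<close>).  The \<open>i\<close>-th point of a rooted primitive ray is therefore a product
  of \<open>i\<close> letters of one of the four pairs \<open>{\<gamma>\<^sub>1\<^sup>\<plusminus>, \<gamma>\<^sub>2\<^sup>\<plusminus>}\<close>, and primitive stability becomes a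
  statement about four semigroups of matrices.  For each of the four there is a triangle in the
  projective plane which both generators map into its interior (\<open>mat_powers_preserve_cone\<close>): in
  coordinates adapted to the triangle the generators are positive matrices.  A product of \<open>n\<close>
  positive matrices with entries in a fixed interval contracts the positive cone at an exponential
  rate, hence is exponentially close, relative to its norm, to a map of rank one, and the ratio of
  its two largest singular values is exponentially large (\<open>cone_semigroup_singular_gap\<close>).  Passing
  to inverses reverses the order of the singular values and exchanges the sign patterns, so the same
  estimate serves the second simple root.

  The statement about primitive elements comes from Nielsen's theorem that any two generating pairs
  are related by elementary moves (\<open>generating_pair_nielsen_equiv_basis\<close>), because being
  simultaneously conjugate to a pair of positive words is preserved by these moves up to a change of
  signs (\<open>conj_positive_mult\<close>).  To pass from the element to its axis, the translation length is
  compared with the \<open>l\<^sup>1\<close>-norm of the image in \<open>\<int>\<^sup>2\<close>: a positive word is as long as this norm, so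
  the translation length is at most the norm, and then no cancellation of signs can happen along a
  period of the axis.

  Parts (2) and (3) concern the commutator \<open>C\<close> of the two matrices.  It satisfies
  \<open>(C - 1) (C\<^sup>2 - 2 c C + 1) = 0\<close> with \<open>c = comm_cos t\<close>, so for \<open>-1 < c < 1\<close> it is conjugate to a
  rotation by the angle \<open>arccos c\<close>.  If the angle is a rational multiple of \<open>\<pi>\<close>, then \<open>C\<close> has finite order, while the
  commutator of a generating pair has infinite order in the free group; otherwise the powers of \<open>C\<close>
  come arbitrarily close to the identity and none of them is scalar.

  For part (4), a group inside a conjugate of \<open>PO(2,1)\<close> preserves a nondegenerate quadratic form up
  to scalars.  Invariance under the diagonal matrix leaves the forms \<open>\<alpha> y\<^sup>2 + 2 \<beta> x z\<close>, and the other
  generator preserves one of these only if \<open>t = 2\<close>.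
\<close>

section \<open>Reduced words and the length function of a free group\<close>

definition inverse_word :: "('g \<times> bool) list \<Rightarrow> ('g \<times> bool) list" where
  "inverse_word w = rev (map (\<lambda>(x, s). (x, \<not> s)) w)"

lemma length_inverse_word [simp]: "length (inverse_word w) = length w"
  by (simp add: inverse_word_def)

lemma fst_set_inverse_word [simp]: "fst ` set (inverse_word w) = fst ` set w"
  by (force simp: inverse_word_def)

lemma reduced_inverse_word: "reduced_word w \<Longrightarrow> reduced_word (inverse_word w)"
  unfolding reduced_word_def inverse_word_def successively_rev successively_map
  by (erule successively_mono) (auto split: prod.splits)

lemma reduced_word_append:
  "reduced_word (u @ w) \<longleftrightarrow> reduced_word u \<and> reduced_word w \<and>
    (u \<noteq> [] \<longrightarrow> w \<noteq> [] \<longrightarrow> fst (last u) = fst (hd w) \<longrightarrow> snd (last u) = snd (hd w))"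
  unfolding reduced_word_def successively_append_iff by (auto simp: case_prod_unfold)

lemma reduced_word_Cons:
  "reduced_word (l # w) \<longleftrightarrow> reduced_word w \<and> (w \<noteq> [] \<longrightarrow> fst l = fst (hd w) \<longrightarrow> snd l = snd (hd w))"
  using reduced_word_append[of "[l]" w] by (auto simp: reduced_word_def)

lemma reduced_word_Nil [simp]: "reduced_word []"
  by (simp add: reduced_word_def)

lemma word_value_Nil [simp]: "word_value G [] = \<one>\<^bsub>G\<^esub>"
  by (simp add: word_value_def)

context group
begin

definition letter_value :: "'a \<times> bool \<Rightarrow> 'a" where
  "letter_value l = (if snd l then inv (fst l) else fst l)"

lemma word_value_Cons [simp]: "word_value G (l # w) = letter_value l \<otimes> word_value G w"
  by (simp add: word_value_def letter_value_def case_prod_unfold)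

lemma letter_value_closed [simp]: "fst l \<in> carrier G \<Longrightarrow> letter_value l \<in> carrier G"
  by (simp add: letter_value_def)

lemma word_value_closed: "fst ` set w \<subseteq> carrier G \<Longrightarrow> word_value G w \<in> carrier G"
  by (induction w) auto

lemma word_value_append:
  assumes "fst ` set u \<subseteq> carrier G" "fst ` set w \<subseteq> carrier G"
  shows "word_value G (u @ w) = word_value G u \<otimes> word_value G w"
  using assms by (induction u) (auto simp: m_assoc word_value_closed)

lemma word_value_inverse_word:
  assumes "fst ` set w \<subseteq> carrier G"
  shows "word_value G (inverse_word w) = inv (word_value G w)"
  using assms
proof (induction w)
  case (Cons l w)
  have "inverse_word (l # w) = inverse_word w @ [(fst l, \<not> snd l)]"
    by (simp add: inverse_word_def case_prod_unfold)
  then show ?case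
    using Cons by (auto simp: word_value_append inv_mult_group word_value_closed letter_value_def)
qed (simp add: inverse_word_def)

lemma exists_reduced_word:
  assumes "fst ` set w \<subseteq> S" "S \<subseteq> carrier G"
  shows "\<exists>w'. fst ` set w' \<subseteq> S \<and> reduced_word w' \<and> word_value G w' = word_value G w"
  using assms(1)
proof (induction w)
  case (Cons l w)
  then obtain w' where w': "fst ` set w' \<subseteq> S" "reduced_word w'" "word_value G w' = word_value G w"
    by auto
  show ?case
  proof (cases "w' \<noteq> [] \<and> fst l = fst (hd w') \<and> snd l \<noteq> snd (hd w')")
    case True
    then obtain w'' where w'': "w' = (fst l, \<not> snd l) # w''"
      by (cases w') auto
    have "fst ` set w'' \<subseteq> carrier G" "fst l \<in> carrier G"
      using w' w'' assms(2) Cons.prems by auto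
    then have "letter_value l \<otimes> letter_value (fst l, \<not> snd l) = \<one>" "word_value G w'' \<in> carrier G"
      using word_value_closed[of w''] by (auto simp: letter_value_def)
    then have "word_value G (l # w) = word_value G w''"
      using \<open>fst l \<in> carrier G\<close> unfolding word_value_Cons w'(3)[symmetric] w''
      by (subst m_assoc[symmetric]) simp_all
    then show ?thesis using w' w'' by (intro exI[of _ w'']) (auto simp: reduced_word_Cons)
  next
    case False
    then show ?thesis using w' Cons.prems by (intro exI[of _ "l # w'"]) (auto simp: reduced_word_Cons)
  qed
qed (auto intro: exI[of _ "[]"])

lemma generate_reduced_word:
  assumes "S \<subseteq> carrier G" "g \<in> generate G S"
  obtains w where "fst ` set w \<subseteq> S" "reduced_word w" "word_value G w = g"
proof -
  have "\<exists>w. fst ` set w \<subseteq> S \<and> word_value G w = g"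
    using assms(2)
  proof induction
    case one then show ?case by (intro exI[of _ "[]"]) simp
  next
    case (incl h) then show ?case using assms(1)
      by (intro exI[of _ "[(h, False)]"]) (auto simp: letter_value_def)
  next
    case (inv h) then show ?case using assms(1)
      by (intro exI[of _ "[(h, True)]"]) (auto simp: letter_value_def)
  next
    case (eng g h)
    then obtain u w where "fst ` set u \<subseteq> S" "word_value G u = g" "fst ` set w \<subseteq> S" "word_value G w = h"
      by blast
    moreover from this have "word_value G (u @ w) = word_value G u \<otimes> word_value G w"
      using assms(1) by (intro word_value_append) blast+
    ultimately show ?case by (intro exI[of _ "u @ w"]) (simp add: image_Un)
  qed
  then obtain w where "fst ` set w \<subseteq> S" "word_value G w = g" by blast
  then show thesis using exists_reduced_word[of w S] assms(1) that by auto
qed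

end

locale free_group = group G for G (structure) +
  fixes B
  assumes basis: "free_basis G B"
begin

lemma B_carrier: "B \<subseteq> carrier G" and generate_B: "generate G B = carrier G"
  and reduced_nontrivial: "\<lbrakk>w \<noteq> []; fst ` set w \<subseteq> B; reduced_word w\<rbrakk> \<Longrightarrow> word_value G w \<noteq> \<one>"
  using basis unfolding free_basis_def by simp_all

definition normal_form :: "'a \<Rightarrow> ('a \<times> bool) list" where
  "normal_form g = (SOME w. fst ` set w \<subseteq> B \<and> reduced_word w \<and> word_value G w = g)"

lemma normal_form:
  assumes "g \<in> carrier G"
  shows "fst ` set (normal_form g) \<subseteq> B" "reduced_word (normal_form g)" "word_value G (normal_form g) = g"
proof -
  have "g \<in> generate G B" using assms generate_B by simp
  then obtain w where "fst ` set w \<subseteq> B" "reduced_word w" "word_value G w = g"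
    by (rule generate_reduced_word[OF B_carrier])
  then have "\<exists>w. fst ` set w \<subseteq> B \<and> reduced_word w \<and> word_value G w = g" by blast
  from someI_ex[OF this, folded normal_form_def]
  show "fst ` set (normal_form g) \<subseteq> B" "reduced_word (normal_form g)" "word_value G (normal_form g) = g"
    by blast+
qed

text \<open>The reduced word of a quotient is obtained by deleting the longest common prefix: after it the two
words continue with different letters, so nothing more can cancel.  Uniqueness of reduced words and
all length formulas below are read off from this.\<close>

lemma cancel_common_prefix:
  assumes u: "fst ` set u \<subseteq> B" "reduced_word u" and w: "fst ` set w \<subseteq> B" "reduced_word w"
  obtains p r r' where "p = longest_common_prefix u w" "u = p @ r" "w = p @ r'"
    "reduced_word (inverse_word r @ r')" "fst ` set (inverse_word r @ r') \<subseteq> B"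
    "word_value G (inverse_word r @ r') = inv (word_value G u) \<otimes> word_value G w"
proof -
  define p where "p = longest_common_prefix u w"
  obtain r where r: "u = p @ r"
    using longest_common_prefix_prefix1[of u w] by (auto simp: p_def prefix_def)
  obtain r' where r': "w = p @ r'"
    using longest_common_prefix_prefix2[of u w] by (auto simp: p_def prefix_def)
  have ne: "hd r \<noteq> hd r'" if "r \<noteq> []" "r' \<noteq> []"
  proof
    assume eq: "hd r = hd r'"
    have "prefix (p @ [hd r]) (p @ s)" if "s \<noteq> []" "hd s = hd r" for s
      using that by (cases s) (auto simp: prefix_def)
    from this[of r] this[of r'] have "prefix (p @ [hd r]) (longest_common_prefix u w)"
      unfolding r r' using that eq by (intro longest_common_prefix_max_prefix) auto
    from prefix_length_le[OF this] show False by (simp flip: p_def)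
  qed
  have "reduced_word (inverse_word r @ r')"
    unfolding reduced_word_append
  proof (intro conjI impI)
    show "reduced_word (inverse_word r)" "reduced_word r'"
      using u(2) w(2) by (auto simp: r r' reduced_word_append reduced_inverse_word)
    assume a: "inverse_word r \<noteq> []" "r' \<noteq> []" "fst (last (inverse_word r)) = fst (hd r')"
    then have "r \<noteq> []" by (auto simp: inverse_word_def)
    then have "last (inverse_word r) = (fst (hd r), \<not> snd (hd r))"
      by (simp add: inverse_word_def last_rev hd_map case_prod_unfold)
    then show "snd (last (inverse_word r)) = snd (hd r')"
      using ne \<open>r \<noteq> []\<close> a by (auto simp: prod_eq_iff)
  qed
  moreover have B: "fst ` set p \<subseteq> B" "fst ` set r \<subseteq> B" "fst ` set r' \<subseteq> B"
    using u(1) w(1) by (auto simp: r r')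
  then have "fst ` set (inverse_word r @ r') \<subseteq> B" by (simp add: image_Un)
  moreover have car: "fst ` set p \<subseteq> carrier G" "fst ` set r \<subseteq> carrier G" "fst ` set r' \<subseteq> carrier G"
    using B B_carrier by blast+
  then have "word_value G (inverse_word r @ r') = inv (word_value G u) \<otimes> word_value G w"
  proof -
    define P R R' where "P = word_value G p" and "R = word_value G r" and "R' = word_value G r'"
    have PR: "P \<in> carrier G" "R \<in> carrier G" "R' \<in> carrier G"
      using car word_value_closed by (auto simp: P_def R_def R'_def)
    then have "inv (P \<otimes> R) \<otimes> (P \<otimes> R') = inv R \<otimes> (inv P \<otimes> P) \<otimes> R'"
      by (simp only: inv_mult_group m_assoc m_closed inv_closed)
    also have "\<dots> = inv R \<otimes> R'" using PR by simp
    finally show ?thesis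
      using car by (simp add: r r' word_value_append word_value_inverse_word P_def R_def R'_def)
  qed
  ultimately show thesis using that r r' p_def by blast
qed

lemma reduced_word_unique:
  assumes u: "fst ` set u \<subseteq> B" "reduced_word u" and w: "fst ` set w \<subseteq> B" "reduced_word w"
    and eq: "word_value G u = word_value G w"
  shows "u = w"
proof -
  obtain p r r' where pr: "u = p @ r" "w = p @ r'" "reduced_word (inverse_word r @ r')"
    "fst ` set (inverse_word r @ r') \<subseteq> B"
    "word_value G (inverse_word r @ r') = inv (word_value G u) \<otimes> word_value G w"
    by (rule cancel_common_prefix[OF u w])
  have "word_value G u \<in> carrier G" using u B_carrier by (auto intro: word_value_closed)
  then have "word_value G (inverse_word r @ r') = \<one>" unfolding pr(5) eq[symmetric] by simp
  then have "inverse_word r @ r' = []" using reduced_nontrivial[OF _ pr(4,3)] by blast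
  then show ?thesis using pr by (simp add: inverse_word_def)
qed

lemma normal_form_value:
  assumes "fst ` set w \<subseteq> B" "reduced_word w"
  shows "normal_form (word_value G w) = w"
proof -
  have "word_value G w \<in> carrier G" using assms B_carrier by (auto intro: word_value_closed)
  from normal_form[OF this] show ?thesis by (intro reduced_word_unique assms)
qed

lemma normal_form_one [simp]: "normal_form \<one> = []"
  using normal_form_value[of "[]"] by simp

definition len :: "'a \<Rightarrow> nat" where
  "len g = length (normal_form g)"

text \<open>The Gromov product based at the identity: in the Cayley tree, the length of the segment shared by
the paths from the identity to the two elements.\<close>

definition overlap :: "'a \<Rightarrow> 'a \<Rightarrow> nat" where
  "overlap g h = length (longest_common_prefix (normal_form g) (normal_form h))"

lemma normal_form_quotient:
  assumes "g \<in> carrier G" "h \<in> carrier G"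
  obtains p r r' where "normal_form g = p @ r" "normal_form h = p @ r'" "length p = overlap g h"
    "normal_form (inv g \<otimes> h) = inverse_word r @ r'"
proof (rule cancel_common_prefix[of "normal_form g" "normal_form h"])
  fix p r r' assume *: "p = longest_common_prefix (normal_form g) (normal_form h)"
    "normal_form g = p @ r" "normal_form h = p @ r'" "reduced_word (inverse_word r @ r')"
    "fst ` set (inverse_word r @ r') \<subseteq> B"
    "word_value G (inverse_word r @ r') = inv (word_value G (normal_form g)) \<otimes> word_value G (normal_form h)"
  have nf: "normal_form (inv g \<otimes> h) = inverse_word r @ r'"
    using normal_form_value[OF *(5,4)] unfolding *(6) normal_form(3)[OF assms(1)] normal_form(3)[OF assms(2)] .
  have "length p = overlap g h" unfolding overlap_def by (rule arg_cong[OF *(1)])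
  then show thesis by (rule that[OF *(2,3) _ nf])
qed (simp_all only: normal_form assms)

lemma normal_form_inv:
  assumes "g \<in> carrier G"
  shows "normal_form (inv g) = inverse_word (normal_form g)"
  by (rule normal_form_quotient[of g \<one>]) (use assms in auto)

lemma len_one [simp]: "len \<one> = 0"
  by (simp add: len_def)

lemma len_inv [simp]: "g \<in> carrier G \<Longrightarrow> len (inv g) = len g"
  by (simp add: len_def normal_form_inv)

lemma len_eq_0_iff: "g \<in> carrier G \<Longrightarrow> len g = 0 \<longleftrightarrow> g = \<one>"
  using normal_form(3)[of g] by (auto simp: len_def)

lemma len_quotient:
  assumes "g \<in> carrier G" "h \<in> carrier G"
  shows "len (inv g \<otimes> h) + 2 * overlap g h = len g + len h"
  by (rule normal_form_quotient[OF assms]) (simp add: len_def)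

lemma len_mult:
  assumes "g \<in> carrier G" "h \<in> carrier G"
  shows "len (g \<otimes> h) + 2 * overlap (inv g) h = len g + len h"
  using len_quotient[of "inv g" h] assms by simp

lemma overlap_commute: "overlap g h = overlap h g"
proof -
  have "length (longest_common_prefix u w) \<le> length (longest_common_prefix w u)" for u w :: "('a \<times> bool) list"
    by (intro prefix_length_le longest_common_prefix_max_prefix
        longest_common_prefix_prefix1 longest_common_prefix_prefix2)
  then show ?thesis unfolding overlap_def by (simp add: antisym)
qed

lemma overlap_le: "overlap g h \<le> len g" "overlap g h \<le> len h"
  unfolding overlap_def len_def
  by (intro prefix_length_le longest_common_prefix_prefix1 longest_common_prefix_prefix2)+

text \<open>The tree property.  Together with \<open>len_quotient\<close> it lets the cancellation arguments below be carried
out with numbers instead of words.\<close>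

lemma overlap_ultrametric: "min (overlap g h) (overlap h k) \<le> overlap g k"
proof -
  let ?g = "normal_form g" and ?h = "normal_form h" and ?k = "normal_form k"
  let ?p = "longest_common_prefix ?g ?h" and ?q = "longest_common_prefix ?h ?k"
  have h: "prefix ?p ?h" "prefix ?q ?h"
    by (rule longest_common_prefix_prefix1 longest_common_prefix_prefix2)+
  then consider "prefix ?p ?q" | "prefix ?q ?p" by (metis prefix_same_cases)
  then show ?thesis
  proof cases
    case 1
    then have "prefix ?p ?k" using longest_common_prefix_prefix2 prefix_order.trans by blast
    then have "length ?p \<le> overlap g k" unfolding overlap_def
      by (intro prefix_length_le longest_common_prefix_max_prefix longest_common_prefix_prefix1)
    then show ?thesis by (simp add: overlap_def)
  next
    case 2
    then have "prefix ?q ?g" using longest_common_prefix_prefix1 prefix_order.trans by blast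
    then have "length ?q \<le> overlap g k" unfolding overlap_def
      by (intro prefix_length_le longest_common_prefix_max_prefix longest_common_prefix_prefix2)
    then show ?thesis by (simp add: overlap_def)
  qed
qed

lemma exists_prefix:
  assumes g: "g \<in> carrier G" and m: "m \<le> len g"
  obtains p where "p \<in> carrier G" "len p = m" "len (inv p \<otimes> g) = len g - m" "overlap p g = m"
proof -
  define w where "w = normal_form g"
  define p where "p = word_value G (take m w)"
  have w: "fst ` set w \<subseteq> B" "reduced_word w" "word_value G w = g"
    using normal_form g by (auto simp: w_def)
  have take: "fst ` set (take m w) \<subseteq> B" "reduced_word (take m w)"
    using w(1,2) reduced_word_append[of "take m w" "drop m w"] set_take_subset[of m w] by auto
  have p: "p \<in> carrier G" unfolding p_def using take B_carrier by (auto intro: word_value_closed)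
  have nf: "normal_form p = take m w" using normal_form_value take by (simp add: p_def)
  then have len: "len p = m" using m by (simp add: len_def w_def)
  have "prefix (take m w) (longest_common_prefix (take m w) w)"
    by (rule longest_common_prefix_max_prefix) (auto intro: take_is_prefix)
  then have "m \<le> overlap p g"
    using prefix_length_le m by (force simp: overlap_def nf len_def simp flip: w_def)
  then have o: "overlap p g = m" using overlap_le(1)[of p g] len by simp
  show thesis using that[OF p len _ o] len_quotient[OF p g] o len by simp
qed

text \<open>If half of \<open>g\<close> cancelled in \<open>g \<otimes> g\<close>, the middle letter, or the two middle letters, of the reduced word
of \<open>g\<close> would be inverse to itself, respectively to each other.\<close>

lemma overlap_inv_less_half:
  assumes g: "g \<in> carrier G" and ne: "g \<noteq> \<one>"
  shows "2 * overlap g (inv g) < len g"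
proof (rule ccontr)
  assume *: "\<not> ?thesis"
  define w where "w = normal_form g"
  define n where "n = length w"
  have n: "0 < n" using len_eq_0_iff[OF g] ne by (simp add: n_def w_def len_def)
  have agree: "w ! i = inverse_word w ! i" if "i < overlap g (inv g)" for i
  proof -
    let ?p = "longest_common_prefix w (inverse_word w)"
    have "i < length ?p" using that by (simp add: overlap_def normal_form_inv[OF g] w_def)
    moreover obtain r r' where "w = ?p @ r" "inverse_word w = ?p @ r'"
      using longest_common_prefix_prefix1[of w "inverse_word w"]
        longest_common_prefix_prefix2[of w "inverse_word w"] by (auto simp: prefix_def)
    ultimately show ?thesis by (metis nth_append)
  qed
  have flip: "inverse_word w ! i = (fst (w ! (n - Suc i)), \<not> snd (w ! (n - Suc i)))" if "i < n" for i
    using that by (simp add: inverse_word_def rev_nth n_def case_prod_unfold)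
  \<comment> \<open>the position of the middle letter, or of the first of the two middle letters\<close>
  define i where "i = (n - 1) div 2"
  have "i < overlap g (inv g)" "i < n"
  proof -
    have "n \<le> 2 * overlap g (inv g)" using * by (simp add: len_def n_def w_def)
    then show "i < overlap g (inv g)" "i < n" unfolding i_def using n by presburger+
  qed
  then have eq: "w ! i = (fst (w ! (n - Suc i)), \<not> snd (w ! (n - Suc i)))"
    using agree flip by simp
  show False
  proof (cases "even n")
    case True
    then have "n - Suc i = Suc i" "Suc i < n" unfolding i_def using n by presburger+
    moreover have "reduced_word w" using normal_form g by (simp add: w_def)
    ultimately show False
      using eq unfolding reduced_word_def successively_conv_nth n_def by (auto simp: case_prod_unfold)
  next
    case False
    then have "n - Suc i = i" unfolding i_def using n by presburger
    then show False using eq by (metis prod.collapse prod.inject)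
  qed
qed

lemma len_basis: "b \<in> B \<Longrightarrow> len b = 1"
  using normal_form_value[of "[(b, False)]"] B_carrier
  by (auto simp: len_def letter_value_def reduced_word_def)

definition exponent_sum :: "'a \<Rightarrow> 'a \<Rightarrow> int" where
  "exponent_sum b g = (\<Sum>(x, s)\<leftarrow>normal_form g. if x = b then if s then -1 else 1 else 0)"

lemma exponent_sum_quotient:
  assumes "g \<in> carrier G" "h \<in> carrier G"
  shows "exponent_sum b (inv g \<otimes> h) = exponent_sum b h - exponent_sum b g"
proof -
  let ?f = "\<lambda>w. (\<Sum>(x, s)\<leftarrow>w. if x = b then if s then -1 else 1 else 0 :: int)"
  have neg: "?f (inverse_word w) = - ?f w" for w
    by (induction w) (auto simp: inverse_word_def)
  show ?thesis
    by (rule normal_form_quotient[OF assms]) (simp add: exponent_sum_def neg)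
qed

lemma exponent_sum_mult:
  assumes "g \<in> carrier G" "h \<in> carrier G"
  shows "exponent_sum b (g \<otimes> h) = exponent_sum b g + exponent_sum b h"
proof -
  have "exponent_sum b \<one> = 0" by (simp add: exponent_sum_def)
  then show ?thesis
    using exponent_sum_quotient[of "inv g" h b] exponent_sum_quotient[of g \<one> b] assms by simp
qed

lemma exponent_sum_basis: "x \<in> B \<Longrightarrow> exponent_sum b x = (if x = b then 1 else 0)"
  using normal_form_value[of "[(x, False)]"] B_carrier
  by (auto simp: exponent_sum_def letter_value_def reduced_word_def)

text \<open>The evident word for a power of the commutator is already reduced.\<close>

lemma commutator_power_nontrivial:
  assumes "x \<in> B" "y \<in> B" "x \<noteq> y" "0 < (n::nat)"
  shows "(x \<otimes> y \<otimes> inv x \<otimes> inv y) [^] n \<noteq> \<one>"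
proof -
  define c where "c = [(x, False), (y, False), (x, True), (y, True)]"
  define w where "w = concat (replicate n c)"
  have xy: "x \<in> carrier G" "y \<in> carrier G" using assms B_carrier by auto
  have c: "word_value G c = x \<otimes> y \<otimes> inv x \<otimes> inv y"
    using xy by (simp add: c_def letter_value_def m_assoc)
  have "fst ` set (concat (replicate n c)) \<subseteq> B \<and> reduced_word (concat (replicate n c)) \<and>
      (n > 0 \<longrightarrow> concat (replicate n c) \<noteq> [] \<and> hd (concat (replicate n c)) = (x, False)) \<and>
      word_value G (concat (replicate n c)) = (x \<otimes> y \<otimes> inv x \<otimes> inv y) [^] n" for n
  proof (induction n)
    case (Suc n)
    have "fst ` set (concat (replicate n c)) \<subseteq> carrier G" "fst ` set c \<subseteq> carrier G"
      using Suc B_carrier assms by (auto simp: c_def)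
    then have "word_value G (concat (replicate (Suc n) c)) = word_value G c \<otimes> word_value G (concat (replicate n c))"
      by (simp add: word_value_append)
    also have "\<dots> = (x \<otimes> y \<otimes> inv x \<otimes> inv y) [^] Suc n"
    proof -
      have IH: "word_value G (concat (replicate n c)) = (x \<otimes> y \<otimes> inv x \<otimes> inv y) [^] n"
        using Suc by blast
      show ?thesis unfolding c IH by (rule nat_pow_Suc2[symmetric]) (use xy in simp)
    qed
    finally show ?case
      using Suc assms by (cases n) (auto simp: c_def reduced_word_Cons reduced_word_append)
  qed simp
  then show ?thesis using reduced_nontrivial[of w] assms(4) unfolding w_def by metis
qed

lemma basis_not_commute:
  assumes "x \<in> B" "y \<in> B" "x \<noteq> y"
  shows "x \<otimes> y \<noteq> y \<otimes> x"
proof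
  assume *: "x \<otimes> y = y \<otimes> x"
  have xy: "x \<in> carrier G" "y \<in> carrier G" using assms B_carrier by auto
  have "x \<otimes> y \<otimes> inv x \<otimes> inv y = \<one>" using xy by (simp add: * m_assoc)
  then show False using commutator_power_nontrivial[OF assms, of 1] xy by simp
qed

end

section \<open>Nielsen equivalence of generating pairs\<close>

text \<open>Simultaneous conjugation is a composite of the other moves in a group generated by the pair; having
it as a move of its own makes the reduction to a minimal pair shorter.\<close>

inductive nielsen_equiv :: "('a, 'm) monoid_scheme \<Rightarrow> 'a \<Rightarrow> 'a \<Rightarrow> 'a \<Rightarrow> 'a \<Rightarrow> bool"
  for G and u v where
  base: "nielsen_equiv G u v u v"
| invert: "nielsen_equiv G u v a b \<Longrightarrow> nielsen_equiv G u v (inv\<^bsub>G\<^esub> a) b"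
| swap: "nielsen_equiv G u v a b \<Longrightarrow> nielsen_equiv G u v b a"
| mult: "nielsen_equiv G u v a b \<Longrightarrow> nielsen_equiv G u v (a \<otimes>\<^bsub>G\<^esub> b) b"
| conj: "\<lbrakk>nielsen_equiv G u v a b; h \<in> carrier G\<rbrakk> \<Longrightarrow>
    nielsen_equiv G u v (h \<otimes>\<^bsub>G\<^esub> a \<otimes>\<^bsub>G\<^esub> inv\<^bsub>G\<^esub> h) (h \<otimes>\<^bsub>G\<^esub> b \<otimes>\<^bsub>G\<^esub> inv\<^bsub>G\<^esub> h)"

lemma nielsen_equiv_trans:
  assumes "nielsen_equiv G u v a b" "nielsen_equiv G a b c d"
  shows "nielsen_equiv G u v c d"
  using assms(2,1)
proof induction
  case (invert c d)
  then show ?case using nielsen_equiv.invert[of G u v c d] by blast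
next
  case (swap c d)
  then show ?case using nielsen_equiv.swap[of G u v c d] by blast
next
  case (mult c d)
  then show ?case using nielsen_equiv.mult[of G u v c d] by blast
next
  case (conj c d h)
  then show ?case using nielsen_equiv.conj[of G u v c d h] by blast
qed

context group
begin

lemma nielsen_equiv_closed:
  assumes "nielsen_equiv G u v a b" "u \<in> carrier G" "v \<in> carrier G"
  shows "a \<in> carrier G \<and> b \<in> carrier G"
  using assms by induction auto

lemma nielsen_equiv_invert2: "nielsen_equiv G u v a b \<Longrightarrow> nielsen_equiv G u v a (inv b)"
  by (rule nielsen_equiv.swap[OF nielsen_equiv.invert[OF nielsen_equiv.swap]])

lemma cancel_left_inverse: "\<lbrakk>h \<in> carrier G; z \<in> carrier G\<rbrakk> \<Longrightarrow> inv h \<otimes> (h \<otimes> z) = z"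
  by (subst m_assoc[symmetric]) simp_all

lemma conjugate_back: "\<lbrakk>h \<in> carrier G; a \<in> carrier G\<rbrakk> \<Longrightarrow> inv h \<otimes> (h \<otimes> a \<otimes> inv h) \<otimes> h = a"
  by (simp add: m_assoc cancel_left_inverse)

lemma nielsen_equiv_sym:
  assumes "nielsen_equiv G u v a b" "u \<in> carrier G" "v \<in> carrier G"
  shows "nielsen_equiv G a b u v"
  using assms
proof induction
  case base
  show ?case by (rule nielsen_equiv.base)
next
  case (invert a b)
  then have "a \<in> carrier G" using nielsen_equiv_closed by blast
  have "nielsen_equiv G (inv a) b (inv (inv a)) b" by (rule nielsen_equiv.invert[OF nielsen_equiv.base])
  then have "nielsen_equiv G (inv a) b a b" using \<open>a \<in> carrier G\<close> by simp
  then show ?case by (rule nielsen_equiv_trans[OF _ invert.IH[OF invert.prems]])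
next
  case (swap a b)
  have "nielsen_equiv G b a a b" by (rule nielsen_equiv.swap[OF nielsen_equiv.base])
  then show ?case by (rule nielsen_equiv_trans[OF _ swap.IH[OF swap.prems]])
next
  case (mult a b)
  then have ab: "a \<in> carrier G" "b \<in> carrier G" using nielsen_equiv_closed by blast+
  have "nielsen_equiv G (a \<otimes> b) b (a \<otimes> b \<otimes> inv b) (inv (inv b))"
    by (rule nielsen_equiv_invert2[OF nielsen_equiv.mult[OF nielsen_equiv_invert2[OF nielsen_equiv.base]]])
  then have "nielsen_equiv G (a \<otimes> b) b a b" using ab by (simp add: m_assoc)
  then show ?case by (rule nielsen_equiv_trans[OF _ mult.IH[OF mult.prems]])
next
  case (conj a b h)
  then have ab: "a \<in> carrier G" "b \<in> carrier G" using nielsen_equiv_closed by blast+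
  let ?a = "h \<otimes> a \<otimes> inv h" and ?b = "h \<otimes> b \<otimes> inv h"
  have "nielsen_equiv G ?a ?b (inv h \<otimes> ?a \<otimes> inv (inv h)) (inv h \<otimes> ?b \<otimes> inv (inv h))"
    by (rule nielsen_equiv.conj[OF nielsen_equiv.base]) (use conj in simp)
  then have "nielsen_equiv G ?a ?b a b" using ab conj(2) by (simp only: inv_inv conjugate_back)
  then show ?case by (rule nielsen_equiv_trans[OF _ conj.IH[OF conj.prems]])
qed

lemma generate_eq_carrierI:
  assumes "generate G S = carrier G" "S \<subseteq> generate G T" "T \<subseteq> carrier G"
  shows "generate G T = carrier G"
  using generate_subgroup_incl[OF assms(2) generate_is_subgroup[OF assms(3)]] generate_incl[OF assms(3)]
  unfolding assms(1) by (rule equalityI[rotated])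

lemma nielsen_equiv_generates:
  assumes "nielsen_equiv G u v a b" "u \<in> carrier G" "v \<in> carrier G" "generate G {u, v} = carrier G"
  shows "generate G {a, b} = carrier G"
  using assms
proof induction
  case (invert a b)
  then have ab: "a \<in> carrier G" "b \<in> carrier G" using nielsen_equiv_closed by blast+
  have "inv (inv a) \<in> generate G {inv a, b}" by (rule generate.inv) simp
  moreover have "b \<in> generate G {inv a, b}" by (rule generate.incl) simp
  ultimately show ?case
    using ab by (intro generate_eq_carrierI[OF invert.IH[OF invert.prems]]) simp_all
next
  case (swap a b)
  then show ?case by (simp add: insert_commute)
next
  case (mult a b)
  then have ab: "a \<in> carrier G" "b \<in> carrier G" using nielsen_equiv_closed by blast+
  have "(a \<otimes> b) \<otimes> inv b \<in> generate G {a \<otimes> b, b}"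
    by (rule generate.eng[OF generate.incl generate.inv]) simp_all
  moreover have "b \<in> generate G {a \<otimes> b, b}" by (rule generate.incl) simp
  ultimately show ?case
    using ab by (intro generate_eq_carrierI[OF mult.IH[OF mult.prems]]) (simp_all add: m_assoc)
next
  case (conj a b h)
  then have ab: "a \<in> carrier G" "b \<in> carrier G" using nielsen_equiv_closed by blast+
  define f where "f = (\<lambda>g. h \<otimes> g \<otimes> inv h)"
  have "f \<in> hom G G"
    using conj(2) by (intro homI) (simp_all add: f_def m_assoc cancel_left_inverse)
  then interpret f: group_hom G G f by unfold_locales
  have "g \<in> f ` carrier G" if "g \<in> carrier G" for g
  proof (rule image_eqI)
    show "g = f (inv h \<otimes> g \<otimes> h)"
      using conjugate_back[of "inv h" g] that conj(2) by (simp add: f_def)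
  qed (use that conj(2) in simp)
  moreover have "f ` carrier G \<subseteq> carrier G" by (intro image_subsetI f.hom_closed)
  ultimately have "f ` carrier G = carrier G" by (intro equalityI subsetI) auto
  moreover have "generate G (f ` {a, b}) = f ` generate G {a, b}"
    using ab by (intro f.generate_img) simp
  ultimately show ?case using conj.IH[OF conj.prems] by (simp add: f_def)
qed

text \<open>Used to see that no generating pair of a noncommutative group contains the identity.\<close>

lemma generate_commute:
  assumes "S \<subseteq> carrier G" "\<And>x y. x \<in> S \<Longrightarrow> y \<in> S \<Longrightarrow> x \<otimes> y = y \<otimes> x"
    and "g \<in> generate G S" "h \<in> generate G S"
  shows "g \<otimes> h = h \<otimes> g"
proof -
  have comm: "g \<otimes> x = x \<otimes> g"
    if "g \<in> generate G S" and x: "x \<in> carrier G" "\<And>s. s \<in> S \<Longrightarrow> s \<otimes> x = x \<otimes> s" for g x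
    using that(1)
  proof induction
    case (inv s)
    then have s: "s \<in> carrier G" "s \<otimes> x = x \<otimes> s" using assms(1) x by auto
    then have "inv s \<otimes> x = inv s \<otimes> (x \<otimes> s) \<otimes> inv s" using x by (simp add: m_assoc)
    also have "\<dots> = inv s \<otimes> (s \<otimes> x) \<otimes> inv s" by (simp only: s(2))
    also have "\<dots> = x \<otimes> inv s" using s(1) x(1) by (simp flip: m_assoc)
    finally show ?case .
  next
    case (eng g h)
    then have car: "g \<in> carrier G" "h \<in> carrier G" using generate_in_carrier[OF assms(1)] by blast+
    then have "g \<otimes> h \<otimes> x = g \<otimes> x \<otimes> h" using eng(4) x(1) by (simp add: m_assoc)
    then show ?case using eng(3) car x(1) by (simp add: m_assoc)
  qed (use x in auto)
  have "g \<in> carrier G" using assms(1,3) generate_in_carrier by blast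
  have "s \<otimes> g = g \<otimes> s" if "s \<in> S" for s
    using comm[OF assms(3), of s] assms(1,2) that by auto
  then show ?thesis using comm[OF assms(4) \<open>g \<in> carrier G\<close>] by simp
qed

end

context free_group
begin

text \<open>Minimality is taken over the whole class, conjugates included.  This replaces the usual well-ordering
of words that breaks ties between pairs of the same length.\<close>

definition minimal_pair :: "'a \<Rightarrow> 'a \<Rightarrow> bool" where
  "minimal_pair a b \<longleftrightarrow> a \<in> carrier G \<and> b \<in> carrier G \<and>
     (\<forall>c d. nielsen_equiv G a b c d \<longrightarrow> len a + len b \<le> len c + len d)"

lemma minimal_pairD:
  assumes "minimal_pair a b"
  shows "a \<in> carrier G" "b \<in> carrier G" "nielsen_equiv G a b c d \<Longrightarrow> len a + len b \<le> len c + len d"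
  using assms by (auto simp: minimal_pair_def)

lemma minimal_pair_swap:
  assumes "minimal_pair a b"
  shows "minimal_pair b a"
proof -
  note ab = minimal_pairD[OF assms]
  have "len b + len a \<le> len c + len d" if "nielsen_equiv G b a c d" for c d
    using ab(3)[OF nielsen_equiv_trans[OF nielsen_equiv.swap[OF nielsen_equiv.base] that]] by simp
  then show ?thesis using ab by (simp add: minimal_pair_def)
qed

lemma minimal_pair_invert:
  assumes "minimal_pair a b"
  shows "minimal_pair (inv a) b"
proof -
  note ab = minimal_pairD[OF assms]
  have "len (inv a) + len b \<le> len c + len d" if "nielsen_equiv G (inv a) b c d" for c d
  proof -
    have "nielsen_equiv G a b (inv a) b" by (rule nielsen_equiv.invert[OF nielsen_equiv.base])
    from ab(3)[OF nielsen_equiv_trans[OF this that]] show ?thesis using ab(1) by simp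
  qed
  then show ?thesis using ab by (simp add: minimal_pair_def)
qed

text \<open>In a minimal pair, no product of one element with the other is shorter than either factor.\<close>

lemma minimal_pair_overlap:
  assumes "minimal_pair a b"
  shows "2 * overlap (inv a) b \<le> len a" "2 * overlap (inv a) b \<le> len b"
proof -
  have *: "len b \<le> len (a \<otimes> b)" "len a \<le> len (a \<otimes> b)" if "minimal_pair a b" for a b
  proof -
    note ab = minimal_pairD[OF that]
    have "nielsen_equiv G a b (a \<otimes> b) b" by (rule nielsen_equiv.mult[OF nielsen_equiv.base])
    from ab(3)[OF this] show "len a \<le> len (a \<otimes> b)" by simp
    have "nielsen_equiv G a b (inv b \<otimes> inv a) (inv a)"
      by (rule nielsen_equiv.mult[OF nielsen_equiv.invert[OF nielsen_equiv.swap[OF nielsen_equiv.invert[OF nielsen_equiv.base]]]])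
    from ab(3)[OF this] show "len b \<le> len (a \<otimes> b)"
      using ab(1,2) len_inv[of "a \<otimes> b"] by (simp add: inv_mult_group)
  qed
  show "2 * overlap (inv a) b \<le> len a" "2 * overlap (inv a) b \<le> len b"
    using *[OF assms] len_mult[of a b] minimal_pairD(1,2)[OF assms] by linarith+
qed

text \<open>The tie case of Nielsen reduction: one half of \<open>v\<close> cancels against \<open>x\<close> on the left and the other half
against \<open>x\<close> on the right.  Then \<open>v = p q\<^sup>-\<^sup>1\<close> and \<open>x = q z' p\<^sup>-\<^sup>1\<close> with \<open>p\<close> and \<open>q\<close> half as long as \<open>v\<close>, and
conjugating the pair \<open>(x v, v)\<close> by \<open>q\<close> makes it shorter than \<open>(x, v)\<close>.\<close>

lemma no_full_cancellation_aux:
  assumes min: "minimal_pair x v" and v: "v \<noteq> \<one>"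
    and left: "2 * overlap (inv x) v = len v" and right: "2 * overlap (inv v) x = len v"
  shows False
proof -
  note car = minimal_pairD(1,2)[OF min]
  define m where "m = overlap (inv x) v"
  have m: "len v = 2 * m" "overlap (inv v) x = m" "0 < m"
    using left right v len_eq_0_iff[OF car(2)] by (auto simp: m_def)
  obtain p where p: "p \<in> carrier G" "len p = m" "len (inv p \<otimes> v) = m" "overlap p v = m"
    using exists_prefix[OF car(2), of m] m by auto
  \<comment> \<open>so that \<open>v = p \<otimes> inv q\<close> splits \<open>v\<close> into halves\<close>
  define q where "q = inv v \<otimes> p"
  have q: "q \<in> carrier G" "inv q = inv p \<otimes> v" using p car by (simp_all add: q_def inv_mult_group)
  then have lq: "len q = m" using p len_inv[of q] by simp
  have "inv q \<otimes> inv v = inv p" using p car q by (simp add: m_assoc)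
  then have oq: "overlap q (inv v) = m" using len_quotient[of q "inv v"] q p car lq m by simp
  have xp: "m \<le> overlap (inv x) p"
    using overlap_ultrametric[of "inv x" v p] p(4) overlap_commute[of p v] by (simp add: m_def)
  have qx: "overlap q x = m"
    using overlap_ultrametric[of q "inv v" x] oq m(2) overlap_le(1)[of q x] lq by simp
  have x2: "2 * m \<le> len x" using minimal_pair_overlap(1)[OF min] by (simp add: m_def)
  define z where "z = inv q \<otimes> x"
  have z: "z \<in> carrier G" using q(1) car by (simp add: z_def)
  have lz: "len z + m = len x" using len_quotient[of q x] q car lq qx by (simp add: z_def)
  have "z \<otimes> inv x = inv q" using q(1) car by (simp add: z_def m_assoc)
  then have "overlap (inv z) (inv x) + m = len x"
    using len_mult[of z "inv x"] z car lz lq q(1) by simp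
  then have "m \<le> overlap (inv z) p"
    using overlap_ultrametric[of "inv z" "inv x" p] xp x2 by simp
  then have lzp: "len (z \<otimes> p) + 2 * m \<le> len x"
    using len_mult[of z p] z p lz by simp
  have "nielsen_equiv G x v (inv q \<otimes> (x \<otimes> v) \<otimes> inv (inv q)) (inv q \<otimes> v \<otimes> inv (inv q))"
    by (rule nielsen_equiv.conj[OF nielsen_equiv.mult[OF nielsen_equiv.base]]) (use q(1) in simp)
  moreover have "v \<otimes> q = p" using p car by (simp add: q_def flip: m_assoc)
  then have "inv q \<otimes> (x \<otimes> v) \<otimes> inv (inv q) = z \<otimes> p" "inv q \<otimes> v \<otimes> inv (inv q) = inv q \<otimes> p"
    using q(1) p(1) car by (simp_all add: z_def m_assoc)
  ultimately have "len x + len v \<le> len (z \<otimes> p) + len (inv q \<otimes> p)"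
    using minimal_pairD(3)[OF min] by metis
  moreover have "len (inv q \<otimes> p) \<le> 2 * m" using len_quotient[of q p] q p lq by simp
  ultimately show False using lzp m by simp
qed

lemma no_full_cancellation:
  assumes min: "minimal_pair a v" and v: "v \<noteq> \<one>"
    and Z: "Z \<in> {a, inv a, v}" and Y: "Y \<in> {a, inv a, v}"
  shows "overlap (inv Z) v + overlap (inv v) Y < len v"
proof (rule ccontr)
  assume *: "\<not> ?thesis"
  note car = minimal_pairD(1,2)[OF min]
  have vv: "2 * overlap (inv v) v < len v"
    using overlap_inv_less_half[OF car(2) v] overlap_commute by metis
  have minx: "minimal_pair x v" if "x \<in> {a, inv a}" for x
    using that min minimal_pair_invert by auto
  have halfZ: "2 * overlap (inv x) v \<le> len v" if "x \<in> {a, inv a}" for x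
    by (rule minimal_pair_overlap(2)[OF minx[OF that]])
  have halfY: "2 * overlap (inv v) y \<le> len v" if "y \<in> {a, inv a}" for y
    by (rule minimal_pair_overlap(1)[OF minimal_pair_swap[OF minx[OF that]]])
  have "Z \<noteq> v" using * vv halfZ halfY Y by (cases "Y = v") fastforce+
  then have Z: "Z \<in> {a, inv a}" using Z by blast
  have "Y \<noteq> v" using * vv halfZ[OF Z] by fastforce
  then have Y: "Y \<in> {a, inv a}" using Y by blast
  have eq: "2 * overlap (inv Z) v = len v" "2 * overlap (inv v) Y = len v"
    using * halfZ[OF Z] halfY[OF Y] by linarith+
  have "Z = Y"
  proof (rule ccontr)
    assume "Z \<noteq> Y"
    then have "inv Z = Y" using Z Y car by auto
    then have "len v \<le> 2 * overlap (inv v) v"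
      using eq overlap_ultrametric[of "inv v" Y v] by simp
    then show False using vv by simp
  qed
  then show False using no_full_cancellation_aux[OF minx[OF Z] v] eq by simp
qed

lemma no_full_cancellation_letters:
  assumes min: "minimal_pair a b" and ne: "a \<noteq> \<one>" "b \<noteq> \<one>"
    and l: "fst l \<in> {a, b}" "fst l' \<in> {a, b}" "fst l'' \<in> {a, b}"
    and red: "reduced_word [l, l']" "reduced_word [l', l'']"
  shows "overlap (inv (letter_value l)) (letter_value l') +
    overlap (inv (letter_value l')) (letter_value l'') < len (letter_value l')"
proof -
  have main: ?thesis if min: "minimal_pair c d" and cd: "{c, d} = {a, b}" and l': "fst l' = d" for c d
  proof -
    note car = minimal_pairD(1,2)[OF min]
    have "d \<in> {a, b}" unfolding cd[symmetric] by simp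
    then have d: "d \<noteq> \<one>" using ne by auto
    have v: "letter_value l' = (if snd l' then inv d else d)" by (simp add: letter_value_def l')
    have mem: "letter_value k \<in> {c, inv c, letter_value l'}"
      if "fst k \<in> {a, b}" "fst k = fst l' \<Longrightarrow> snd k = snd l'" for k
    proof -
      have "fst k \<in> {c, d}" unfolding cd by (rule that(1))
      then show ?thesis using that(2) l' by (auto simp: letter_value_def)
    qed
    have "minimal_pair c (letter_value l')"
      using min minimal_pair_swap[OF minimal_pair_invert[OF minimal_pair_swap[OF min]]] by (simp add: v)
    moreover have "letter_value l' \<noteq> \<one>" using d car by (simp add: v)
    moreover have "letter_value l \<in> {c, inv c, letter_value l'}"
      using l(1) red(1) by (intro mem) (auto simp: reduced_word_Cons)
    moreover have "letter_value l'' \<in> {c, inv c, letter_value l'}"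
      using l(3) red(2) by (intro mem) (auto simp: reduced_word_Cons)
    ultimately show ?thesis by (rule no_full_cancellation)
  qed
  show ?thesis
  proof (cases "fst l' = b")
    case True
    then show ?thesis by (rule main[OF min refl])
  next
    case False
    then have "fst l' = a" using l(2) by simp
    then show ?thesis by (rule main[OF minimal_pair_swap[OF min] insert_commute])
  qed
qed

text \<open>Every factor of a reduced product keeps a letter that is not cancelled by its neighbours.  The
induction over the product follows the number \<open>E\<close> of letters at its end that come from the last
factor: the next factor cancels fewer than \<open>E\<close> letters, so by the tree property it cancels against
the product exactly what it cancels against the last factor alone.\<close>

lemma minimal_pair_len_word:
  assumes min: "minimal_pair a b" and ne: "a \<noteq> \<one>" "b \<noteq> \<one>"
    and w: "fst ` set w \<subseteq> {a, b}" "reduced_word w"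
  shows "length w \<le> len (word_value G w)"
proof -
  note car = minimal_pairD(1,2)[OF min]
  note strict = no_full_cancellation_letters[OF min ne]
  have letter: "letter_value l \<in> carrier G" if "fst l \<in> {a, b}" for l using that car by auto
  have self: "reduced_word [l, l]" for l :: "'a \<times> bool" by (simp add: reduced_word_Cons)
  define E where "E = (\<lambda>w. overlap (inv (word_value G w)) (inv (letter_value (last w))))"
  have inv: "w \<noteq> [] \<longrightarrow> length w \<le> len (word_value G w) + 1 - E w \<and> E w \<le> len (word_value G w) \<and>
      (\<forall>l. fst l \<in> {a, b} \<longrightarrow> reduced_word [last w, l] \<longrightarrow>
        overlap (inv (letter_value (last w))) (letter_value l) < E w)"
    using w
  proof (induction w rule: rev_induct)
    case (snoc l w)
    define Y where "Y = letter_value l"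
    have l: "fst l \<in> {a, b}" using snoc.prems by auto
    have Y: "Y \<in> carrier G" using letter[OF l] by (simp add: Y_def)
    have next_l: "overlap (inv Y) (letter_value k) < len Y - overlap (inv (letter_value j)) Y"
      if "fst j \<in> {a, b}" "fst k \<in> {a, b}" "reduced_word [j, l]" "reduced_word [l, k]" for j k
      using strict[OF that(1) l that(2-4)] by (simp add: Y_def)
    show ?case
    proof (cases "w = []")
      case True
      have "overlap (inv Y) (inv Y) = len Y"
        using len_quotient[of "inv Y" "inv Y"] Y by simp
      moreover have "word_value G (w @ [l]) = Y" using True Y by (simp add: Y_def)
      ultimately have "E (w @ [l]) = len Y" by (simp add: E_def flip: Y_def)
      moreover have "overlap (inv Y) (letter_value k) < len Y"
        if "fst k \<in> {a, b}" "reduced_word [l, k]" for k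
        using next_l[OF l that(1) self that(2)] by linarith
      ultimately show ?thesis using True \<open>word_value G (w @ [l]) = Y\<close> by (simp flip: Y_def)
    next
      case False
      define W L where "W = word_value G w" and "L = letter_value (last w)"
      have EW: "E w = overlap (inv W) (inv L)" by (simp add: E_def W_def L_def)
      have wab: "fst ` set w \<subseteq> {a, b}" "fst (last w) \<in> {a, b}"
        using snoc.prems(1) last_in_set[OF False] by (auto simp: image_subset_iff)
      have red: "reduced_word w" "reduced_word [last w, l]"
        using snoc.prems(2) False by (simp_all add: reduced_word_append reduced_word_Cons)
      have W: "W \<in> carrier G" using wab car by (auto simp: W_def intro!: word_value_closed)
      have IH: "length w \<le> len W + 1 - E w" "E w \<le> len W"
        "\<And>k. fst k \<in> {a, b} \<Longrightarrow> reduced_word [last w, k] \<Longrightarrow> overlap (inv L) (letter_value k) < E w"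
        using snoc.IH[OF wab(1) red(1)] False unfolding W_def L_def by blast+
      define c where "c = overlap (inv L) Y"
      have "c < E w" using IH(3)[OF l red(2)] by (simp add: c_def Y_def)
      have "overlap (inv W) Y = c"
      proof (rule antisym)
        show "c \<le> overlap (inv W) Y"
          using overlap_ultrametric[of "inv W" "inv L" Y] \<open>c < E w\<close> by (simp add: c_def EW)
        show "overlap (inv W) Y \<le> c"
          using overlap_ultrametric[of "inv L" "inv W" Y] \<open>c < E w\<close> overlap_commute[of "inv L" "inv W"]
          by (simp add: c_def EW)
      qed
      then have lWY: "len (W \<otimes> Y) + 2 * c = len W + len Y" using len_mult[OF W Y] by simp
      have "W \<otimes> Y \<otimes> inv Y = W" using W Y by (simp add: m_assoc)
      then have E': "len W + 2 * overlap (inv (W \<otimes> Y)) (inv Y) = len (W \<otimes> Y) + len Y"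
        using len_mult[of "W \<otimes> Y" "inv Y"] W Y by simp
      have "c < len Y"
        using next_l[OF wab(2) l red(2) self] unfolding c_def L_def by linarith
      then have E'': "overlap (inv (W \<otimes> Y)) (inv Y) = len Y - c" using lWY E' by linarith
      have val: "word_value G (w @ [l]) = W \<otimes> Y"
      proof -
        have "fst ` set w \<subseteq> carrier G" "fst ` set [l] \<subseteq> carrier G" using wab(1) l car by auto
        then have "word_value G (w @ [l]) = W \<otimes> word_value G [l]"
          unfolding W_def by (rule word_value_append)
        then show ?thesis using Y by (simp flip: Y_def)
      qed
      have "E (w @ [l]) = len Y - c" unfolding E_def val using E'' by (simp flip: Y_def)
      moreover have "overlap (inv Y) (letter_value k) < len Y - c"
        if "fst k \<in> {a, b}" "reduced_word [l, k]" for k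
        using next_l[OF wab(2) that(1) red(2) that(2)] by (simp add: c_def L_def)
      moreover have "length w + 1 \<le> len (W \<otimes> Y) + 1 - (len Y - c)" "len Y - c \<le> len (W \<otimes> Y)"
        using IH(1,2) \<open>c < E w\<close> lWY \<open>c < len Y\<close> by linarith+
      ultimately show ?thesis by (simp add: val flip: Y_def)
    qed
  qed simp
  show ?thesis
  proof (cases "w = []")
    case False
    then have "fst (last w) \<in> {a, b}" using w(1) last_in_set[of w] by (auto simp: image_subset_iff)
    then have "0 < E w" using inv False self[of "last w"] by (metis gr_zeroI not_less_zero)
    then show ?thesis using inv False by linarith
  qed simp
qed

text \<open>Take a minimal pair in the class of \<open>(u, v)\<close>.  Basis elements have length one, so as reduced
products of elements of the minimal pair they have only one factor.\<close>

theorem generating_pair_nielsen_equiv_basis: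
  assumes B: "B = {x, y}" "x \<noteq> y" and uv: "u \<in> carrier G" "v \<in> carrier G"
    and gen: "generate G {u, v} = carrier G"
  shows "nielsen_equiv G u v x y"
proof -
  define N where "N = (\<lambda>(a, b). nielsen_equiv G u v a b)"
  obtain ab where ab: "N ab" "\<And>cd. N cd \<Longrightarrow> len (fst ab) + len (snd ab) \<le> len (fst cd) + len (snd cd)"
  proof -
    have "N (u, v)" by (simp add: N_def nielsen_equiv.base)
    from ex_has_least_nat[of N, OF this, of "\<lambda>ab. len (fst ab) + len (snd ab)"]
    show thesis using that by auto
  qed
  define a b where "a = fst ab" and "b = snd ab"
  have uvab: "nielsen_equiv G u v a b" using ab by (simp add: N_def a_def b_def case_prod_unfold)
  have car: "a \<in> carrier G" "b \<in> carrier G" using nielsen_equiv_closed[OF uvab uv] by auto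
  have min: "minimal_pair a b"
    unfolding minimal_pair_def
  proof (intro conjI allI impI car)
    fix c d assume "nielsen_equiv G a b c d"
    then have "N (c, d)" using uvab nielsen_equiv_trans by (auto simp: N_def)
    from ab(2)[OF this] show "len a + len b \<le> len c + len d" by (simp add: a_def b_def)
  qed
  have gen': "generate G {a, b} = carrier G" by (rule nielsen_equiv_generates[OF uvab uv gen])
  have xy: "x \<in> carrier G" "y \<in> carrier G" using B B_carrier by auto
  have nc: "x \<otimes> y \<noteq> y \<otimes> x" by (rule basis_not_commute[OF _ _ B(2)]) (simp_all add: B(1))
  have "a \<otimes> b \<noteq> b \<otimes> a"
  proof
    assume ab: "a \<otimes> b = b \<otimes> a"
    have "x \<otimes> y = y \<otimes> x"
    proof (rule generate_commute[of "{a, b}"])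
      show "{a, b} \<subseteq> carrier G" using car by simp
      show "c \<otimes> d = d \<otimes> c" if "c \<in> {a, b}" "d \<in> {a, b}" for c d
        using that ab ab[symmetric] by (elim insertE emptyE) (simp_all only:)
    qed (simp_all only: gen' xy)
    then show False using nc by simp
  qed
  then have ne: "a \<noteq> \<one>" "b \<noteq> \<one>" using car by auto
  have letter: "z \<in> {a, inv a, b, inv b}" if z: "z \<in> B" for z
  proof -
    have zG: "z \<in> generate G {a, b}" unfolding gen' using z B_carrier by blast
    have "{a, b} \<subseteq> carrier G" using car by simp
    then obtain w where w: "fst ` set w \<subseteq> {a, b}" "reduced_word w" "word_value G w = z"
      using zG by (rule generate_reduced_word)
    have "length w \<le> 1" using minimal_pair_len_word[OF min ne w(1,2)] w(3) len_basis[OF z] by simp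
    moreover have "w \<noteq> []" using w(3) len_basis[OF z] by auto
    ultimately obtain l where l: "w = [l]" by (cases w) auto
    then have "fst l \<in> {a, b}" using w(1) by simp
    moreover from this have "fst l \<in> carrier G" using car by blast
    then have "z = letter_value l" using w(3) l by simp
    ultimately show ?thesis unfolding letter_value_def by (cases "snd l") auto
  qed
  have abab: "nielsen_equiv G a b a b" by (rule nielsen_equiv.base)
  have moves: "nielsen_equiv G a b c d" if "c \<in> {a, inv a}" "d \<in> {b, inv b}" for c d
    using that
    by (elim insertE emptyE; simp only:)
      (rule abab nielsen_equiv.invert[OF abab] nielsen_equiv_invert2[OF abab]
        nielsen_equiv_invert2[OF nielsen_equiv.invert[OF abab]])+
  have separate: "\<not> (x \<in> {z, inv z} \<and> y \<in> {z, inv z})" if "z \<in> carrier G" for z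
  proof
    assume "x \<in> {z, inv z} \<and> y \<in> {z, inv z}"
    then have "x \<otimes> y = y \<otimes> x" using that by (elim conjE insertE emptyE) simp_all
    then show False using nc by simp
  qed
  have "x \<in> {a, inv a} \<or> x \<in> {b, inv b}" "y \<in> {a, inv a} \<or> y \<in> {b, inv b}"
    using letter[of x] letter[of y] unfolding B(1) by simp_all
  then have "x \<in> {a, inv a} \<and> y \<in> {b, inv b} \<or> y \<in> {a, inv a} \<and> x \<in> {b, inv b}"
    using separate[OF car(1)] separate[OF car(2)] by blast
  then have "nielsen_equiv G a b x y"
    using moves[of x y] nielsen_equiv.swap[OF moves[of y x]] by blast
  then show ?thesis by (rule nielsen_equiv_trans[OF uvab])
qed

end

section \<open>Primitive elements and their axes\<close>

inductive positive_pair :: "('a, 'm) monoid_scheme \<Rightarrow> 'a \<Rightarrow> 'a \<Rightarrow> 'a \<Rightarrow> 'a \<Rightarrow> bool"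
  for G and p and q where
  base: "positive_pair G p q p q"
| swap: "positive_pair G p q a b \<Longrightarrow> positive_pair G p q b a"
| mult_right: "positive_pair G p q a b \<Longrightarrow> positive_pair G p q (a \<otimes>\<^bsub>G\<^esub> b) b"
| mult_left: "positive_pair G p q a b \<Longrightarrow> positive_pair G p q (b \<otimes>\<^bsub>G\<^esub> a) b"

context group
begin

definition conjugate :: "'a \<Rightarrow> 'a \<Rightarrow> 'a" where
  "conjugate h u = h \<otimes> u \<otimes> inv h"

lemma conjugate_closed [simp]: "\<lbrakk>h \<in> carrier G; u \<in> carrier G\<rbrakk> \<Longrightarrow> conjugate h u \<in> carrier G"
  by (simp add: conjugate_def)

lemma conjugate_mult:
  "\<lbrakk>h \<in> carrier G; u \<in> carrier G; v \<in> carrier G\<rbrakk> \<Longrightarrow> conjugate h (u \<otimes> v) = conjugate h u \<otimes> conjugate h v"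
  by (simp add: conjugate_def m_assoc cancel_left_inverse)

lemma conjugate_inv: "\<lbrakk>h \<in> carrier G; u \<in> carrier G\<rbrakk> \<Longrightarrow> conjugate h (inv u) = inv (conjugate h u)"
  by (simp add: conjugate_def m_assoc inv_mult_group)

lemma conjugate_conjugate:
  "\<lbrakk>h \<in> carrier G; k \<in> carrier G; u \<in> carrier G\<rbrakk> \<Longrightarrow> conjugate k (conjugate h u) = conjugate (k \<otimes> h) u"
  by (simp add: conjugate_def m_assoc inv_mult_group)

lemma conjugate_one [simp]: "u \<in> carrier G \<Longrightarrow> conjugate \<one> u = u"
  by (simp add: conjugate_def)

lemma conjugate_inverse [simp]:
  "\<lbrakk>h \<in> carrier G; u \<in> carrier G\<rbrakk> \<Longrightarrow> conjugate (inv h) (conjugate h u) = u"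
  by (simp add: conjugate_conjugate)

lemma conjugate_nat_pow:
  "\<lbrakk>h \<in> carrier G; u \<in> carrier G\<rbrakk> \<Longrightarrow> conjugate h (u [^] (n::nat)) = conjugate h u [^] n"
  by (induction n) (simp_all add: conjugate_mult, simp add: conjugate_def)

lemma positive_pair_closed:
  assumes "positive_pair G p q a b" "p \<in> carrier G" "q \<in> carrier G"
  shows "a \<in> carrier G \<and> b \<in> carrier G"
  using assms by induction simp_all

text \<open>The signs of the letters \<open>p\<close>, \<open>q\<close> may depend on the pair.  Inverting the elements of the pair
separately must be allowed, as the quotient of two positive words may be the inverse of one.\<close>

definition conj_positive :: "'a \<Rightarrow> 'a \<Rightarrow> 'a \<Rightarrow> 'a \<Rightarrow> bool" where
  "conj_positive x y u v \<longleftrightarrow> u \<in> carrier G \<and> v \<in> carrier G \<and>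
     (\<exists>p q a b h. p \<in> {x, inv x} \<and> q \<in> {y, inv y} \<and> positive_pair G p q a b \<and> h \<in> carrier G \<and>
        conjugate h u \<in> {a, inv a} \<and> conjugate h v \<in> {b, inv b})"

lemma conj_positive_swap: "conj_positive x y u v \<Longrightarrow> conj_positive x y v u"
  unfolding conj_positive_def using positive_pair.swap[of G] by blast

lemma conj_positive_invert:
  assumes "x \<in> carrier G" "y \<in> carrier G" "conj_positive x y u v"
  shows "conj_positive x y (inv u) v"
proof -
  obtain p q a b h where *: "p \<in> {x, inv x}" "q \<in> {y, inv y}" "positive_pair G p q a b"
    "h \<in> carrier G" "conjugate h u \<in> {a, inv a}" "conjugate h v \<in> {b, inv b}"
    and uv: "u \<in> carrier G" "v \<in> carrier G"
    using assms(3) unfolding conj_positive_def by blast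
  have "p \<in> carrier G" "q \<in> carrier G" using * assms by auto
  then have "a \<in> carrier G" using positive_pair_closed[OF *(3)] by blast
  then have "conjugate h (inv u) \<in> {a, inv a}" using *(5) by (auto simp: conjugate_inv[OF *(4) uv(1)])
  then show ?thesis unfolding conj_positive_def using * uv by blast
qed

lemma conj_positive_conjugate:
  assumes "conj_positive x y u v" "k \<in> carrier G"
  shows "conj_positive x y (conjugate k u) (conjugate k v)"
proof -
  obtain p q a b h where *: "p \<in> {x, inv x}" "q \<in> {y, inv y}" "positive_pair G p q a b"
    "h \<in> carrier G" "conjugate h u \<in> {a, inv a}" "conjugate h v \<in> {b, inv b}"
    and uv: "u \<in> carrier G" "v \<in> carrier G"
    using assms(1) unfolding conj_positive_def by blast
  have "conjugate (h \<otimes> inv k) (conjugate k w) = conjugate h w" if "w \<in> carrier G" for w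
    using that *(4) assms(2) by (simp add: conjugate_conjugate m_assoc)
  then have "conjugate (h \<otimes> inv k) (conjugate k u) \<in> {a, inv a}"
    "conjugate (h \<otimes> inv k) (conjugate k v) \<in> {b, inv b}"
    using *(5,6) uv by simp_all
  moreover have "h \<otimes> inv k \<in> carrier G" "conjugate k u \<in> carrier G" "conjugate k v \<in> carrier G"
    using *(4) uv assms(2) by simp_all
  ultimately show ?thesis unfolding conj_positive_def using *(1-3) by blast
qed

lemma conj_positive_conjugate_iff:
  assumes "k \<in> carrier G" "u \<in> carrier G" "v \<in> carrier G"
  shows "conj_positive x y (conjugate k u) (conjugate k v) \<longleftrightarrow> conj_positive x y u v"
  using conj_positive_conjugate[of x y "conjugate k u" "conjugate k v" "inv k"]
    conj_positive_conjugate[of x y u v k] assms by auto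

lemma positive_pair_conj_positive:
  assumes "positive_pair G p q a b" "p \<in> {x, inv x}" "q \<in> {y, inv y}" "x \<in> carrier G" "y \<in> carrier G"
  shows "conj_positive x y a b"
proof -
  have "p \<in> carrier G" "q \<in> carrier G" using assms by auto
  then have "a \<in> carrier G" "b \<in> carrier G" using positive_pair_closed[OF assms(1)] by auto
  moreover from this have "conjugate \<one> a \<in> {a, inv a}" "conjugate \<one> b \<in> {b, inv b}" by simp_all
  ultimately show ?thesis unfolding conj_positive_def using assms(1-3) one_closed by blast
qed

text \<open>If the last move that produced \<open>(a, b)\<close> multiplied \<open>a\<close> by \<open>b\<close>, then the quotient undoes it, up to
conjugation by \<open>b\<close>.  If it multiplied \<open>b\<close> by \<open>a\<close>, the quotient is the inverse of the previous \<open>b\<close>.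
At the start of the chain the quotient changes one of the two signs.\<close>

lemma positive_pair_quotient:
  assumes "positive_pair G p q a b" "p \<in> {x, inv x}" "q \<in> {y, inv y}" "x \<in> carrier G" "y \<in> carrier G"
  shows "conj_positive x y (a \<otimes> inv b) b \<and> conj_positive x y (b \<otimes> inv a) a"
proof -
  note xy = assms(4,5)
  have pq: "p \<in> carrier G" "q \<in> carrier G" "inv p \<in> {x, inv x}" "inv q \<in> {y, inv y}"
    using assms by auto
  note pos = positive_pair_conj_positive[OF _ assms(2-5)]
  note inv1 = conj_positive_invert[OF xy]
  have inv2: "conj_positive x y u v \<Longrightarrow> conj_positive x y u (inv v)" for u v
    using inv1 conj_positive_swap by blast
  from assms(1) show ?thesis
  proof induction
    case base
    have "conj_positive x y (p \<otimes> inv q) (inv q)"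
      by (rule positive_pair_conj_positive[OF positive_pair.mult_right[OF positive_pair.base]
            assms(2) pq(4) xy])
    from inv2[OF this] have "conj_positive x y (p \<otimes> inv q) q" using pq by simp
    moreover have "conj_positive x y (q \<otimes> inv p) (inv p)"
      by (rule positive_pair_conj_positive[OF positive_pair.mult_right[OF positive_pair.swap[OF
              positive_pair.base]] pq(3) assms(3) xy])
    from inv2[OF this] have "conj_positive x y (q \<otimes> inv p) p" using pq by simp
    ultimately show ?case ..
  next
    case (swap a b)
    then show ?case by blast
  next
    case (mult_right a b)
    have ab: "a \<in> carrier G" "b \<in> carrier G" using positive_pair_closed[OF mult_right(1) pq(1,2)] by auto
    have "conj_positive x y (a \<otimes> b \<otimes> inv b) b"
      using pos[OF mult_right(1)] ab by (simp add: m_assoc)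
    moreover have "conj_positive x y (inv a) (a \<otimes> b)"
      by (rule inv1[OF pos[OF positive_pair.swap[OF positive_pair.mult_left[OF positive_pair.swap[OF mult_right(1)]]]]])
    then have "conj_positive x y (b \<otimes> inv (a \<otimes> b)) (a \<otimes> b)"
      using ab by (simp add: inv_mult_group flip: m_assoc)
    ultimately show ?case ..
  next
    case (mult_left a b)
    have ab: "a \<in> carrier G" "b \<in> carrier G" using positive_pair_closed[OF mult_left(1) pq(1,2)] by auto
    have "conj_positive x y (conjugate b a) (conjugate b b)"
      by (rule conj_positive_conjugate[OF pos[OF mult_left(1)] ab(2)])
    then have "conj_positive x y (b \<otimes> a \<otimes> inv b) b"
      using ab by (simp add: conjugate_def m_assoc)
    moreover have "conj_positive x y (inv a) (a \<otimes> b)"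
      by (rule inv1[OF pos[OF positive_pair.swap[OF positive_pair.mult_left[OF positive_pair.swap[OF mult_left(1)]]]]])
    from conj_positive_conjugate[OF this ab(2)]
    have "conj_positive x y (b \<otimes> inv (b \<otimes> a)) (b \<otimes> a)"
      using ab by (simp add: conjugate_def m_assoc inv_mult_group)
    ultimately show ?case ..
  qed
qed

lemma conj_positive_mult:
  assumes xy: "x \<in> carrier G" "y \<in> carrier G" and cp: "conj_positive x y u v"
  shows "conj_positive x y (u \<otimes> v) v"
proof -
  obtain p q a b h where *: "p \<in> {x, inv x}" "q \<in> {y, inv y}" "positive_pair G p q a b"
    "h \<in> carrier G" "conjugate h u \<in> {a, inv a}" "conjugate h v \<in> {b, inv b}"
    and uv: "u \<in> carrier G" "v \<in> carrier G"
    using cp unfolding conj_positive_def by blast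
  have "p \<in> carrier G" "q \<in> carrier G" using * xy by auto
  then have ab: "a \<in> carrier G" "b \<in> carrier G" using positive_pair_closed[OF *(3)] by auto
  note pos = positive_pair_conj_positive[OF _ *(1,2) xy]
  note inv1 = conj_positive_invert[OF xy]
  have inv2: "conj_positive x y u v \<Longrightarrow> conj_positive x y u (inv v)" for u v
    using inv1 conj_positive_swap by blast
  have quot: "conj_positive x y (a \<otimes> inv b) b"
    using positive_pair_quotient[OF *(3,1,2) xy] by blast
  have "conj_positive x y (conjugate h u \<otimes> conjugate h v) (conjugate h v)"
    using *(5,6)
  proof (elim insertE emptyE; simp only:)
    show "conj_positive x y (a \<otimes> b) b"
      by (rule pos[OF positive_pair.mult_right[OF *(3)]])
    show "conj_positive x y (a \<otimes> inv b) (inv b)" by (rule inv2[OF quot])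
    have "conj_positive x y (conjugate (inv b) (b \<otimes> inv a)) (conjugate (inv b) b)"
      using conj_positive_conjugate[OF inv1[OF quot], of "inv b"] ab by (simp add: inv_mult_group)
    then show "conj_positive x y (inv a \<otimes> b) b"
      using ab by (simp add: conjugate_def m_assoc cancel_left_inverse)
    have "conj_positive x y (inv (b \<otimes> a)) (inv b)"
      by (rule inv2[OF inv1[OF pos[OF positive_pair.mult_left[OF *(3)]]]])
    then show "conj_positive x y (inv a \<otimes> inv b) (inv b)" using ab by (simp add: inv_mult_group)
  qed
  then show ?thesis
    using conj_positive_conjugate_iff[OF *(4), of "u \<otimes> v" v x y] uv *(4) by (simp add: conjugate_mult)
qed

lemma nielsen_equiv_conj_positive:
  assumes "nielsen_equiv G x y u v" "x \<in> carrier G" "y \<in> carrier G"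
  shows "conj_positive x y u v"
  using assms
proof induction
  case base
  show ?case by (rule positive_pair_conj_positive[OF positive_pair.base]) (use base in simp_all)
next
  case (invert a b)
  then show ?case by (intro conj_positive_invert) simp_all
next
  case (swap a b)
  show ?case by (rule conj_positive_swap[OF swap.IH[OF swap.prems]])
next
  case (mult a b)
  then show ?case by (intro conj_positive_mult) simp_all
next
  case (conj a b h)
  then show ?case using conj_positive_conjugate[of x y a b h] by (simp add: conjugate_def)
qed

lemma word_length_le: "\<lbrakk>fst ` set w \<subseteq> S; word_value G w = g\<rbrakk> \<Longrightarrow> word_length G S g \<le> length w"
  unfolding word_length_def by (rule Least_le) blast

lemma word_length_attained:
  assumes "S \<subseteq> carrier G" "g \<in> generate G S"
  obtains w where "length w = word_length G S g" "fst ` set w \<subseteq> S" "word_value G w = g"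
proof -
  obtain w where "fst ` set w \<subseteq> S" "word_value G w = g" using generate_reduced_word[OF assms] by metis
  then have "\<exists>n w. length w = n \<and> fst ` set w \<subseteq> S \<and> word_value G w = g" by blast
  from LeastI_ex[OF this, folded word_length_def] show thesis using that by blast
qed

lemma word_length_mult:
  assumes S: "S \<subseteq> carrier G" and gh: "g \<in> generate G S" "h \<in> generate G S"
  shows "word_length G S (g \<otimes> h) \<le> word_length G S g + word_length G S h"
proof -
  obtain u where u: "length u = word_length G S g" "fst ` set u \<subseteq> S" "word_value G u = g"
    by (rule word_length_attained[OF S gh(1)])
  obtain w where w: "length w = word_length G S h" "fst ` set w \<subseteq> S" "word_value G w = h"
    by (rule word_length_attained[OF S gh(2)])
  have "word_value G (u @ w) = g \<otimes> h"
    using word_value_append[of u w] u w S by (metis subset_trans)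
  then have "word_length G S (g \<otimes> h) \<le> length (u @ w)"
    using u w by (intro word_length_le) (simp_all add: image_Un)
  then show ?thesis using u w by simp
qed

lemma word_length_inv:
  assumes S: "S \<subseteq> carrier G" and g: "g \<in> generate G S"
  shows "word_length G S (inv g) \<le> word_length G S g"
proof -
  obtain u where u: "length u = word_length G S g" "fst ` set u \<subseteq> S" "word_value G u = g"
    by (rule word_length_attained[OF S g])
  have "fst ` set u \<subseteq> carrier G" using u(2) S by (rule subset_trans)
  then have "word_value G (inverse_word u) = inv g" using word_value_inverse_word u by simp
  then show ?thesis using word_length_le[of "inverse_word u" S "inv g"] u by simp
qed

lemma word_length_pow:
  assumes S: "S \<subseteq> carrier G" and g: "g \<in> generate G S"
  shows "g [^] (n::nat) \<in> generate G S \<and> word_length G S (g [^] n) \<le> n * word_length G S g"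
proof (induction n)
  case 0
  show ?case using word_length_le[of "[]" S \<one>] by (simp add: generate.one)
next
  case (Suc n)
  then show ?case using word_length_mult[OF S, of "g [^] n" g] g generate.eng[of "g [^] n" G S g] by simp
qed

end

lemma int_isometry_cases:
  fixes f :: "int \<Rightarrow> int"
  assumes f: "\<And>i j. \<bar>f i - f j\<bar> = \<bar>i - j\<bar>"
  obtains "\<And>i. f i = f 0 + i" | "\<And>i. f i = f 0 - i"
proof (cases "f 1 = f 0 + 1")
  case True
  have "f i = f 0 + i" for i using f[of i 0] f[of i 1] True by linarith
  then show thesis by (rule that(1))
next
  case False
  have "f i = f 0 - i" for i using f[of i 0] f[of i 1] f[of 1 0] False by linarith
  then show thesis by (rule that(2))
qed

lemma ray_in_int_cases:
  fixes g :: "nat \<Rightarrow> int"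
  assumes g: "\<And>i j. \<bar>g i - g j\<bar> = \<bar>int i - int j\<bar>"
  obtains "\<And>i. g i = g 0 + int i" | "\<And>i. g i = g 0 - int i"
proof (cases "g 1 = g 0 + 1")
  case True
  have "g i = g 0 + int i" for i using g[of i 0] g[of i 1] True by simp
  then show thesis by (rule that(1))
next
  case False
  have "g i = g 0 - int i" for i using g[of i 0] g[of i 1] g[of 1 0] False by simp
  then show thesis by (rule that(2))
qed

text \<open>An upper bound for every term that is attained by the sum is attained by every term.\<close>

lemma all_one_if_sum_large:
  fixes s :: "nat \<Rightarrow> int"
  assumes "\<And>i. s i \<le> 1" "int n \<le> (\<Sum>i<n. s i)" "j < n"
  shows "s j = 1"
proof -
  have "(\<Sum>i\<in>{..<n} - {j}. s i) \<le> (\<Sum>i\<in>{..<n} - {j}. 1)" by (rule sum_mono) (rule assms)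
  moreover have "(\<Sum>i<n. s i) = s j + (\<Sum>i\<in>{..<n} - {j}. s i)" using assms(3) by (intro sum.remove) auto
  ultimately show ?thesis using assms by (simp add: of_nat_diff antisym)
qed

text \<open>The homomorphisms \<open>\<phi>\<close> and \<open>\<psi>\<close> are the coordinates of the abelianization with respect to the pair.
With them, no normal form with respect to \<open>x\<close> and \<open>y\<close> is needed to study axes.\<close>

locale generating_pair = group G for G (structure) +
  fixes x y and \<phi> \<psi> :: "'a \<Rightarrow> int"
  assumes xy: "x \<in> carrier G" "y \<in> carrier G" "generate G {x, y} = carrier G"
    and \<phi>: "\<And>g h. \<lbrakk>g \<in> carrier G; h \<in> carrier G\<rbrakk> \<Longrightarrow> \<phi> (g \<otimes> h) = \<phi> g + \<phi> h"
    and \<psi>: "\<And>g h. \<lbrakk>g \<in> carrier G; h \<in> carrier G\<rbrakk> \<Longrightarrow> \<psi> (g \<otimes> h) = \<psi> g + \<psi> h"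
    and dual: "\<phi> x = 1" "\<phi> y = 0" "\<psi> x = 0" "\<psi> y = 1"
    and primitive_equiv: "\<And>u v. \<lbrakk>u \<in> carrier G; v \<in> carrier G; generate G {u, v} = carrier G\<rbrakk> \<Longrightarrow>
      nielsen_equiv G x y u v"
begin

lemma \<phi>_one [simp]: "\<phi> \<one> = 0" and \<psi>_one [simp]: "\<psi> \<one> = 0"
  using \<phi>[of \<one> \<one>] \<psi>[of \<one> \<one>] by simp_all

lemma \<phi>_inv [simp]: "g \<in> carrier G \<Longrightarrow> \<phi> (inv g) = - \<phi> g"
  and \<psi>_inv [simp]: "g \<in> carrier G \<Longrightarrow> \<psi> (inv g) = - \<psi> g"
  using \<phi>[of g "inv g"] \<psi>[of g "inv g"] by simp_all

lemma \<phi>_conjugate: "\<lbrakk>h \<in> carrier G; g \<in> carrier G\<rbrakk> \<Longrightarrow> \<phi> (conjugate h g) = \<phi> g"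
  and \<psi>_conjugate: "\<lbrakk>h \<in> carrier G; g \<in> carrier G\<rbrakk> \<Longrightarrow> \<psi> (conjugate h g) = \<psi> g"
  by (simp_all add: conjugate_def \<phi> \<psi>)

abbreviation "wl \<equiv> word_length G {x, y}"

lemma wl_mult: "\<lbrakk>g \<in> carrier G; h \<in> carrier G\<rbrakk> \<Longrightarrow> wl (g \<otimes> h) \<le> wl g + wl h"
  and wl_inv: "g \<in> carrier G \<Longrightarrow> wl (inv g) \<le> wl g"
  and wl_pow: "g \<in> carrier G \<Longrightarrow> wl (g [^] (n::nat)) \<le> n * wl g"
  using word_length_mult[of "{x, y}"] word_length_inv[of "{x, y}"] word_length_pow[of "{x, y}"] xy
  by auto

lemma wl_one_letter:
  assumes "g \<in> carrier G" "wl g = 1"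
  shows "g \<in> {x, inv x, y, inv y}"
proof -
  have S: "{x, y} \<subseteq> carrier G" "g \<in> generate G {x, y}" using xy assms by simp_all
  obtain w where w: "length w = wl g" "fst ` set w \<subseteq> {x, y}" "word_value G w = g"
    by (rule word_length_attained[OF S])
  then obtain l where l: "w = [l]" using assms(2) by (auto simp: length_Suc_conv)
  then have "fst l \<in> {x, y}" using w(2) by simp
  moreover from this have "fst l \<in> carrier G" using xy by blast
  then have "g = letter_value l" using w(3) l by simp
  ultimately show ?thesis unfolding letter_value_def by (cases "snd l") auto
qed

lemma wl_generators: "wl x \<le> 1" "wl (inv x) \<le> 1" "wl y \<le> 1" "wl (inv y) \<le> 1"
  using word_length_le[of "[(x, False)]" "{x, y}" x] word_length_le[of "[(x, True)]" "{x, y}" "inv x"]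
    word_length_le[of "[(y, False)]" "{x, y}" y] word_length_le[of "[(y, True)]" "{x, y}" "inv y"] xy
  by (simp_all add: letter_value_def)

text \<open>A positive word is as long as the \<open>l\<^sup>1\<close>-norm of its abelianization, which \<open>F\<close> computes because the
coordinates have the signs of \<open>p\<close> and \<open>q\<close>.\<close>

lemma positive_pair_bounds:
  assumes "positive_pair G p q a b" "p \<in> {x, inv x}" "q \<in> {y, inv y}"
  shows "(let F = (\<lambda>g. \<phi> p * \<phi> g + \<psi> q * \<psi> g) in
    int (wl a) \<le> F a \<and> 0 < F a \<and> int (wl b) \<le> F b \<and> 0 < F b)"
proof -
  have pq: "p \<in> carrier G" "q \<in> carrier G" using assms xy by auto
  define F where "F = (\<lambda>g. \<phi> p * \<phi> g + \<psi> q * \<psi> g)"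
  have F: "F (g \<otimes> h) = F g + F h" if "g \<in> carrier G" "h \<in> carrier G" for g h
    using that by (simp add: F_def \<phi> \<psi> algebra_simps)
  have "int (wl a) \<le> F a \<and> 0 < F a \<and> int (wl b) \<le> F b \<and> 0 < F b"
    using assms(1)
  proof induction
    case base
    have "F p = 1" "F q = 1" using assms(2,3) xy dual by (auto simp: F_def)
    moreover have "wl p \<le> 1" "wl q \<le> 1" using assms(2,3) wl_generators by auto
    ultimately show ?case by simp
  next
    case (swap a b)
    then show ?case by simp
  next
    case (mult_right a b)
    then have "a \<in> carrier G" "b \<in> carrier G" using positive_pair_closed[OF mult_right(1) pq] by auto
    then show ?case using mult_right F[of a b] wl_mult[of a b] by simp
  next
    case (mult_left a b)
    then have "a \<in> carrier G" "b \<in> carrier G" using positive_pair_closed[OF mult_left(1) pq] by auto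
    then show ?case using mult_left F[of b a] wl_mult[of b a] by simp
  qed
  then show ?thesis by (simp add: Let_def F_def)
qed

text \<open>A conjugate of \<open>\<gamma>\<close> is a positive word or the inverse of one, and these are bounded by their
abelianizations.\<close>

lemma primitive_growth:
  assumes "primitive_elt G \<gamma>"
  shows "\<gamma> \<in> carrier G" "0 < \<bar>\<phi> \<gamma>\<bar> + \<bar>\<psi> \<gamma>\<bar>"
    "\<exists>h\<in>carrier G. \<forall>m::nat. int (wl (conjugate h (\<gamma> [^] m))) \<le> int m * (\<bar>\<phi> \<gamma>\<bar> + \<bar>\<psi> \<gamma>\<bar>)"
proof -
  obtain T where T: "card T = 2" "generating_set G T" "\<gamma> \<in> T" using assms by (auto simp: primitive_elt_def)
  then obtain \<delta> where \<delta>: "T = {\<gamma>, \<delta>}" by (auto simp: card_2_iff)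
  then have gd: "\<gamma> \<in> carrier G" "\<delta> \<in> carrier G" "generate G {\<gamma>, \<delta>} = carrier G"
    using T by (auto simp: generating_set_def)
  show "\<gamma> \<in> carrier G" by (rule gd)
  have "conj_positive x y \<gamma> \<delta>"
    by (rule nielsen_equiv_conj_positive[OF primitive_equiv[OF gd] xy(1,2)])
  then obtain p q a b h where *: "p \<in> {x, inv x}" "q \<in> {y, inv y}" "positive_pair G p q a b"
    "h \<in> carrier G" "conjugate h \<gamma> \<in> {a, inv a}"
    unfolding conj_positive_def by blast
  have "p \<in> carrier G" "q \<in> carrier G" using * xy by auto
  then have a: "a \<in> carrier G" using positive_pair_closed[OF *(3)] by blast
  have pq: "\<phi> p \<in> {1, -1}" "\<psi> q \<in> {1, -1}" using *(1,2) xy dual by auto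
  have bnd: "int (wl a) \<le> \<phi> p * \<phi> a + \<psi> q * \<psi> a" "0 < \<phi> p * \<phi> a + \<psi> q * \<psi> a"
    using positive_pair_bounds[OF *(3,1,2)] by (simp_all add: Let_def)
  have "\<bar>\<phi> \<gamma>\<bar> = \<bar>\<phi> a\<bar>" "\<bar>\<psi> \<gamma>\<bar> = \<bar>\<psi> a\<bar>"
    using *(5) \<phi>_conjugate[OF *(4) gd(1)] \<psi>_conjugate[OF *(4) gd(1)] a by auto
  moreover have "\<phi> p * \<phi> a + \<psi> q * \<psi> a \<le> \<bar>\<phi> a\<bar> + \<bar>\<psi> a\<bar>" using pq by auto
  ultimately have norm: "int (wl a) \<le> \<bar>\<phi> \<gamma>\<bar> + \<bar>\<psi> \<gamma>\<bar>" "0 < \<bar>\<phi> \<gamma>\<bar> + \<bar>\<psi> \<gamma>\<bar>" using bnd by linarith+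
  show "0 < \<bar>\<phi> \<gamma>\<bar> + \<bar>\<psi> \<gamma>\<bar>" by (rule norm)
  have wlc: "wl (conjugate h \<gamma>) \<le> wl a" using *(5) wl_inv[OF a] by auto
  have "int (wl (conjugate h (\<gamma> [^] m))) \<le> int m * (\<bar>\<phi> \<gamma>\<bar> + \<bar>\<psi> \<gamma>\<bar>)" for m :: nat
  proof -
    have "wl (conjugate h (\<gamma> [^] m)) \<le> m * wl (conjugate h \<gamma>)"
      using wl_pow[of "conjugate h \<gamma>" m] *(4) gd(1) by (simp add: conjugate_nat_pow)
    moreover have "m * wl (conjugate h \<gamma>) \<le> m * wl a" by (intro mult_left_mono wlc) simp
    ultimately have "wl (conjugate h (\<gamma> [^] m)) \<le> m * wl a" by linarith
    then have 1: "int (wl (conjugate h (\<gamma> [^] m))) \<le> int m * int (wl a)"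
      unfolding of_nat_mult[symmetric] of_nat_le_iff .
    have 2: "int m * int (wl a) \<le> int m * (\<bar>\<phi> \<gamma>\<bar> + \<bar>\<psi> \<gamma>\<bar>)" by (intro mult_left_mono norm) simp
    from 1 2 show ?thesis by linarith
  qed
  then show "\<exists>h\<in>carrier G. \<forall>m::nat. int (wl (conjugate h (\<gamma> [^] m))) \<le> int m * (\<bar>\<phi> \<gamma>\<bar> + \<bar>\<psi> \<gamma>\<bar>)"
    using *(4) by blast
qed

lemma axis_points:
  assumes "axis_of G {x, y} \<gamma> c"
  shows "c i \<in> carrier G" "int (wl (inv (c i) \<otimes> c j)) = \<bar>i - j\<bar>"
proof -
  have "geodesic_line G {x, y} c" using assms unfolding axis_of_def by (elim conjE)
  then have "range c \<subseteq> carrier G" "\<forall>i j. int (wl (inv (c i) \<otimes> c j)) = \<bar>i - j\<bar>"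
    unfolding geodesic_line_def word_dist_def by simp_all
  then show "c i \<in> carrier G" "int (wl (inv (c i) \<otimes> c j)) = \<bar>i - j\<bar>" by blast+
qed

text \<open>A reflection of the line would be an involution, which is impossible since the abelianization is
torsion-free and \<open>\<gamma>\<close> is nontrivial in it.  The bound on the translation length \<open>\<bar>k\<bar>\<close> comes from the
growth of the powers of \<open>\<gamma>\<close> by letting the exponent \<open>m\<close> be large.\<close>

lemma axis_translation:
  assumes prim: "primitive_elt G \<gamma>" and ax: "axis_of G {x, y} \<gamma> c"
  obtains k where "\<And>i. \<gamma> \<otimes> c i = c (k + i)" "k \<noteq> 0" "\<bar>k\<bar> \<le> \<bar>\<phi> \<gamma>\<bar> + \<bar>\<psi> \<gamma>\<bar>"
proof -
  note \<gamma> = primitive_growth(1,2)[OF prim]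
  note c = axis_points[OF ax]
  have "\<exists>j. \<gamma> \<otimes> c i = c j" for i
  proof -
    have "(\<lambda>x. \<gamma> \<otimes> x) ` range c = range c" using ax unfolding axis_of_def by (elim conjE)
    then have "\<gamma> \<otimes> c i \<in> range c" by (rule subst) simp
    then show ?thesis by (elim rangeE) (rule exI)
  qed
  then obtain f where f: "\<And>i. \<gamma> \<otimes> c i = c (f i)" by metis
  have iso: "\<bar>f i - f j\<bar> = \<bar>i - j\<bar>" for i j
  proof -
    have "inv (c (f i)) \<otimes> c (f j) = inv (c i) \<otimes> c j"
      using \<gamma>(1) c(1) by (simp add: inv_mult_group m_assoc cancel_left_inverse flip: f)
    then show ?thesis using c(2)[of "f i" "f j"] c(2)[of i j] by simp
  qed
  show thesis
  proof (rule int_isometry_cases[of f, OF iso])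
    assume refl: "\<And>i. f i = f 0 - i"
    have "\<gamma> \<otimes> (\<gamma> \<otimes> c 0) = c 0" using f[of 0] f[of "f 0"] refl[of "f 0"] by simp
    then have "\<phi> (\<gamma> \<otimes> (\<gamma> \<otimes> c 0)) = \<phi> (c 0)" "\<psi> (\<gamma> \<otimes> (\<gamma> \<otimes> c 0)) = \<psi> (c 0)" by simp_all
    then show thesis using \<gamma> c(1)[of 0] by (simp add: \<phi> \<psi>)
  next
    define k where "k = f 0"
    assume up: "\<And>i. f i = f 0 + i"
    have k: "\<gamma> \<otimes> c i = c (k + i)" for i
      unfolding k_def by (subst up[symmetric]) (rule f)
    have "k \<noteq> 0"
    proof
      assume "k = 0"
      then have "\<gamma> \<otimes> c 0 = c 0" using k[of 0] by simp
      then have "\<phi> (\<gamma> \<otimes> c 0) = \<phi> (c 0)" "\<psi> (\<gamma> \<otimes> c 0) = \<psi> (c 0)" by simp_all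
      then show False using \<gamma> c(1)[of 0] by (simp add: \<phi> \<psi>)
    qed
    obtain h where h: "h \<in> carrier G"
      "\<And>m::nat. int (wl (conjugate h (\<gamma> [^] m))) \<le> int m * (\<bar>\<phi> \<gamma>\<bar> + \<bar>\<psi> \<gamma>\<bar>)"
      using primitive_growth(3)[OF prim] by blast
    define g where "g = inv (c 0) \<otimes> inv h"
    have g: "g \<in> carrier G" using h c(1) by (simp add: g_def)
    have bound: "int m * \<bar>k\<bar> \<le> int m * (\<bar>\<phi> \<gamma>\<bar> + \<bar>\<psi> \<gamma>\<bar>) + int (wl g + wl (inv g))" for m :: nat
    proof -
      have pw: "\<gamma> [^] m \<otimes> c 0 = c (int m * k)"
      proof (induction m)
        case (Suc m)
        have "\<gamma> [^] Suc m \<otimes> c 0 = \<gamma> \<otimes> (\<gamma> [^] m \<otimes> c 0)"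
          unfolding nat_pow_Suc2[OF \<gamma>(1)] by (rule m_assoc) (use \<gamma>(1) c(1) in simp_all)
        also have "\<dots> = c (k + int m * k)" unfolding Suc.IH by (rule k)
        also have "k + int m * k = int (Suc m) * k" by (simp add: algebra_simps)
        finally show ?case .
      qed (use c(1) in simp)
      have "inv (c 0) \<otimes> c (int m * k) = conjugate g (conjugate h (\<gamma> [^] m))"
        using h(1) c(1)[of 0] \<gamma>(1)
        by (simp add: g_def conjugate_conjugate m_assoc flip: pw) (simp add: conjugate_def m_assoc)
      then have "int (wl (conjugate g (conjugate h (\<gamma> [^] m)))) = int m * \<bar>k\<bar>"
        using c(2)[of 0 "int m * k"] by (simp add: abs_mult)
      moreover have "wl (conjugate g (conjugate h (\<gamma> [^] m))) \<le> wl g + wl (conjugate h (\<gamma> [^] m)) + wl (inv g)"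
        unfolding conjugate_def[of g] using wl_mult[of "g \<otimes> conjugate h (\<gamma> [^] m)" "inv g"]
          wl_mult[of g "conjugate h (\<gamma> [^] m)"] g h(1) \<gamma>(1) by simp
      ultimately show ?thesis using h(2)[of m] by linarith
    qed
    have "\<bar>k\<bar> \<le> \<bar>\<phi> \<gamma>\<bar> + \<bar>\<psi> \<gamma>\<bar>"
    proof (rule ccontr)
      define A M where "A = \<bar>\<phi> \<gamma>\<bar> + \<bar>\<psi> \<gamma>\<bar>" and "M = wl g + wl (inv g) + 1"
      assume "\<not> \<bar>k\<bar> \<le> \<bar>\<phi> \<gamma>\<bar> + \<bar>\<psi> \<gamma>\<bar>"
      then have "A < \<bar>k\<bar>" by (simp only: A_def not_le)
      then have "A + 1 \<le> \<bar>k\<bar>" by (rule zless_imp_add1_zle)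
      then have "int M * (A + 1) \<le> int M * \<bar>k\<bar>" by (rule mult_left_mono) (rule of_nat_0_le_iff)
      moreover have "int M * \<bar>k\<bar> \<le> int M * A + int (wl g + wl (inv g))"
        unfolding A_def by (rule bound)
      ultimately have "int M * A + int M \<le> int M * A + int (wl g + wl (inv g))"
        by (simp only: distrib_left mult_1_right)
      then have "int M \<le> int (wl g + wl (inv g))" by (simp only: add_le_cancel_left)
      then show False by (simp only: M_def of_nat_le_iff)
    qed
    then show thesis by (rule that[OF k \<open>k \<noteq> 0\<close>])
  qed
qed

text \<open>Over one period of the axis the abelianization changes by that of \<open>\<gamma>\<close>, up to sign, and the
\<open>l\<^sup>1\<close>-norm of the change is at least the number of steps.  Each step contributes at most one, so all
of them contribute exactly one with the same signs.\<close>

lemma axis_steps: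
  assumes prim: "primitive_elt G \<gamma>" and ax: "axis_of G {x, y} \<gamma> c"
  shows "\<exists>p\<in>{x, inv x}. \<exists>q\<in>{y, inv y}. \<forall>i. inv (c i) \<otimes> c (i + 1) \<in> {p, q}"
proof -
  obtain k where k: "\<And>i. \<gamma> \<otimes> c i = c (k + i)" "k \<noteq> 0" "\<bar>k\<bar> \<le> \<bar>\<phi> \<gamma>\<bar> + \<bar>\<psi> \<gamma>\<bar>"
    by (rule axis_translation[OF assms]) (rule that)
  note \<gamma> = primitive_growth(1)[OF prim]
  note c = axis_points[OF ax]
  define l where "l = (\<lambda>i. inv (c i) \<otimes> c (i + 1))"
  have l: "l i \<in> {x, inv x, y, inv y}" for i
  proof (rule wl_one_letter)
    have "int (wl (l i)) = 1" unfolding l_def using c(2)[of i "i + 1"] by simp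
    then show "wl (l i) = 1" by simp
  qed (simp add: l_def c(1))
  define e d where "e = (if sgn k * \<phi> \<gamma> \<ge> 0 then 1 else -1 :: int)" and "d = (if sgn k * \<psi> \<gamma> \<ge> 0 then 1 else -1 :: int)"
  define H where "H = (\<lambda>g. e * \<phi> g + d * \<psi> g)"
  have H_step: "H (l i) = H (c (i + 1)) - H (c i)" for i
    using c(1) by (simp add: H_def l_def \<phi> \<psi> algebra_simps)
  define n where "n = nat \<bar>k\<bar>"
  have "H (c (i + int n)) - H (c i) = \<bar>\<phi> \<gamma>\<bar> + \<bar>\<psi> \<gamma>\<bar>" for i
  proof (cases "k > 0")
    case True
    then have "c (i + int n) = \<gamma> \<otimes> c i" using k(1)[of i] by (simp add: n_def add.commute)
    then show ?thesis using True \<gamma> c(1)[of i] by (simp add: H_def \<phi> \<psi> e_def d_def algebra_simps)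
  next
    case False
    then have "c i = \<gamma> \<otimes> c (i + int n)" "sgn k = -1" using k(1)[of "i + int n"] k(2) by (auto simp: n_def)
    then show ?thesis using \<gamma> c(1)[of "i + int n"] by (simp add: H_def \<phi> \<psi> e_def d_def algebra_simps)
  qed
  moreover have tele: "(\<Sum>j<m. H (l (i + int j))) = H (c (i + int m)) - H (c i)" for i and m :: nat
    by (induction m) (simp_all add: H_step add_ac)
  ultimately have sum: "int n \<le> (\<Sum>j<n. H (l (i + int j)))" for i using k(3) by (simp add: n_def)
  have "H (l i) \<le> 1" for i using l[of i] xy dual by (auto simp: H_def e_def d_def)
  then have "H (l (i + int 0)) = 1" for i
    using all_one_if_sum_large[of "\<lambda>j. H (l (i + int j))" n 0] sum[of i] k(2) by (simp add: n_def)
  then have one: "H (l i) = 1" for i by simp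
  define p q where "p = (if e = 1 then x else inv x)" and "q = (if d = 1 then y else inv y)"
  have "l i \<in> {p, q}" for i
    using l[of i] one[of i] xy dual by (auto simp: H_def e_def d_def p_def q_def split: if_splits)
  then show ?thesis unfolding l_def
    by (intro bexI[of _ p] bexI[of _ q]) (auto simp: p_def q_def)
qed

lemma rooted_ray_steps:
  assumes "rooted_primitive_ray G {x, y} \<eta>"
  shows "\<eta> 0 = \<one>" "\<And>i. \<eta> i \<in> carrier G"
    "\<exists>p\<in>{x, inv x}. \<exists>q\<in>{y, inv y}. \<forall>i. \<exists>l\<in>{p, q}. \<eta> (Suc i) = \<eta> i \<otimes> l"
proof -
  obtain \<gamma> c where gc: "primitive_elt G \<gamma>" "axis_of G {x, y} \<gamma> c" "range \<eta> \<subseteq> range c"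
    and ray: "geodesic_ray G {x, y} \<eta>" and "\<eta> 0 = \<one>"
    using assms unfolding rooted_primitive_ray_def primitive_ray_def by blast
  show "\<eta> 0 = \<one>" by fact
  have \<eta>: "\<eta> i \<in> carrier G" "int (wl (inv (\<eta> i) \<otimes> \<eta> j)) = \<bar>int i - int j\<bar>" for i j
  proof -
    have "range \<eta> \<subseteq> carrier G" "\<forall>i j. int (wl (inv (\<eta> i) \<otimes> \<eta> j)) = \<bar>int i - int j\<bar>"
      using ray unfolding geodesic_ray_def word_dist_def by simp_all
    then show "\<eta> i \<in> carrier G" "int (wl (inv (\<eta> i) \<otimes> \<eta> j)) = \<bar>int i - int j\<bar>" by blast+
  qed
  show "\<eta> i \<in> carrier G" for i by (rule \<eta>)
  note c = axis_points[OF gc(2)]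
  obtain p q where pq: "p \<in> {x, inv x}" "q \<in> {y, inv y}" "\<And>i. inv (c i) \<otimes> c (i + 1) \<in> {p, q}"
  proof -
    from axis_steps[OF gc(1,2)] show thesis by (elim bexE) (rule that, assumption+, erule spec)
  qed
  have car: "p \<in> carrier G" "q \<in> carrier G" using pq(1,2) xy by auto
  have "\<forall>i. \<exists>j. \<eta> i = c j" using gc(3) by blast
  then obtain g where g: "\<And>i. \<eta> i = c (g i)" by metis
  have iso: "\<bar>g i - g j\<bar> = \<bar>int i - int j\<bar>" for i j
    using \<eta>(2)[of i j] c(2)[of "g i" "g j"] by (simp add: g)
  have step: "\<eta> (Suc i) = \<eta> i \<otimes> (inv (\<eta> i) \<otimes> \<eta> (Suc i))" for i
    using \<eta>(1) by (simp flip: m_assoc)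
  show "\<exists>p\<in>{x, inv x}. \<exists>q\<in>{y, inv y}. \<forall>i. \<exists>l\<in>{p, q}. \<eta> (Suc i) = \<eta> i \<otimes> l"
  proof (rule ray_in_int_cases[of g, OF iso])
    assume up: "\<And>i. g i = g 0 + int i"
    have in_pq: "inv (\<eta> i) \<otimes> \<eta> (Suc i) \<in> {p, q}" for i
    proof -
      have "g (Suc i) = g i + 1" unfolding up[of i] up[of "Suc i"] by simp
      then show ?thesis using pq(3)[of "g i"] by (simp only: g)
    qed
    show ?thesis
    proof (rule bexI[OF _ pq(1)], rule bexI[OF _ pq(2)], rule allI)
      show "\<exists>l\<in>{p, q}. \<eta> (Suc i) = \<eta> i \<otimes> l" for i
        by (rule bexI[of _ "inv (\<eta> i) \<otimes> \<eta> (Suc i)"]) (rule step, rule in_pq)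
    qed
  next
    assume down: "\<And>i. g i = g 0 - int i"
    have "inv (\<eta> i) \<otimes> \<eta> (Suc i) \<in> {inv p, inv q}" for i
    proof -
      define j where "j = g (Suc i)"
      have j: "g i = j + 1" unfolding j_def down[of i] down[of "Suc i"] by simp
      have "inv (\<eta> i) \<otimes> \<eta> (Suc i) = inv (c (j + 1)) \<otimes> c j" by (simp only: g j flip: j_def)
      also have "\<dots> = inv (inv (c j) \<otimes> c (j + 1))" by (simp add: inv_mult_group c(1))
      finally show ?thesis using pq(3)[of j] by (elim insertE emptyE) simp_all
    qed
    note in_pq = this
    have pq': "inv p \<in> {x, inv x}" "inv q \<in> {y, inv y}" using pq(1,2) xy by auto
    show ?thesis
    proof (rule bexI[OF _ pq'(1)], rule bexI[OF _ pq'(2)], rule allI)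
      show "\<exists>l\<in>{inv p, inv q}. \<eta> (Suc i) = \<eta> i \<otimes> l" for i
        by (rule bexI[of _ "inv (\<eta> i) \<otimes> \<eta> (Suc i)"]) (rule step, rule in_pq)
    qed
  qed
qed

end

section \<open>Commutators and coordinates of generating pairs\<close>

context group
begin

definition infinite_order :: "'a \<Rightarrow> bool" where
  "infinite_order g \<longleftrightarrow> (\<forall>n::nat. 0 < n \<longrightarrow> g [^] n \<noteq> \<one>)"

lemma infinite_order_inv: "\<lbrakk>g \<in> carrier G; infinite_order g\<rbrakk> \<Longrightarrow> infinite_order (inv g)"
  by (simp add: infinite_order_def nat_pow_inv inv_eq_1_iff)

lemma infinite_order_conjugate:
  assumes "h \<in> carrier G" "g \<in> carrier G" "infinite_order g"
  shows "infinite_order (conjugate h g)"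
  unfolding infinite_order_def
proof (intro allI impI notI)
  fix n :: nat assume "0 < n" "conjugate h g [^] n = \<one>"
  then have "conjugate (inv h) (conjugate h (g [^] n)) = conjugate (inv h) \<one>"
    using assms by (simp add: conjugate_nat_pow)
  then have "g [^] n = \<one>" using assms(1,2) by (simp add: conjugate_def[of "inv h" \<one>])
  then show False using assms(3) \<open>0 < n\<close> by (simp add: infinite_order_def)
qed

definition comm :: "'a \<Rightarrow> 'a \<Rightarrow> 'a" where
  "comm u v = u \<otimes> v \<otimes> inv u \<otimes> inv v"

lemma comm_closed [simp]: "\<lbrakk>u \<in> carrier G; v \<in> carrier G\<rbrakk> \<Longrightarrow> comm u v \<in> carrier G"
  by (simp add: comm_def)

text \<open>A Nielsen move replaces the commutator by a conjugate of itself or of its inverse.\<close>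

lemma nielsen_equiv_comm_infinite_order:
  assumes "nielsen_equiv G u v a b" "u \<in> carrier G" "v \<in> carrier G" "infinite_order (comm u v)"
  shows "infinite_order (comm a b)"
  using assms
proof induction
  case (invert a b)
  have ab: "a \<in> carrier G" "b \<in> carrier G" using nielsen_equiv_closed[OF invert(1)] invert by auto
  have "infinite_order (conjugate (inv a) (inv (comm a b)))"
    by (rule infinite_order_conjugate[OF _ _ infinite_order_inv]) (use ab invert in simp_all)
  also have "conjugate (inv a) (inv (comm a b)) = comm (inv a) b"
    using ab by (simp add: conjugate_def comm_def inv_mult_group m_assoc)
  finally show ?case .
next
  case (swap a b)
  have ab: "a \<in> carrier G" "b \<in> carrier G" using nielsen_equiv_closed[OF swap(1)] swap by auto
  have "infinite_order (inv (comm a b))" by (rule infinite_order_inv) (use ab swap in simp_all)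
  also have "inv (comm a b) = comm b a" using ab by (simp add: comm_def inv_mult_group m_assoc)
  finally show ?case .
next
  case (mult a b)
  have ab: "a \<in> carrier G" "b \<in> carrier G" using nielsen_equiv_closed[OF mult(1)] mult by auto
  have "comm (a \<otimes> b) b = a \<otimes> b \<otimes> (b \<otimes> inv b) \<otimes> inv a \<otimes> inv b"
    using ab by (simp only: comm_def inv_mult_group m_assoc m_closed inv_closed)
  also have "\<dots> = comm a b" using ab by (simp add: comm_def)
  finally show ?case using mult by simp
next
  case (conj a b h)
  have ab: "a \<in> carrier G" "b \<in> carrier G" using nielsen_equiv_closed[OF conj(1)] conj by auto
  have "infinite_order (conjugate h (comm a b))"
    by (rule infinite_order_conjugate) (use ab conj in simp_all)
  also have "conjugate h (comm a b) = comm (conjugate h a) (conjugate h b)"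
    using ab conj(2) by (simp add: comm_def conjugate_mult conjugate_inv)
  finally show ?case by (simp add: conjugate_def)
qed

definition additive :: "('a \<Rightarrow> int) \<Rightarrow> bool" where
  "additive f \<longleftrightarrow> (\<forall>g\<in>carrier G. \<forall>h\<in>carrier G. f (g \<otimes> h) = f g + f h)"

lemma additive_mult: "\<lbrakk>additive f; g \<in> carrier G; h \<in> carrier G\<rbrakk> \<Longrightarrow> f (g \<otimes> h) = f g + f h"
  by (simp add: additive_def)

lemma additive_inv: "\<lbrakk>additive f; g \<in> carrier G\<rbrakk> \<Longrightarrow> f (inv g) = - f g"
  using additive_mult[of f g "inv g"] additive_mult[of f \<one> \<one>] by simp

text \<open>A Nielsen move changes the dual coordinates by an integral change of basis.\<close>

lemma nielsen_equiv_coordinates: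
  assumes "nielsen_equiv G u v a b" "u \<in> carrier G" "v \<in> carrier G"
    and "\<exists>\<phi> \<psi>. additive \<phi> \<and> additive \<psi> \<and> \<phi> u = 1 \<and> \<phi> v = 0 \<and> \<psi> u = 0 \<and> \<psi> v = 1"
  shows "\<exists>\<phi> \<psi>. additive \<phi> \<and> additive \<psi> \<and> \<phi> a = 1 \<and> \<phi> b = 0 \<and> \<psi> a = 0 \<and> \<psi> b = 1"
  using assms
proof induction
  case (invert a b)
  have ab: "a \<in> carrier G" "b \<in> carrier G" using nielsen_equiv_closed[OF invert(1)] invert by auto
  obtain \<phi> \<psi> where *: "additive \<phi>" "additive \<psi>" "\<phi> a = 1" "\<phi> b = 0" "\<psi> a = 0" "\<psi> b = 1"
    using invert.IH[OF invert.prems] by blast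
  have "additive (\<lambda>g. - \<phi> g)" using *(1) by (simp add: additive_def)
  then show ?case using * ab by (intro exI[of _ "\<lambda>g. - \<phi> g"] exI[of _ \<psi>]) (simp add: additive_inv)
next
  case (swap a b)
  then show ?case by blast
next
  case (mult a b)
  have ab: "a \<in> carrier G" "b \<in> carrier G" using nielsen_equiv_closed[OF mult(1)] mult by auto
  obtain \<phi> \<psi> where *: "additive \<phi>" "additive \<psi>" "\<phi> a = 1" "\<phi> b = 0" "\<psi> a = 0" "\<psi> b = 1"
    using mult.IH[OF mult.prems] by blast
  have "additive (\<lambda>g. \<psi> g - \<phi> g)" using *(1,2) by (simp add: additive_def)
  then show ?case using * ab
    by (intro exI[of _ \<phi>] exI[of _ "\<lambda>g. \<psi> g - \<phi> g"]) (simp add: additive_mult)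
next
  case (conj a b h)
  have ab: "a \<in> carrier G" "b \<in> carrier G" using nielsen_equiv_closed[OF conj(1)] conj by auto
  obtain \<phi> \<psi> where *: "additive \<phi>" "additive \<psi>" "\<phi> a = 1" "\<phi> b = 0" "\<psi> a = 0" "\<psi> b = 1"
    using conj.IH[OF conj.prems] by blast
  then show ?case using ab conj(2)
    by (intro exI[of _ \<phi>] exI[of _ \<psi>]) (simp add: additive_mult additive_inv)
qed

end

lemma (in free_group) generating_pair_facts:
  assumes B2: "card B = 2" and uv: "u \<in> carrier G" "v \<in> carrier G" "generate G {u, v} = carrier G"
  shows "infinite_order (comm u v)"
    and "\<exists>\<phi> \<psi>. generating_pair G u v \<phi> \<psi>"
proof -
  obtain x y where B: "B = {x, y}" "x \<noteq> y" using B2 by (auto simp: card_2_iff)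
  have xB: "x \<in> B" "y \<in> B" using B by simp_all
  have xy: "x \<in> carrier G" "y \<in> carrier G" using xB B_carrier by auto
  have to_basis: "nielsen_equiv G a b x y"
    if "a \<in> carrier G" "b \<in> carrier G" "generate G {a, b} = carrier G" for a b
    by (rule generating_pair_nielsen_equiv_basis[OF B that])
  have from_basis: "nielsen_equiv G x y u v" by (rule nielsen_equiv_sym[OF to_basis[OF uv] uv(1,2)])
  have "infinite_order (comm x y)"
    unfolding infinite_order_def comm_def using commutator_power_nontrivial[OF xB B(2)] by blast
  then show "infinite_order (comm u v)"
    by (rule nielsen_equiv_comm_infinite_order[OF from_basis xy])
  have "additive (exponent_sum x)" "additive (exponent_sum y)"
    by (simp_all add: additive_def exponent_sum_mult)
  moreover have "exponent_sum x x = 1" "exponent_sum x y = 0" "exponent_sum y x = 0" "exponent_sum y y = 1"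
    using B(2) by (simp_all add: exponent_sum_basis xB)
  ultimately obtain \<phi> \<psi> where *: "additive \<phi>" "additive \<psi>" "\<phi> u = 1" "\<phi> v = 0" "\<psi> u = 0" "\<psi> v = 1"
    using nielsen_equiv_coordinates[OF from_basis xy] by blast
  have "generating_pair G u v \<phi> \<psi>"
  proof
    fix a b assume ab: "a \<in> carrier G" "b \<in> carrier G" "generate G {a, b} = carrier G"
    show "nielsen_equiv G u v a b"
      by (rule nielsen_equiv_trans[OF to_basis[OF uv] nielsen_equiv_sym[OF to_basis[OF ab] ab(1,2)]])
  qed (use uv * in \<open>simp_all add: additive_mult\<close>)
  then show "\<exists>\<phi> \<psi>. generating_pair G u v \<phi> \<psi>" by blast
qed

section \<open>Contraction by products of positive matrices\<close>

definition mat_prod :: "(real^3^3) list \<Rightarrow> real^3^3" where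
  "mat_prod As = foldr (**) As (mat 1)"

lemma mat_prod_Nil [simp]: "mat_prod [] = mat 1"
  by (simp add: mat_prod_def)

lemma mat_prod_Cons [simp]: "mat_prod (A # As) = A ** mat_prod As"
  by (simp add: mat_prod_def)

text \<open>Birkhoff's contraction of the positive cone in elementary form.  Both \<open>z - m h\<close> and \<open>M h - z\<close> are
nonnegative and their coordinate sums add up to \<open>M - m\<close> times that of \<open>h\<close>; the larger of the two is
mapped by \<open>P\<close> above a fixed multiple of \<open>(M - m) P h\<close>, and this improves one of the two bounds.\<close>

lemma positive_matrix_contracts_ratio:
  fixes P :: "real^3^3" and h z :: "real^3"
  assumes P: "\<And>i j. a \<le> P$i$j \<and> P$i$j \<le> A" and a: "0 < a"
    and h: "\<And>i. 0 < h$i" and z: "\<And>i. m * h$i \<le> z$i \<and> z$i \<le> M * h$i"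
  shows "\<exists>m' M'. M' - m' = (1 - a / (2 * A)) * (M - m) \<and>
    (\<forall>i. 0 < (P *v h)$i \<and> m' * (P *v h)$i \<le> (P *v z)$i \<and> (P *v z)$i \<le> M' * (P *v h)$i)"
proof -
  define y where "y = z - m *\<^sub>R h"
  define y' where "y' = M *\<^sub>R h - z"
  define S where "S = (\<lambda>x::real^3. \<Sum>j\<in>UNIV. x$j)"
  have A: "0 < A" using P[of 1 1] a by linarith
  have lower: "a * S x \<le> (P *v x)$i" if "\<And>j. 0 \<le> x$j" for x i
    unfolding S_def matrix_vector_mult_def
    by (simp add: sum_distrib_left) (intro sum_mono mult_right_mono, use P that in auto)
  have upper: "(P *v x)$i \<le> A * S x" if "\<And>j. 0 \<le> x$j" for x i
    unfolding S_def matrix_vector_mult_def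
    by (simp add: sum_distrib_left) (intro sum_mono mult_right_mono, use P that in auto)
  have S_h: "0 < S h" unfolding S_def by (intro sum_pos) (use h in auto)
  have pos: "0 < (P *v h)$i" for i
    using lower[of h i] mult_pos_pos[OF a S_h] h by (meson less_imp_le less_le_trans)
  have y0: "0 \<le> y$j" "0 \<le> y'$j" for j using z[of j] by (auto simp: y_def y'_def)
  have "S y + S y' = (M - m) * S h"
    by (simp add: S_def y_def y'_def sum_subtractf sum_distrib_left algebra_simps flip: sum.distrib)
  moreover have "a / (2 * A) * (M - m) * (P *v h)$i \<le> (P *v x)$i"
    if "(M - m) * S h \<le> 2 * S x" and x: "\<And>j. 0 \<le> x$j" for x i
  proof -
    have "0 \<le> M - m"
      using z[of 1] h[of 1] by (meson diff_ge_0_iff_ge mult_le_cancel_right_pos order_trans)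
    then have "a / (2 * A) * (M - m) * (P *v h)$i \<le> a / (2 * A) * (M - m) * (A * S h)"
      using upper[of h i] h a A by (intro mult_left_mono) (auto simp: less_imp_le)
    also have "\<dots> = a / 2 * ((M - m) * S h)" using A by simp
    also have "\<dots> \<le> a / 2 * (2 * S x)" using that a by (intro mult_left_mono) auto
    also have "\<dots> \<le> (P *v x)$i" using lower[of x i] x by simp
    finally show ?thesis .
  qed
  moreover have "(M - m) * S h \<le> 2 * S y \<or> (M - m) * S h \<le> 2 * S y'"
    using calculation by linarith
  ultimately consider "\<And>i. a / (2 * A) * (M - m) * (P *v h)$i \<le> (P *v y)$i"
    | "\<And>i. a / (2 * A) * (M - m) * (P *v h)$i \<le> (P *v y')$i"
    using y0 by blast
  moreover have Py: "(P *v y)$i = (P *v z)$i - m * (P *v h)$i"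
    and Py': "(P *v y')$i = M * (P *v h)$i - (P *v z)$i" for i
    by (simp_all add: y_def y'_def matrix_vector_mult_diff_distrib matrix_vector_mult_scaleR)
  moreover have Px: "0 \<le> (P *v x)$i" if "\<And>j. 0 \<le> x$j" for x i
  proof -
    have "0 \<le> S x" unfolding S_def using that by (intro sum_nonneg) auto
    then show ?thesis using lower[of x i, OF that] a by (meson less_imp_le mult_nonneg_nonneg order_trans)
  qed
  ultimately show ?thesis
  proof cases
    case 1
    have "(m + a / (2 * A) * (M - m)) * (P *v h)$i \<le> (P *v z)$i \<and> (P *v z)$i \<le> M * (P *v h)$i" for i
      using 1[of i] Py[of i] Py'[of i] Px[OF y0(2), of i] by (simp add: distrib_right)
    then show ?thesis
      by (intro exI[of _ "m + a / (2 * A) * (M - m)"] exI[of _ M]) (use pos in \<open>simp add: algebra_simps\<close>)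
  next
    case 2
    have "m * (P *v h)$i \<le> (P *v z)$i \<and> (P *v z)$i \<le> (M - a / (2 * A) * (M - m)) * (P *v h)$i" for i
      using 2[of i] Py[of i] Py'[of i] Px[OF y0(1), of i] by (simp add: left_diff_distrib)
    then show ?thesis
      by (intro exI[of _ m] exI[of _ "M - a / (2 * A) * (M - m)"]) (use pos in \<open>simp add: algebra_simps\<close>)
  qed
qed

lemma positive_product_ratio:
  fixes z :: "real^3"
  assumes P: "\<forall>P\<in>set Ps. \<forall>i j. a \<le> P$i$j \<and> P$i$j \<le> A" and a: "0 < a"
    and z: "\<And>i. \<bar>z$i\<bar> \<le> r"
  shows "\<exists>m M. M - m = (1 - a / (2 * A)) ^ length Ps * (2 * r) \<and>
    (\<forall>i. 0 < (mat_prod Ps *v 1)$i \<and> m * (mat_prod Ps *v 1)$i \<le> (mat_prod Ps *v z)$i \<and>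
      (mat_prod Ps *v z)$i \<le> M * (mat_prod Ps *v 1)$i)"
  using P
proof (induction Ps)
  case Nil
  show ?case
    by (rule exI[of _ "-r"], rule exI[of _ r]) (use z in \<open>auto simp: abs_le_iff minus_le_iff\<close>)
next
  case (Cons P Ps)
  then obtain m M where "M - m = (1 - a / (2 * A)) ^ length Ps * (2 * r)"
    and *: "\<forall>i. 0 < (mat_prod Ps *v 1)$i \<and> m * (mat_prod Ps *v 1)$i \<le> (mat_prod Ps *v z)$i \<and>
      (mat_prod Ps *v z)$i \<le> M * (mat_prod Ps *v 1)$i" by auto
  moreover obtain m' M' where "M' - m' = (1 - a / (2 * A)) * (M - m)"
    "\<forall>i. 0 < (P *v (mat_prod Ps *v 1))$i \<and>
      m' * (P *v (mat_prod Ps *v 1))$i \<le> (P *v (mat_prod Ps *v z))$i \<and>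
      (P *v (mat_prod Ps *v z))$i \<le> M' * (P *v (mat_prod Ps *v 1))$i"
    using positive_matrix_contracts_ratio[of a P A "mat_prod Ps *v 1" m "mat_prod Ps *v z" M] * a Cons.prems
    by auto
  ultimately show ?case
    by (intro exI[of _ m'] exI[of _ M']) (simp add: matrix_vector_mul_assoc)
qed

text \<open>When the coordinate sum of the image vanishes, the bounds \<open>m\<close> and \<open>M\<close> have opposite signs, so the
image is at most \<open>M - m\<close> times the image of the vector of ones.\<close>

lemma positive_product_kernel_bound:
  fixes z :: "real^3"
  assumes P: "\<forall>P\<in>set Ps. \<forall>i j. a \<le> P$i$j \<and> P$i$j \<le> A" and a: "0 < a"
    and sum0: "(\<Sum>i\<in>UNIV. (mat_prod Ps *v z)$i) = 0"
  shows "norm (mat_prod Ps *v z) \<le> 2 * (1 - a / (2 * A)) ^ length Ps * norm z * norm (mat_prod Ps *v 1)"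
proof -
  define h where "h = mat_prod Ps *v 1"
  define w where "w = mat_prod Ps *v z"
  have "\<bar>z$i\<bar> \<le> norm z" for i by (rule component_le_norm_cart)
  then obtain m M where mM: "M - m = (1 - a / (2 * A)) ^ length Ps * (2 * norm z)"
    and h: "\<And>i. 0 < h$i" and w: "\<And>i. m * h$i \<le> w$i \<and> w$i \<le> M * h$i"
    using positive_product_ratio[OF P a, of z "norm z"] unfolding h_def w_def by blast
  have S: "0 < (\<Sum>i\<in>UNIV. h$i)" by (intro sum_pos) (use h in auto)
  have "m * (\<Sum>i\<in>UNIV. h$i) \<le> (\<Sum>i\<in>UNIV. w$i)" "(\<Sum>i\<in>UNIV. w$i) \<le> M * (\<Sum>i\<in>UNIV. h$i)"
    unfolding sum_distrib_left using w by (auto intro: sum_mono)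
  then have "m \<le> 0" "0 \<le> M" using S sum0 by (auto simp: w_def[symmetric] mult_le_0_iff zero_le_mult_iff)
  have "\<bar>w$i\<bar> \<le> ((M - m) *\<^sub>R h)$i" for i
  proof -
    have "M * h$i \<le> (M - m) * h$i" "- m * h$i \<le> (M - m) * h$i"
      by (rule mult_right_mono; use h[of i] \<open>m \<le> 0\<close> \<open>0 \<le> M\<close> in simp)+
    then show ?thesis using w[of i] by auto
  qed
  then have "norm w \<le> norm ((M - m) *\<^sub>R h)"
    by (intro norm_le_componentwise_cart) (use abs_ge_self order_trans in \<open>fastforce simp del: abs_ge_self\<close>)
  also have "\<dots> = (M - m) * norm h" using \<open>m \<le> 0\<close> \<open>0 \<le> M\<close> by simp
  finally show ?thesis unfolding mM h_def w_def by (simp add: mult_ac)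
qed

text \<open>The rows of \<open>Q\<close> are linear forms, and the cone is where they are nonnegative; \<open>g\<close> maps it into its
interior, because in the coordinates \<open>Q\<close> it is given by a positive matrix.\<close>

definition preserves_cone :: "real^3^3 \<Rightarrow> real^3^3 \<Rightarrow> bool" where
  "preserves_cone Q g \<longleftrightarrow> (\<exists>P. (\<forall>i j. 0 < P$i$j) \<and> Q ** g = P ** Q)"

lemma matrix_vector_bound:
  fixes Q :: "real^3^3"
  obtains K where "0 < K" "\<And>x. norm (Q *v x) \<le> K * norm x"
  using bounded_linear.pos_bounded[OF matrix_vector_mul_bounded_linear[of Q]]
  by (metis mult.commute)

text \<open>Long products are nearly of rank one: they almost annihilate the plane that they send into the
kernel of the sum of the linear forms defining the cone.\<close>

lemma cone_semigroup_kernel_bound: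
  assumes fin: "finite G" and Q: "invertible Q" and G: "\<And>g. g \<in> G \<Longrightarrow> preserves_cone Q g"
  obtains C q e where "0 < C" "0 < q" "q < 1"
    "\<And>As x. \<lbrakk>set As \<subseteq> G; (\<Sum>i\<in>UNIV. (Q *v (mat_prod As *v x))$i) = 0\<rbrakk> \<Longrightarrow>
      norm (mat_prod As *v x) \<le> C * q ^ length As * norm x * norm (mat_prod As *v e)"
proof -
  obtain Pf where Pf: "\<And>g. g \<in> G \<Longrightarrow> (\<forall>i j. 0 < Pf g $ i $ j) \<and> Q ** g = Pf g ** Q"
    using G unfolding preserves_cone_def by metis
  define E where "E = insert 1 ((\<lambda>(g,i,j). Pf g $ i $ j) ` (G \<times> UNIV \<times> UNIV))"
  have E: "finite E" "E \<noteq> {}" "\<And>x. x \<in> E \<Longrightarrow> 0 < x" using fin Pf by (auto simp: E_def)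
  define a A where "a = Min E" and "A = Max E"
  have a: "0 < a" using E by (simp add: a_def)
  have aA: "a \<le> 1" "1 \<le> A" using E by (auto simp: a_def A_def E_def)
  have P: "a \<le> Pf g $ i $ j \<and> Pf g $ i $ j \<le> A" if "g \<in> G" for g i j
  proof -
    have "Pf g $ i $ j \<in> E" unfolding E_def using that by (auto intro!: image_eqI[of _ _ "(g, i, j)"])
    then show ?thesis using E by (simp add: a_def A_def)
  qed
  define q where "q = 1 - a / (2 * A)"
  have q: "0 < q" "q < 1" using a aA by (auto simp: q_def field_simps)
  obtain R where R: "Q ** R = mat 1" "R ** Q = mat 1" using Q by (auto simp: invertible_def)
  obtain K1 where K1: "0 < K1" "\<And>x. norm (R *v x) \<le> K1 * norm x" by (rule matrix_vector_bound[of R]) auto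
  obtain K2 where K2: "0 < K2" "\<And>x. norm (Q *v x) \<le> K2 * norm x" by (rule matrix_vector_bound[of Q]) auto
  show thesis
  proof (rule that[of "K1 * 2 * K2 * K2" q "R *v 1"])
    fix As x assume As: "set As \<subseteq> G" and s: "(\<Sum>i\<in>UNIV. (Q *v (mat_prod As *v x))$i) = 0"
    define W where "W = mat_prod (map Pf As)"
    have "Q ** mat_prod As = W ** Q"
      using As unfolding W_def
    proof (induction As)
      case (Cons g As)
      then have IH: "Q ** mat_prod As = mat_prod (map Pf As) ** Q" and g: "Q ** g = Pf g ** Q"
        using Pf[of g] by auto
      show ?case
        by (simp add: IH g matrix_mul_assoc) (simp add: IH g flip: matrix_mul_assoc)
    qed simp
    then have QW: "Q *v (mat_prod As *v y) = W *v (Q *v y)" for y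
      by (simp add: matrix_vector_mul_assoc)
    have "norm (mat_prod As *v x) = norm (R *v (Q *v (mat_prod As *v x)))"
      using R by (simp add: matrix_vector_mul_assoc matrix_mul_assoc)
    also have "\<dots> \<le> K1 * norm (W *v (Q *v x))" using K1(2) by (simp add: QW)
    also have "norm (W *v (Q *v x)) \<le> 2 * q ^ length As * norm (Q *v x) * norm (W *v 1)"
      using positive_product_kernel_bound[of "map Pf As" a A "Q *v x"] P As a s
      by (auto simp: W_def QW q_def)
    also have "W *v 1 = Q *v (mat_prod As *v (R *v 1))"
      using R by (simp add: QW) (simp add: matrix_vector_mul_assoc)
    also have "2 * q ^ length As * norm (Q *v x) * norm (Q *v (mat_prod As *v (R *v 1))) \<le>
      2 * q ^ length As * (K2 * norm x) * (K2 * norm (mat_prod As *v (R *v 1)))"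
      using K2 q by (intro mult_mono) auto
    finally show "norm (mat_prod As *v x) \<le> K1 * 2 * K2 * K2 * q ^ length As * norm x *
        norm (mat_prod As *v (R *v 1))"
      using K1(1) by (simp add: mult_ac)
  qed (use K1 K2 q in auto)
qed
(*X*)

section \<open>Singular values with respect to an inner product\<close>

definition is_svd :: "(real^3 \<Rightarrow> real^3 \<Rightarrow> real) \<Rightarrow> real^3^3 \<Rightarrow> real^3 \<Rightarrow>
    (3 \<Rightarrow> real^3) \<Rightarrow> (3 \<Rightarrow> real^3) \<Rightarrow> bool" where
  "is_svd ip A s u v \<longleftrightarrow> s$1 \<ge> s$2 \<and> s$2 \<ge> s$3 \<and> s$3 \<ge> 0 \<and>
     orthonormal_frame ip u \<and> orthonormal_frame ip v \<and> (\<forall>i. A *v v i = s$i *\<^sub>R u i)"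

locale inner_product_R3 =
  fixes ip :: "real^3 \<Rightarrow> real^3 \<Rightarrow> real"
  assumes ip: "inner_product ip"
begin

lemma ip_bilinear: "bilinear ip" and ip_sym: "ip x y = ip y x" and ip_pos: "x \<noteq> 0 \<Longrightarrow> 0 < ip x x"
  using ip by (auto simp: inner_product_def)

lemma ip_simps [simp]:
  "ip 0 x = 0" "ip x 0 = 0" "ip (x + y) z = ip x z + ip y z" "ip z (x + y) = ip z x + ip z y"
  "ip (x - y) z = ip x z - ip y z" "ip z (x - y) = ip z x - ip z y"
  "ip (c *\<^sub>R x) z = c * ip x z" "ip z (c *\<^sub>R x) = c * ip z x"
  using ip_bilinear
  by (simp_all add: bilinear_lzero bilinear_rzero bilinear_ladd bilinear_radd bilinear_lsub
      bilinear_rsub bilinear_lmul bilinear_rmul)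

lemma ip_nonneg: "0 \<le> ip x x"
  using ip_pos[of x] by (cases "x = 0") auto

lemma ip_sum_left: "ip (\<Sum>i\<in>I. f i) x = (\<Sum>i\<in>I. ip (f i) x)"
  using ip_bilinear linear_sum[of "\<lambda>y. ip y x" f I] by (simp add: bilinear_def)

lemma ip_sum_right: "ip x (\<Sum>i\<in>I. f i) = (\<Sum>i\<in>I. ip x (f i))"
  using ip_bilinear linear_sum[of "ip x" f I] by (simp add: bilinear_def)

lemma frame_sum:
  assumes "orthonormal_frame ip u"
  shows "ip (\<Sum>i\<in>UNIV. c i *\<^sub>R u i) (\<Sum>i\<in>UNIV. d i *\<^sub>R u i) = (\<Sum>i\<in>UNIV. c i * d i)"
proof -
  have uu: "ip (u i) (u j) = (if i = j then 1 else 0)" for i j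
    using assms by (simp add: orthonormal_frame_def)
  show ?thesis
    by (simp add: uu ip_sum_left ip_sum_right mult.commute if_distrib[of "(*) _"] cong: if_cong)
qed

lemma frame_coeff:
  assumes "orthonormal_frame ip u"
  shows "ip (\<Sum>i\<in>UNIV. c i *\<^sub>R u i) (u j) = c j"
proof -
  have uu: "ip (u i) (u j) = (if i = j then 1 else 0)" for i j
    using assms by (simp add: orthonormal_frame_def)
  show ?thesis
    by (simp add: uu ip_sum_left if_distrib[of "(*) _"] cong: if_cong)
qed

lemma frame_expand:
  assumes v: "orthonormal_frame ip v"
  shows "x = (\<Sum>i\<in>UNIV. ip x (v i) *\<^sub>R v i)"
proof -
  define f where "f = (\<lambda>c::real^3. \<Sum>i\<in>UNIV. c$i *\<^sub>R v i)"
  have lin: "linear f"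
    by (rule linearI) (simp_all add: f_def scaleR_left_distrib sum.distrib scaleR_sum_right)
  have "inj f"
  proof (rule injI)
    fix c d assume "f c = f d"
    then have "ip (f c) (v j) = ip (f d) (v j)" for j by simp
    then show "c = d" by (simp add: f_def frame_coeff[OF v] vec_eq_iff)
  qed
  then have "surj f" using lin by (simp add: linear_injective_imp_surjective)
  then obtain c where "x = f c" by auto
  then show ?thesis by (simp add: f_def frame_coeff[OF v])
qed

lemma frame_norm:
  assumes "orthonormal_frame ip v"
  shows "ip x x = (\<Sum>i\<in>UNIV. (ip x (v i))\<^sup>2)"
  using frame_sum[OF assms, of "\<lambda>i. ip x (v i)" "\<lambda>i. ip x (v i)"] frame_expand[OF assms, of x]
  by (simp add: power2_eq_square)

lemma frame_image_norm:
  assumes u: "orthonormal_frame ip u" and v: "orthonormal_frame ip v"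
    and A: "\<And>i. A *v v i = \<sigma> i *\<^sub>R u i"
  shows "ip (A *v x) (A *v x) = (\<Sum>i\<in>UNIV. (\<sigma> i)\<^sup>2 * (ip x (v i))\<^sup>2)"
proof -
  have "A *v x = A *v (\<Sum>i\<in>UNIV. ip x (v i) *\<^sub>R v i)"
    using frame_expand[OF v, of x] by simp
  also have "\<dots> = (\<Sum>i\<in>UNIV. (ip x (v i) * \<sigma> i) *\<^sub>R u i)"
    by (simp add: linear_sum[OF matrix_vector_mul_linear] matrix_vector_mult_scaleR A)
  finally show ?thesis
    by (simp add: frame_sum[OF u] power2_eq_square mult_ac)
qed

lemma is_svd_form:
  assumes "is_svd ip A s u v"
  shows "ip (A *v x) (A *v x) = (\<Sum>i\<in>UNIV. (s$i)\<^sup>2 * (ip x (v i))\<^sup>2)"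
  using assms by (intro frame_image_norm[of u]) (simp_all add: is_svd_def)

lemma is_svd_order:
  assumes "is_svd ip A s u v"
  shows "0 \<le> s$3" "s$3 \<le> s$i" "s$i \<le> s$1" "0 \<le> s$i"
proof -
  have "0 \<le> s$3" "s$3 \<le> s$2" "s$2 \<le> s$1" using assms by (simp_all add: is_svd_def)
  then have "\<forall>i. 0 \<le> s$3 \<and> s$3 \<le> s$i \<and> s$i \<le> s$1 \<and> 0 \<le> s$i"
    unfolding forall_3 by linarith
  then show "0 \<le> s$3" "s$3 \<le> s$i" "s$i \<le> s$1" "0 \<le> s$i" by blast+
qed

text \<open>The largest and the smallest singular value are the extreme values of \<open>\<bar>A x\<bar> / \<bar>x\<bar>\<close>, and the sum of
squares is a trace, which Parseval's identity shows to be independent of the frame.\<close>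

lemma is_svd_compare:
  assumes s: "is_svd ip A s u v" and s': "is_svd ip A s' u' v'"
  shows "s'$1 \<le> s$1" "s$3 \<le> s'$3" "(\<Sum>i\<in>UNIV. (s'$i)\<^sup>2) = (\<Sum>i\<in>UNIV. (s$i)\<^sup>2)"
proof -
  note ord = is_svd_order[OF s] is_svd_order[OF s']
  have v: "orthonormal_frame ip v" and v': "orthonormal_frame ip v'"
    using s s' by (simp_all add: is_svd_def)
  have v'1: "ip (v' i) (v' i) = 1" and v1: "ip (v i) (v i) = 1" for i
    using v v' by (simp_all add: orthonormal_frame_def)
  have one: "(\<Sum>i\<in>UNIV. (ip (v' j) (v i))\<^sup>2) = 1" "(\<Sum>i\<in>UNIV. (ip (v j) (v' i))\<^sup>2) = 1" for j
    by (simp_all only: v'1 v1 flip: frame_norm[OF v] frame_norm[OF v'])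
  have q': "(s'$j)\<^sup>2 = (\<Sum>i\<in>UNIV. (s$i)\<^sup>2 * (ip (v' j) (v i))\<^sup>2)" for j
  proof -
    have "A *v v' j = s'$j *\<^sub>R u' j" "ip (u' j) (u' j) = 1"
      using s' by (simp_all add: is_svd_def orthonormal_frame_def)
    then have "(s'$j)\<^sup>2 = ip (A *v v' j) (A *v v' j)" by (simp add: power2_eq_square)
    then show ?thesis by (simp only: is_svd_form[OF s])
  qed
  have "(s'$1)\<^sup>2 \<le> (\<Sum>i\<in>UNIV. (s$1)\<^sup>2 * (ip (v' 1) (v i))\<^sup>2)"
    unfolding q' by (intro sum_mono mult_right_mono power_mono ord zero_le_power2)
  also have "\<dots> = (s$1)\<^sup>2" by (simp only: one mult_1_right flip: sum_distrib_left)
  finally show "s'$1 \<le> s$1" using ord(4) by (rule power2_le_imp_le)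
  have "(s$3)\<^sup>2 = (\<Sum>i\<in>UNIV. (s$3)\<^sup>2 * (ip (v' 3) (v i))\<^sup>2)"
    by (simp only: one mult_1_right flip: sum_distrib_left)
  also have "\<dots> \<le> (s'$3)\<^sup>2"
    unfolding q' by (intro sum_mono mult_right_mono power_mono ord zero_le_power2)
  finally show "s$3 \<le> s'$3" using ord(5) by (rule power2_le_imp_le)
  have "(\<Sum>j\<in>UNIV. (s'$j)\<^sup>2) = (\<Sum>i\<in>UNIV. \<Sum>j\<in>UNIV. (s$i)\<^sup>2 * (ip (v i) (v' j))\<^sup>2)"
    unfolding q' by (subst sum.swap) (simp only: ip_sym[of "v _"])
  also have "\<dots> = (\<Sum>i\<in>UNIV. (s$i)\<^sup>2)"
    by (simp only: one mult_1_right flip: sum_distrib_left)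
  finally show "(\<Sum>i\<in>UNIV. (s'$i)\<^sup>2) = (\<Sum>i\<in>UNIV. (s$i)\<^sup>2)" .
qed

lemma is_svd_unique:
  assumes s: "is_svd ip A s u v" and s': "is_svd ip A s' u' v'"
  shows "s = s'"
proof -
  note cmp = is_svd_compare[OF s s'] is_svd_compare[OF s' s]
  have 13: "s'$1 = s$1" "s'$3 = s$3" using cmp(1,2,4,5) by simp_all
  have "(s'$2)\<^sup>2 = (s$2)\<^sup>2" using cmp(3) 13 by (simp add: sum_3)
  then have "s'$2 = s$2"
    by (rule power2_eq_imp_eq) (rule is_svd_order[OF s] is_svd_order[OF s'])+
  with 13 show ?thesis by (simp add: vec_eq_iff forall_3)
qed

text \<open>A maximizer of \<open>q x x / ip x x\<close> is critical in all orthogonal directions.\<close>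

lemma quadratic_form_maximizer:
  assumes V: "subspace V" "x0 \<in> V" "x0 \<noteq> 0"
    and q: "bilinear q" and q_sym: "\<And>x y. q x y = q y x"
  obtains v where "v \<in> V" "ip v v = 1" "\<And>w. \<lbrakk>w \<in> V; ip v w = 0\<rbrakk> \<Longrightarrow> q v w = 0"
    "\<And>w. w \<in> V \<Longrightarrow> q w w \<le> q v v * ip w w"
proof -
  have q_simps: "q (x + y) z = q x z + q y z" "q z (x + y) = q z x + q z y"
    "q (c *\<^sub>R x) z = c * q x z" "q z (c *\<^sub>R x) = c * q z x" "q 0 z = 0" for x y z :: "real^3" and c
    using q by (simp_all add: bilinear_ladd bilinear_radd bilinear_lmul bilinear_rmul bilinear_lzero)
  define S where "S = V \<inter> sphere 0 1"
  have "compact S"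
    unfolding S_def by (intro closed_Int_compact closed_subspace V) auto
  moreover have "(1 / norm x0) *\<^sub>R x0 \<in> S"
    using V by (simp add: S_def subspace_scale)
  moreover have "ip x x \<noteq> 0" if "x \<in> S" for x
    using that ip_pos[of x] by (cases "x = 0") (auto simp: S_def)
  then have "continuous_on S (\<lambda>x. q x x / ip x x)"
    using q ip_bilinear unfolding bilinear_conv_bounded_bilinear
    by (intro continuous_on_divide bounded_bilinear.continuous_on[of q] bounded_bilinear.continuous_on[of ip]
      continuous_on_id) auto
  ultimately obtain m where m: "m \<in> S" "\<And>x. x \<in> S \<Longrightarrow> q x x / ip x x \<le> q m m / ip m m"
    using continuous_attains_sup[of S "\<lambda>x. q x x / ip x x"] by auto
  have "m \<noteq> 0" using m by (auto simp: S_def)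
  define M where "M = q m m / ip m m"
  have M: "q w w \<le> M * ip w w" if "w \<in> V" for w
  proof (cases "w = 0")
    case False
    then have "(1 / norm w) *\<^sub>R w \<in> S" using that V by (simp add: S_def subspace_scale)
    from m(2)[OF this] have "q w w / ip w w \<le> M" using False by (simp add: M_def q_simps)
    then show ?thesis using ip_pos[OF False] by (simp add: field_simps)
  qed (simp add: q_simps)
  define v where "v = (1 / sqrt (ip m m)) *\<^sub>R m"
  have v: "v \<in> V" "ip v v = 1" "q v v = M"
    using m V ip_pos[OF \<open>m \<noteq> 0\<close>] by (auto simp: v_def S_def subspace_scale M_def q_simps)
  show thesis
  proof (rule that[of v])
    fix w assume w: "w \<in> V" "ip v w = 0"
    define K where "K = M * ip w w - q w w"
    have "0 \<le> K" using M w by (simp add: K_def)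
    have var: "2 * s * q v w \<le> s\<^sup>2 * K" for s
    proof -
      have "v + s *\<^sub>R w \<in> V" using v w V by (simp add: subspace_add subspace_scale)
      from M[OF this] show ?thesis
        using v w ip_sym[of w v] q_sym[of w v] by (simp add: q_simps K_def algebra_simps power2_eq_square)
    qed
    show "q v w = 0"
    proof (rule ccontr)
      assume "q v w \<noteq> 0"
      \<comment> \<open>the step that violates \<open>var\<close>, as its right-hand side is quadratic in \<open>s\<close>\<close>
      define s where "s = q v w / (K + 1)"
      have s: "q v w = s * (K + 1)" "0 < s\<^sup>2"
        using \<open>0 \<le> K\<close> \<open>q v w \<noteq> 0\<close> by (auto simp: s_def)
      have "s\<^sup>2 * (2 * (K + 1)) \<le> s\<^sup>2 * K"
        using var[of s] by (simp add: s(1) power2_eq_square mult_ac)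
      then have "2 * (K + 1) \<le> K" using s(2) by (simp only: mult_le_cancel_left_pos)
      then show False using \<open>0 \<le> K\<close> by simp
    qed
  qed (use v M in auto)
qed

lemma exists_orthogonal: "\<exists>x. x \<noteq> 0 \<and> ip a x = 0 \<and> ip b x = 0"
proof (rule ccontr)
  assume *: "\<not> ?thesis"
  define f where "f = (\<lambda>x::real^3. (vector [ip a x, ip b x, 0] :: real^3))"
  have "linear f"
    by (rule linearI) (simp_all add: f_def vec_eq_iff forall_3)
  moreover have "inj f"
    using * \<open>linear f\<close> by (subst linear_injective_0) (auto simp: f_def vec_eq_iff forall_3)
  ultimately have "surj f" by (simp add: linear_injective_imp_surjective)
  then have "axis 3 1 \<in> range f" by simp
  then obtain x where "axis 3 1 = f x" by (rule rangeE)
  then have "(f x)$3 = 1" by (metis axis_nth)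
  then show False by (simp add: f_def)
qed

text \<open>Successive maximization of \<open>\<bar>A x\<bar>\<^sup>2\<close> on orthogonal complements produces the right singular vectors.\<close>

lemma is_svd_exists:
  assumes A: "invertible A"
  shows "\<exists>s u v. is_svd ip A s u v"
proof -
  define q where "q = (\<lambda>x y. ip (A *v x) (A *v y))"
  have q: "bilinear q"
    unfolding bilinear_def q_def
    by (auto intro!: linearI simp: matrix_vector_right_distrib matrix_vector_mult_scaleR)
  have q_sym: "q x y = q y x" for x y by (simp add: q_def ip_sym)
  have A0: "A *v x \<noteq> 0" if "x \<noteq> 0" for x
  proof
    obtain B where "B ** A = mat 1" using A by (auto simp: invertible_def)
    then have "x = B *v (A *v x)" by (simp add: matrix_vector_mul_assoc)
    moreover assume "A *v x = 0"
    ultimately show False using that by simp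
  qed
  note max = quadratic_form_maximizer[OF _ _ _ q q_sym]
  obtain v1 where v1: "ip v1 v1 = 1" "\<And>w. ip v1 w = 0 \<Longrightarrow> q v1 w = 0" "\<And>w. q w w \<le> q v1 v1 * ip w w"
    by (rule max[of UNIV "axis 1 1"]) (auto simp: axis_eq_0_iff)
  obtain x where x: "x \<noteq> 0" "ip v1 x = 0" using exists_orthogonal[of v1 v1] by blast
  define V2 where "V2 = {w. ip v1 w = 0}"
  have "subspace V2" by (auto simp: V2_def subspace_def)
  then obtain v2 where v2: "ip v1 v2 = 0" "ip v2 v2 = 1"
    "\<And>w. \<lbrakk>ip v1 w = 0; ip v2 w = 0\<rbrakk> \<Longrightarrow> q v2 w = 0" "\<And>w. ip v1 w = 0 \<Longrightarrow> q w w \<le> q v2 v2 * ip w w"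
    by (rule max[of V2 x]) (use x in \<open>auto simp: V2_def\<close>)
  obtain y where y: "y \<noteq> 0" "ip v1 y = 0" "ip v2 y = 0" using exists_orthogonal[of v1 v2] by blast
  define v3 where "v3 = (1 / sqrt (ip y y)) *\<^sub>R y"
  have v3: "ip v1 v3 = 0" "ip v2 v3 = 0" "ip v3 v3 = 1"
    using y ip_pos[OF y(1)] by (auto simp: v3_def)
  have ne: "v1 \<noteq> 0" "v2 \<noteq> 0" "v3 \<noteq> 0" using v1 v2 v3 by auto
  define v where "v = (\<lambda>i::3. if i = 1 then v1 else if i = 2 then v2 else v3)"
  define s :: "real^3" where "s = (\<chi> i. sqrt (q (v i) (v i)))"
  define u where "u = (\<lambda>i. (1 / s$i) *\<^sub>R (A *v v i))"
  have v_simps: "v 1 = v1" "v 2 = v2" "v 3 = v3" by (simp_all add: v_def)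
  have "\<forall>i j. ip (v i) (v j) = (if i = j then 1 else 0)"
    by (simp add: forall_3 v_simps v1(1) v2(1,2) v3 ip_sym[of v2 v1] ip_sym[of v3 v1] ip_sym[of v3 v2])
  then have v: "ip (v i) (v j) = (if i = j then 1 else 0)" for i j by blast
  have q0: "q v1 v2 = 0" "q v1 v3 = 0" "q v2 v3 = 0"
    using v1(2)[OF v2(1)] v1(2)[OF v3(1)] v2(3)[OF v3(1,2)] by blast+
  have "\<forall>i j. i \<noteq> j \<longrightarrow> q (v i) (v j) = 0"
    by (simp add: forall_3 v_simps q0 q_sym[of v2 v1] q_sym[of v3 v1] q_sym[of v3 v2])
  then have qv: "q (v i) (v j) = 0" if "i \<noteq> j" for i j using that by blast
  have qpos: "0 < q (v i) (v i)" for i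
    unfolding q_def by (rule ip_pos, rule A0) (use ne in \<open>simp add: v_def\<close>)
  then have spos: "0 < s$i" for i by (simp add: s_def)
  have u: "ip (u i) (u j) = (if i = j then 1 else 0)" for i j
  proof -
    have *: "ip (u i) (u j) = q (v i) (v j) / (s$i * s$j)"
      unfolding u_def q_def ip_simps by (simp only: times_divide_eq_left times_divide_eq_right divide_divide_eq_left mult_1_left mult.commute)
    show ?thesis
    proof (cases "i = j")
      case True
      have "s$i * s$i = q (v i) (v i)" using qpos[of i] by (simp only: s_def vec_lambda_beta real_sqrt_mult_self abs_of_pos)
      then show ?thesis using qpos[of i] unfolding * by (simp only: True) simp
    next
      case False
      then show ?thesis unfolding * qv[OF False] by simp
    qed
  qed
  have Av: "A *v v i = s$i *\<^sub>R u i" for i using spos[of i] by (simp add: u_def)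
  have "q v2 v2 \<le> q v1 v1" "q v3 v3 \<le> q v2 v2"
    using v1(3)[of v2] v2(4)[OF v3(1)] v2(2) v3(3) by auto
  then have ord: "s$1 \<ge> s$2" "s$2 \<ge> s$3" by (simp_all only: s_def v_simps vec_lambda_beta real_sqrt_le_iff)
  have "is_svd ip A s u v"
    unfolding is_svd_def orthonormal_frame_def
  proof (intro conjI allI)
    show "s$3 \<ge> 0" using spos[of 3] by simp
    show "s$1 \<ge> s$2" "s$2 \<ge> s$3" by (rule ord)+
    show "ip (u i) (u j) = (if i = j then 1 else 0)" "ip (v i) (v j) = (if i = j then 1 else 0)" for i j
      by (rule u, rule v)
    show "A *v v i = s$i *\<^sub>R u i" for i by (rule Av)
  qed
  then show ?thesis by blast
qed

lemma singular_values_svd: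
  assumes "invertible A"
  obtains u v where "is_svd ip A (singular_values ip A) u v"
proof -
  obtain s u v where *: "is_svd ip A s u v" using is_svd_exists[OF assms] by blast
  have "singular_values ip A = (THE s. \<exists>u v. is_svd ip A s u v)"
    unfolding singular_values_def is_svd_def by (simp only: ex_simps)
  also have "\<dots> = s" using * is_svd_unique by (intro the_equality) blast+
  finally show thesis using * that by blast
qed

lemma ip_norm_bounds:
  obtains c C where "0 < c" "0 < C" "\<And>x. c * norm x \<le> sqrt (ip x x)" "\<And>x. sqrt (ip x x) \<le> C * norm x"
proof -
  let ?S = "sphere 0 1 :: (real^3) set"
  have cont: "continuous_on ?S (\<lambda>x. sqrt (ip x x))"
    using ip_bilinear unfolding bilinear_conv_bounded_bilinear
    by (intro continuous_on_real_sqrt bounded_bilinear.continuous_on[of ip] continuous_on_id)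
  have ne: "?S \<noteq> {}" by simp
  obtain a where a: "a \<in> ?S" "\<And>x. x \<in> ?S \<Longrightarrow> sqrt (ip a a) \<le> sqrt (ip x x)"
    using continuous_attains_inf[OF compact_sphere ne cont] by blast
  obtain b where b: "b \<in> ?S" "\<And>x. x \<in> ?S \<Longrightarrow> sqrt (ip x x) \<le> sqrt (ip b b)"
    using continuous_attains_sup[OF compact_sphere ne cont] by blast
  have "a \<noteq> 0" "b \<noteq> 0" using a b by auto
  have scale: "sqrt (ip x x) = norm x * sqrt (ip ((1 / norm x) *\<^sub>R x) ((1 / norm x) *\<^sub>R x))" if "x \<noteq> 0" for x
    using that by (simp add: real_sqrt_divide real_sqrt_mult)
  have "sqrt (ip a a) * norm x \<le> sqrt (ip x x) \<and> sqrt (ip x x) \<le> sqrt (ip b b) * norm x" for x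
  proof (cases "x = 0")
    case False
    then have "(1 / norm x) *\<^sub>R x \<in> ?S" by simp
    from a(2)[OF this] b(2)[OF this] show ?thesis
      unfolding scale[OF False] by (simp add: mult.commute mult_left_mono)
  qed simp
  then show thesis
    using that[of "sqrt (ip a a)" "sqrt (ip b b)"] ip_pos \<open>a \<noteq> 0\<close> \<open>b \<noteq> 0\<close> by auto
qed

text \<open>The plane spanned by two right singular vectors contains a vector to which
\<open>cone_semigroup_kernel_bound\<close> applies; its image is at least \<open>\<sigma> j\<close> times as long.  The statement is
phrased for any order of the frames, so that it also applies to the inverse of a matrix.\<close>

lemma cone_semigroup_singular_gap:
  assumes "finite G" "invertible Q" "\<And>g. g \<in> G \<Longrightarrow> preserves_cone Q g"
  obtains C q where "0 < C" "0 < q" "q < 1"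
    "\<And>As u v \<sigma> i j. \<lbrakk>set As \<subseteq> G; orthonormal_frame ip u; orthonormal_frame ip v;
        \<And>k. mat_prod As *v v k = \<sigma> k *\<^sub>R u k; \<And>k. 0 \<le> \<sigma> k \<and> \<sigma> k \<le> \<sigma> i; i \<noteq> j\<rbrakk> \<Longrightarrow>
      \<sigma> j \<le> C * q ^ length As * \<sigma> i"
proof -
  obtain C q e where C: "0 < C" "0 < q" "q < 1"
    and bound: "\<And>As x. \<lbrakk>set As \<subseteq> G; (\<Sum>i\<in>UNIV. (Q *v (mat_prod As *v x))$i) = 0\<rbrakk> \<Longrightarrow>
      norm (mat_prod As *v x) \<le> C * q ^ length As * norm x * norm (mat_prod As *v e)"
    by (rule cone_semigroup_kernel_bound[OF assms(1,2)]) (use assms(3) in blast)+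
  define N where "N = (\<lambda>x. sqrt (ip x x))"
  obtain c D where c: "0 < c" "0 < D" and cN: "\<And>x. c * norm x \<le> N x" "\<And>x. N x \<le> D * norm x"
    unfolding N_def by (rule ip_norm_bounds) auto
  show thesis
  proof (rule that[of "D * C / c / c * N e + 1" q])
    fix As u v \<sigma> i j
    assume As: "set As \<subseteq> G" and u: "orthonormal_frame ip u" and v: "orthonormal_frame ip v"
      and Av: "\<And>k. mat_prod As *v v k = \<sigma> k *\<^sub>R u k" and \<sigma>: "\<And>k. 0 \<le> \<sigma> k \<and> \<sigma> k \<le> \<sigma> i" and ij: "i \<noteq> j"
    define A where "A = mat_prod As"
    define l where "l = (\<lambda>x. \<Sum>i\<in>UNIV. (Q *v (A *v x))$i)"
    have l: "l (a *\<^sub>R x + b *\<^sub>R y) = a * l x + b * l y" for a b x y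
      by (simp add: l_def matrix_vector_right_distrib matrix_vector_mult_scaleR sum.distrib sum_distrib_left)
    obtain a b where ab: "a\<^sup>2 + b\<^sup>2 > 0" "a * l (v i) + b * l (v j) = 0"
    proof (cases "l (v i) = 0")
      case True then show ?thesis using that[of 1 0] by simp
    next
      case False then show ?thesis using that[of "- l (v j)" "l (v i)"] by (simp add: sum_power2_gt_zero_iff)
    qed
    define x where "x = a *\<^sub>R v i + b *\<^sub>R v j"
    have vv: "ip (v i) (v j) = (if i = j then 1 else 0)" for i j
      using v by (simp add: orthonormal_frame_def)
    have xk: "ip x (v k) = (if k = i then a else if k = j then b else 0)" for k
      using ij by (auto simp: x_def vv)
    have "ip x x = a\<^sup>2 + b\<^sup>2"
      using ij by (simp add: x_def vv power2_eq_square)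
    then have Nx: "0 < N x" "(N x)\<^sup>2 = a\<^sup>2 + b\<^sup>2" using ab by (auto simp: N_def)
    have N2: "(N y)\<^sup>2 = ip y y" for y by (simp add: N_def ip_nonneg)
    have form: "(N (A *v y))\<^sup>2 = (\<Sum>k\<in>UNIV. (\<sigma> k)\<^sup>2 * (ip y (v k))\<^sup>2)" for y
      unfolding N2 A_def by (rule frame_image_norm[OF u v Av])
    have "(\<sigma> j * N x)\<^sup>2 \<le> (N (A *v x))\<^sup>2"
    proof -
      have "(\<sigma> j * N x)\<^sup>2 = (\<sigma> j)\<^sup>2 * a\<^sup>2 + (\<sigma> j)\<^sup>2 * b\<^sup>2"
        using Nx by (simp add: power_mult_distrib algebra_simps)
      also have "\<dots> \<le> (\<sigma> i)\<^sup>2 * a\<^sup>2 + (\<sigma> j)\<^sup>2 * b\<^sup>2"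
        using \<sigma> by (intro add_right_mono mult_right_mono power_mono) auto
      also have "\<dots> = (\<Sum>k\<in>{i, j}. (\<sigma> k)\<^sup>2 * (ip x (v k))\<^sup>2)"
        using ij by (simp add: xk)
      also have "\<dots> \<le> (N (A *v x))\<^sup>2"
        unfolding form by (intro sum_mono2) auto
      finally show ?thesis .
    qed
    then have "\<sigma> j * N x \<le> N (A *v x)"
      by (rule power2_le_imp_le) (simp add: N_def ip_nonneg)
    also have "\<dots> \<le> D * norm (A *v x)" by (rule cN)
    also have "norm (A *v x) \<le> C * q ^ length As * norm x * norm (A *v e)"
    proof -
      have "l x = 0" using ab(2) by (simp add: x_def l)
      then show ?thesis unfolding A_def by (intro bound[OF As]) (simp add: l_def A_def)
    qed
    also have "\<dots> \<le> C * q ^ length As * (N x / c) * (\<sigma> i * N e / c)"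
    proof (intro mult_mono mult_left_mono)
      show "norm x \<le> N x / c" using cN(1)[of x] c by (simp add: field_simps)
      have "(N (A *v e))\<^sup>2 \<le> (\<Sum>k\<in>UNIV. (\<sigma> i)\<^sup>2 * (ip e (v k))\<^sup>2)"
        unfolding form using \<sigma> by (intro sum_mono mult_right_mono power_mono) auto
      also have "\<dots> = (\<sigma> i * N e)\<^sup>2"
        by (simp only: power_mult_distrib N2 frame_norm[OF v, of e] sum_distrib_left)
      finally have "N (A *v e) \<le> \<sigma> i * N e"
        by (rule power2_le_imp_le) (use \<sigma>[of i] in \<open>simp add: N_def ip_nonneg\<close>)
      then show "norm (A *v e) \<le> \<sigma> i * N e / c"
        using cN(1)[of "A *v e"] c by (simp add: field_simps)
    qed (use C Nx c in auto)
    finally have "\<sigma> j * N x \<le> (D * C / c / c * N e * q ^ length As * \<sigma> i) * N x"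
      using c by (simp add: mult_ac)
    then have "\<sigma> j \<le> D * C / c / c * N e * q ^ length As * \<sigma> i"
      using Nx(1) by (rule mult_right_le_imp_le)
    also have "\<dots> \<le> (D * C / c / c * N e + 1) * q ^ length As * \<sigma> i"
      using C \<sigma>[of i] by (intro mult_right_mono) auto
    finally show "\<sigma> j \<le> (D * C / c / c * N e + 1) * q ^ length As * \<sigma> i" .
  qed (use C c ip_nonneg in \<open>auto simp: N_def intro!: add_nonneg_pos mult_nonneg_nonneg divide_nonneg_nonneg\<close>)
qed

end

section \<open>A triangle contracted by the four semigroups\<close>

abbreviation mat3 :: "real \<Rightarrow> real \<Rightarrow> real \<Rightarrow> real \<Rightarrow> real \<Rightarrow> real \<Rightarrow> real \<Rightarrow> real \<Rightarrow> real \<Rightarrow> real^3^3" where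
  "mat3 a b c d e f g h i \<equiv> vector [vector [a, b, c], vector [d, e, f], vector [g, h, i]]"

lemmas mat3_simps = vec_eq_iff forall_3 sum_3 matrix_matrix_mult_def mat_def

definition mat_a_power :: "bool \<Rightarrow> real^3^3" where
  "mat_a_power s = (if s then mat3 2 0 0 0 1 0 0 0 (1/2) else mat_a)"

text \<open>The inverse is explicit so that it can be compared, in \<open>mat_b_inverse_preserves_cone\<close>, with the
spectral decomposition of \<open>mat_b t\<close>.\<close>

definition mat_b_power :: "real \<Rightarrow> bool \<Rightarrow> real^3^3" where
  "mat_b_power t s = (if s then (1/32) *\<^sub>R
     mat3 (4 + 1/t) (4 - 2/t) (1/t) (2 - 1/t) (4 + 2/t) (2 - 1/t) (1/t) (4 - 2/t) (4 + 1/t)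
   else mat_b t)"

lemma mat_a_power_inverse: "mat_a_power s ** mat_a_power (\<not> s) = mat 1"
  by (cases s) (simp_all add: mat_a_power_def mat_a_def mat3_simps)

lemma mat_b_power_inverse: "t \<noteq> 0 \<Longrightarrow> mat_b_power t s ** mat_b_power t (\<not> s) = mat 1"
  by (cases s) (simp_all add: mat_b_power_def mat_b_def mat3_simps field_simps)

text \<open>The linear forms that cut out the triangle with vertices \<open>(-14, -1, 16)\<close>, \<open>(9, 4, 8)\<close>, \<open>(7, -8, 4)\<close>.
With \<open>u\<^sub>1 = (1, -1, 1)\<close>, \<open>u\<^sub>2 = (1, 0, -1)\<close>, \<open>u\<^sub>3 = (1, 1, 1)\<close>, the eigenvectors of \<open>mat_b t\<close> for the
eigenvalues \<open>8 t\<close>, \<open>8\<close>, \<open>4\<close>, and the corresponding spectral projections \<open>\<pi>\<^sub>1\<close>, \<open>\<pi>\<^sub>2\<close>, \<open>\<pi>\<^sub>3\<close>, one has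
\<open>mat_b t = 8 (t - 1) \<pi>\<^sub>1 + 4 (1 - \<pi>\<^sub>3) + 4\<close>.  The triangle is chosen so that \<open>\<pi>\<^sub>1\<close> maps it into its
interior, \<open>1 - \<pi>\<^sub>3\<close>, the projection from the point \<open>u\<^sub>3\<close> to the line through \<open>u\<^sub>1\<close> and \<open>u\<^sub>2\<close>, maps it
into itself, and \<open>mat_a\<close> maps it into its interior.\<close>

definition cone_coords :: "real^3^3" where
  "cone_coords = mat3 (-4) (-1) 5 124 168 119 72 (-256) 47"

text \<open>The symmetries that move between the four sign patterns: reversing the order of the coordinates
inverts \<open>mat_a\<close> and fixes \<open>mat_b t\<close>, while the sign change of the second coordinate fixes \<open>mat_a\<close> and
exchanges \<open>u\<^sub>1\<close> with \<open>u\<^sub>3\<close>.\<close>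

definition sign_twist :: "bool \<Rightarrow> bool \<Rightarrow> real^3^3" where
  "sign_twist s r = (let y = (if r then -1 else 1) in
     if s then mat3 0 0 1 0 y 0 1 0 0 else mat3 1 0 0 0 y 0 0 0 1)"

lemma sign_twist_involution: "sign_twist s r ** sign_twist s r = mat 1"
  by (cases s; cases r) (simp_all add: sign_twist_def mat3_simps)

lemma sign_twist_a: "sign_twist s r ** mat_a_power s ** sign_twist s r = mat_a"
  by (cases s; cases r) (simp_all add: sign_twist_def mat_a_power_def mat_a_def mat3_simps)

lemma sign_twist_b:
  "sign_twist s r ** mat_b_power t r ** sign_twist s r = sign_twist False r ** mat_b_power t r ** sign_twist False r"
  by (cases s; cases r) (simp_all add: sign_twist_def mat_b_power_def mat_b_def mat3_simps)

lemma preserves_cone_conjugate: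
  assumes "T ** T = mat 1" "preserves_cone Q (T ** g ** T)"
  shows "preserves_cone (Q ** T) g"
proof -
  obtain P where P: "\<forall>i j. 0 < P$i$j" "Q ** (T ** g ** T) = P ** Q"
    using assms by (auto simp: preserves_cone_def)
  have "Q ** T ** g = Q ** T ** g ** (T ** T)" by (simp only: assms(1) matrix_mul_rid)
  also have "\<dots> = Q ** (T ** g ** T) ** T" by (simp only: matrix_mul_assoc)
  also have "\<dots> = P ** (Q ** T)" by (simp only: P(2)) (simp only: matrix_mul_assoc)
  finally show ?thesis using P by (auto simp: preserves_cone_def)
qed

lemma mat_a_preserves_cone: "preserves_cone cone_coords mat_a"
  unfolding preserves_cone_def
  by (rule exI[of _ "mat3 (189/137) (29/1370) (17/1370) (2772/137) (1567/1370) (21/1370)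
        (1256/137) (13/685) (669/685)"])
    (simp add: cone_coords_def mat_a_def mat3_simps)

lemma mat_b_preserves_cone:
  assumes "1 < t"
  shows "preserves_cone cone_coords (mat_b t)"
  unfolding preserves_cone_def
  by (rule exI[of _ "(2 * (t - 1)) *\<^sub>R mat3 (8/137) (9/1370) (27/1370) (300/137) (135/548) (405/548)
        (1500/137) (675/548) (2025/548) + mat3 4 0 0 0 (1/4) (3/4) 0 (5/4) (15/4) + mat3 4 0 0 0 4 0 0 0 4"])
    (use assms in \<open>simp add: cone_coords_def mat_b_def mat3_simps add_pos_pos field_simps\<close>)

text \<open>Exchanging \<open>u\<^sub>1\<close> and \<open>u\<^sub>3\<close> turns \<open>32\<close> times the inverse into
\<open>4 \<pi>\<^sub>1 + 4 (1 - 1/t) (1 - \<pi>\<^sub>3) + 4/t\<close>.\<close>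

lemma mat_b_inverse_preserves_cone:
  assumes "1 < t"
  shows "preserves_cone cone_coords (sign_twist False True ** mat_b_power t True ** sign_twist False True)"
  unfolding preserves_cone_def
  by (rule exI[of _ "(1/32) *\<^sub>R (mat3 (8/137) (9/1370) (27/1370) (300/137) (135/548) (405/548)
        (1500/137) (675/548) (2025/548) + (1 - 1/t) *\<^sub>R mat3 4 0 0 0 (1/4) (3/4) 0 (5/4) (15/4)
        + (1/t) *\<^sub>R mat3 4 0 0 0 4 0 0 0 4)"])
    (use assms in \<open>simp add: cone_coords_def sign_twist_def mat_b_power_def mat3_simps add_pos_pos field_simps\<close>)

lemma mat_powers_preserve_cone:
  assumes "1 < t" and "g \<in> {mat_a_power s, mat_b_power t r}"
  shows "preserves_cone (cone_coords ** sign_twist s r) g"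
proof (rule preserves_cone_conjugate[OF sign_twist_involution])
  have "sign_twist False False = mat 1" by (simp add: sign_twist_def mat3_simps)
  then have "preserves_cone cone_coords (sign_twist False r ** mat_b_power t r ** sign_twist False r)"
    using mat_b_inverse_preserves_cone[OF assms(1)] mat_b_preserves_cone[OF assms(1)]
    by (cases r) (auto simp: mat_b_power_def)
  then show "preserves_cone cone_coords (sign_twist s r ** g ** sign_twist s r)"
    using assms(2) mat_a_preserves_cone by (auto simp: sign_twist_a sign_twist_b[of s r t])
qed

lemma invertible_cone_coords: "invertible (cone_coords ** sign_twist s r)"
proof (rule invertible_mult)
  show "invertible cone_coords"
    unfolding invertible_det_nz by (simp add: cone_coords_def det_3)
  show "invertible (sign_twist s r)"
    unfolding invertible_def using sign_twist_involution by blast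
qed

lemma mat_prod_append: "mat_prod (As @ Bs) = mat_prod As ** mat_prod Bs"
  by (induction As) (simp_all add: matrix_mul_assoc)

lemma mat_prod_powers_inverse:
  assumes "t \<noteq> 0" "set As \<subseteq> {mat_a_power s, mat_b_power t r}"
  obtains Bs where "set Bs \<subseteq> {mat_a_power (\<not> s), mat_b_power t (\<not> r)}" "length Bs = length As"
    "mat_prod Bs ** mat_prod As = mat 1"
proof -
  have "\<exists>Bs. set Bs \<subseteq> {mat_a_power (\<not> s), mat_b_power t (\<not> r)} \<and> length Bs = length As \<and>
      mat_prod Bs ** mat_prod As = mat 1"
    using assms(2)
  proof (induction As)
    case (Cons A As)
    then obtain Bs where Bs: "set Bs \<subseteq> {mat_a_power (\<not> s), mat_b_power t (\<not> r)}"
      "length Bs = length As" "mat_prod Bs ** mat_prod As = mat 1" by auto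
    obtain B where B: "B \<in> {mat_a_power (\<not> s), mat_b_power t (\<not> r)}" "B ** A = mat 1"
      using Cons.prems mat_a_power_inverse[of "\<not> s"] mat_b_power_inverse[OF assms(1), of "\<not> r"] by auto
    have "mat_prod (Bs @ [B]) ** mat_prod (A # As) = mat_prod Bs ** (B ** A) ** mat_prod As"
      by (simp add: mat_prod_append matrix_mul_assoc)
    then show ?case using B Bs by (intro exI[of _ "Bs @ [B]"]) auto
  qed simp
  then show thesis using that by blast
qed

lemma proj_eq: "proj A = {c *\<^sub>R A | c. c \<noteq> 0}"
  unfolding proj_def r_coset_def scalars3_def GL3_def by auto

lemma normalized_rep_proj:
  assumes "invertible A"
  obtains c where "c \<noteq> 0" "normalized_rep (proj A) = c *\<^sub>R A"
proof -
  note proj = proj_eq[of A]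
  have "det A \<noteq> 0" using assms by (simp add: invertible_det_nz)
  \<comment> \<open>the factor that normalizes the determinant, which is homogeneous of degree three\<close>
  define c where "c = 1 / root 3 \<bar>det A\<bar>"
  have c: "c \<noteq> 0" "c ^ 3 = 1 / \<bar>det A\<bar>"
    using \<open>det A \<noteq> 0\<close> by (simp_all add: c_def power_divide odd_real_root_pow)
  have "det (c *\<^sub>R A) = c ^ 3 * det A" by (simp add: det_3 power3_eq_cube algebra_simps)
  then have "\<bar>det (c *\<^sub>R A)\<bar> = 1" using c \<open>det A \<noteq> 0\<close> by (simp add: abs_mult)
  then have "\<exists>N. N \<in> proj A \<and> \<bar>det N\<bar> = 1" using c proj by blast
  from someI_ex[OF this] have "normalized_rep (proj A) \<in> proj A" by (simp add: normalized_rep_def)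
  then show thesis using that proj by blast
qed

text \<open>The first root is estimated by the product itself and the second one by its inverse, which is a
product of the same length over the letters with opposite signs.\<close>

lemma (in inner_product_R3) cartan_proj_gap:
  assumes t: "1 < t"
  shows "\<exists>\<kappa>>0. \<exists>\<kappa>'>0. \<forall>s r As. set As \<subseteq> {mat_a_power s, mat_b_power t r} \<longrightarrow>
    (\<forall>k\<in>{1, 2}. simple_root k (cartan_proj ip (proj (mat_prod As))) \<ge> \<kappa> * real (length As) - \<kappa>')"
proof -
  define G where "G = (\<lambda>s r. {mat_a_power s, mat_b_power t r})"
  define gap where "gap = (\<lambda>C q s r. \<forall>As u v \<sigma> i j. set As \<subseteq> G s r \<longrightarrow> orthonormal_frame ip u \<longrightarrow>
    orthonormal_frame ip v \<longrightarrow> (\<forall>k. mat_prod As *v v k = \<sigma> k *\<^sub>R u k) \<longrightarrow>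
    (\<forall>k. 0 \<le> \<sigma> k \<and> \<sigma> k \<le> \<sigma> i) \<longrightarrow> i \<noteq> j \<longrightarrow> \<sigma> j \<le> C * q ^ length As * \<sigma> i)"
  have "\<exists>C q. 0 < C \<and> 0 < q \<and> q < 1 \<and> gap C q s r" for s r
  proof -
    have G: "finite (G s r)" "\<And>g. g \<in> G s r \<Longrightarrow> preserves_cone (cone_coords ** sign_twist s r) g"
      using mat_powers_preserve_cone[OF t] by (auto simp: G_def)
    show ?thesis
    proof (rule cone_semigroup_singular_gap[OF G(1) invertible_cone_coords G(2)])
      fix C q assume "0 < C" "0 < q" "q < 1"
        and "\<And>As u v \<sigma> i j. \<lbrakk>set As \<subseteq> G s r; orthonormal_frame ip u; orthonormal_frame ip v;
          \<And>k. mat_prod As *v v k = \<sigma> k *\<^sub>R u k; \<And>k. 0 \<le> \<sigma> k \<and> \<sigma> k \<le> \<sigma> i; i \<noteq> j\<rbrakk> \<Longrightarrow>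
          \<sigma> j \<le> C * q ^ length As * \<sigma> i"
      then have "gap C q s r" unfolding gap_def by simp
      with \<open>0 < C\<close> \<open>0 < q\<close> \<open>q < 1\<close> show ?thesis by blast
    qed
  qed
  then obtain C q where Cq: "\<And>s r. 0 < C s r \<and> 0 < q s r \<and> q s r < 1 \<and> gap (C s r) (q s r) s r"
    by metis
  define C' where "C' = Max (insert 1 ((\<lambda>(s, r). C s r) ` UNIV))"
  define q' where "q' = Max ((\<lambda>(s, r). q s r) ` UNIV)"
  have mem: "C s r \<in> (\<lambda>(s, r). C s r) ` UNIV" "q s r \<in> (\<lambda>(s, r). q s r) ` UNIV" for s r
    by (rule image_eqI[of _ _ "(s, r)"]; simp)+
  have C': "C s r \<le> C'" for s r unfolding C'_def by (rule Max_ge) (simp, use mem in blast)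
  have "1 \<le> C'" unfolding C'_def by (rule Max_ge) auto
  note C' = C' this
  have q': "q s r \<le> q'" for s r unfolding q'_def by (rule Max_ge[OF _ mem(2)]) simp
  have "q' < 1" unfolding q'_def using Cq by (subst Max_less_iff) auto
  note q' = q' this
  have "0 < q'" using q'(1)[of True True] Cq[of True True] by linarith
  have gap': "\<sigma> j \<le> C' * q' ^ length As * \<sigma> i"
    if "set As \<subseteq> G s r" "orthonormal_frame ip u" "orthonormal_frame ip v"
      "\<And>k. mat_prod As *v v k = \<sigma> k *\<^sub>R u k" "\<And>k. 0 \<le> \<sigma> k \<and> \<sigma> k \<le> \<sigma> i" "i \<noteq> j"
    for As u v \<sigma> i j s r
  proof -
    have "\<sigma> j \<le> C s r * q s r ^ length As * \<sigma> i"
      using Cq[of s r] that unfolding gap_def by blast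
    also have "\<dots> \<le> C' * q' ^ length As * \<sigma> i"
      using C'(1)[of s r] C'(2) q'(1)[of s r] Cq[of s r] that(5)[of i]
      by (intro mult_right_mono mult_mono power_mono) auto
    finally show ?thesis .
  qed
  have "simple_root k (cartan_proj ip (proj (mat_prod As))) \<ge> - ln q' * real (length As) - (ln C' + 1)"
    if As: "set As \<subseteq> G s r" and k: "k \<in> {1, 2}" for s r As k
  proof -
    define n where "n = length As"
    define A where "A = mat_prod As"
    obtain Bs where Bs: "set Bs \<subseteq> G (\<not> s) (\<not> r)" "length Bs = n" "mat_prod Bs ** A = mat 1"
      using mat_prod_powers_inverse[of t As s r] t As unfolding n_def A_def G_def by auto
    have A: "invertible A" using Bs(3) matrix_left_right_inverse[of "mat_prod Bs" A] unfolding invertible_def by blast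
    obtain c where c: "c \<noteq> 0" "normalized_rep (proj A) = c *\<^sub>R A"
      using normalized_rep_proj[OF A] by blast
    have cA: "invertible (c *\<^sub>R A)"
      using c A invertible_mult[OF invertible_scaleR_mat[OF c(1)] A] by simp
    define S where "S = singular_values ip (c *\<^sub>R A)"
    obtain u v where svd: "is_svd ip (c *\<^sub>R A) S u v"
      unfolding S_def by (rule singular_values_svd[OF cA])
    note ord = is_svd_order[OF svd]
    have u: "orthonormal_frame ip u" and v: "orthonormal_frame ip v" using svd by (auto simp: is_svd_def)
    have Av: "A *v v i = (S$i / c) *\<^sub>R u i" for i
    proof -
      have "c *\<^sub>R (A *v v i) = S$i *\<^sub>R u i" using svd by (simp add: is_svd_def scaleR_matrix_vector_assoc)
      then have "(1 / c) *\<^sub>R c *\<^sub>R (A *v v i) = (1 / c) *\<^sub>R S$i *\<^sub>R u i" by simp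
      then show ?thesis using c by simp
    qed
    have Bu: "(S$i / c) *\<^sub>R (mat_prod Bs *v u i) = v i" for i
    proof -
      have "mat_prod Bs *v (A *v v i) = v i" by (simp add: matrix_vector_mul_assoc Bs)
      then show ?thesis by (simp add: Av matrix_vector_mult_scaleR)
    qed
    have Spos: "0 < S$i" for i
    proof (rule ccontr)
      assume "\<not> 0 < S$i"
      then have "S$i = 0" using ord(4)[of i] by simp
      then have "v i = 0" using Bu[of i] by simp
      moreover have "ip (v i) (v i) = 1" using v by (simp add: orthonormal_frame_def)
      ultimately show False by simp
    qed
    \<comment> \<open>singular values do not see the sign of the scalar \<open>c\<close>; it is moved into the frame\<close>
    define e where "e = (if c > 0 then 1 else - 1 :: real)"
    have e: "e * e = 1" "e / \<bar>c\<bar> = 1 / c" "\<bar>c\<bar> / c = e" using c by (auto simp: e_def)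
    have eu: "orthonormal_frame ip (\<lambda>i. e *\<^sub>R u i)"
      using u e(1) by (simp add: orthonormal_frame_def flip: mult.assoc)
    have "S$2 / \<bar>c\<bar> \<le> C' * q' ^ n * (S$1 / \<bar>c\<bar>)"
    proof (unfold n_def, rule gap'[where \<sigma> = "\<lambda>k. S$k / \<bar>c\<bar>" and i = 1 and j = 2, OF As eu v])
      show "mat_prod As *v v k = (S$k / \<bar>c\<bar>) *\<^sub>R e *\<^sub>R u k" for k
      proof -
        have "S$k / \<bar>c\<bar> * e = S$k * (e / \<bar>c\<bar>)" by simp
        then show ?thesis using Av[of k] by (simp add: e(2) A_def)
      qed
    qed (use ord c in \<open>auto simp: divide_right_mono\<close>)
    then have 12: "S$2 \<le> C' * q' ^ n * S$1" using c by (simp add: divide_le_cancel)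
    have "\<bar>c\<bar> / S$2 \<le> C' * q' ^ length Bs * (\<bar>c\<bar> / S$3)"
    proof (rule gap'[where \<sigma> = "\<lambda>k. \<bar>c\<bar> / S$k" and i = 3 and j = 2, OF Bs(1) v eu])
      show "mat_prod Bs *v (e *\<^sub>R u k) = (\<bar>c\<bar> / S$k) *\<^sub>R v k" for k
      proof -
        have "(\<bar>c\<bar> / S$k) *\<^sub>R v k = (\<bar>c\<bar> / S$k) *\<^sub>R (S$k / c) *\<^sub>R (mat_prod Bs *v u k)"
          by (subst (1) Bu[symmetric]) (rule refl)
        also have "\<dots> = e *\<^sub>R (mat_prod Bs *v u k)"
        proof -
          have "\<bar>c\<bar> / S$k * (S$k / c) = \<bar>c\<bar> / c" using Spos[of k] by simp
          then show ?thesis by (simp only: scaleR_scaleR e(3))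
        qed
        finally show ?thesis by (simp only: matrix_vector_mult_scaleR)
      qed
      show "0 \<le> \<bar>c\<bar> / S$k \<and> \<bar>c\<bar> / S$k \<le> \<bar>c\<bar> / S$3" for k
        using Spos[of k] divide_left_mono[OF ord(2)[of k] abs_ge_zero[of c] mult_pos_pos[OF Spos[of k] Spos[of 3]]]
        by simp
    qed simp
    then have 23: "S$3 \<le> C' * q' ^ n * S$2"
      using c Spos[of 2] Spos[of 3] Bs(2) by (simp add: field_simps)
    have log: "ln x - ln y \<ge> - ln q' * real n - (ln C' + 1)" if "y \<le> C' * q' ^ n * x" "0 < x" "0 < y" for x y
    proof -
      have "ln y \<le> ln (C' * q' ^ n * x)" using that by simp
      also have "\<dots> = ln C' + real n * ln q' + ln x"
        using C'(2) \<open>0 < q'\<close> that by (simp add: ln_mult ln_realpow)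
      finally show ?thesis by (simp add: algebra_simps)
    qed
    have cp: "cartan_proj ip (proj (mat_prod As)) = (\<chi> i. ln (S$i))"
      by (simp add: cartan_proj_def S_def c flip: A_def)
    show ?thesis
      using k log[OF 12 Spos Spos] log[OF 23 Spos Spos]
      by (auto simp: cp simple_root_def n_def)
  qed
  moreover have "0 < - ln q'" "0 < ln C' + 1" using q' \<open>0 < q'\<close> C' by (auto simp: ln_less_zero add_nonneg_pos)
  ultimately show ?thesis unfolding G_def by blast
qed

section \<open>The commutator as a rotation\<close>

lemma scaleR_matrix_mult: "(k *\<^sub>R A) ** B = k *\<^sub>R (A ** (B :: real^3^3))"
  "A ** (k *\<^sub>R B) = k *\<^sub>R (A ** (B :: real^3^3))"
  by (simp_all add: matrix_matrix_mult_def vec_eq_iff sum_distrib_left mult_ac)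

lemma matrix_mult_distrib:
  fixes A B M :: "real^3^3"
  shows "(A + B) ** M = A ** M + B ** M" "M ** (A + B) = M ** A + M ** B"
    "(A - B) ** M = A ** M - B ** M" "M ** (A - B) = M ** A - M ** B"
  by (simp_all add: matrix_matrix_mult_def vec_eq_iff sum.distrib sum_subtractf algebra_simps)

lemmas matrix_algebra = scaleR_matrix_mult matrix_mult_distrib

definition commutator_matrix :: "real \<Rightarrow> real^3^3" where
  "commutator_matrix t = mat_a_power False ** mat_b_power t False ** mat_a_power True ** mat_b_power t True"

definition commutator_numerator :: "real \<Rightarrow> real^3^3" where
  "commutator_numerator t = mat3 (16 * t^2 + 106 * t + 13) (8 * t^2 + 48 * t - 26) (- 8 * t^2 + 14 * t + 13)
      (- 32 * t^2 + 12 * t + 2) (- 16 * t^2 + 144 * t - 4) (16 * t^2 - 12 * t + 2)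
      (64 * t^2 - 88 * t - 44) (32 * t^2 - 192 * t + 88) (- 32 * t^2 + 184 * t - 44)"

lemma commutator_matrix_entries:
  assumes "t \<noteq> 0"
  shows "commutator_matrix t = (1 / (128 * t)) *\<^sub>R commutator_numerator t"
  using assms
  by (simp add: commutator_matrix_def commutator_numerator_def mat_a_power_def mat_b_power_def mat_a_def mat_b_def mat3_simps
      field_simps power2_eq_square)

text \<open>Reversing the order of the coordinates conjugates the first matrix to its inverse and fixes the
second one, so it takes the commutator to a conjugate of its inverse.  As the determinant is \<open>1\<close>, the
commutator has the eigenvalue \<open>1\<close>, and its characteristic polynomial is determined by the trace
\<open>1 + 2 comm_cos t\<close>; the identity is the Cayley--Hamilton theorem.\<close>

lemma commutator_matrix_cubic:
  assumes t: "t \<noteq> 0"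
  defines "C \<equiv> commutator_matrix t"
  defines "E \<equiv> C ** C - (2 * comm_cos t) *\<^sub>R C + mat 1"
  shows "C ** E = E"
proof -
  define M where "M = commutator_numerator t"
  define d where "d = - 35 + 306 * t - 32 * t\<^sup>2"
  have C: "C = (1 / (128 * t)) *\<^sub>R M" unfolding C_def M_def by (rule commutator_matrix_entries[OF t])
  have c: "2 * comm_cos t = d / (128 * t)" using t by (simp add: comm_cos_def d_def field_simps)
  define N where "N = M ** M - d *\<^sub>R M + (128 * t)\<^sup>2 *\<^sub>R mat 1"
  have E: "E = (1 / (128 * t)\<^sup>2) *\<^sub>R N"
    unfolding E_def C c N_def using t
    by (simp add: matrix_algebra scaleR_add_right scaleR_diff_right power2_eq_square)
  have "M ** N = (128 * t) *\<^sub>R N"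
    unfolding N_def M_def commutator_numerator_def d_def by (simp add: mat3_simps) (simp add: power2_eq_square algebra_simps)
  then show ?thesis unfolding E C using t by (simp add: matrix_algebra)
qed

lemma commutator_matrix_nontrivial:
  assumes "t \<noteq> 0"
  shows "commutator_matrix t \<noteq> mat 1"
proof
  assume *: "commutator_matrix t = mat 1"
  have "commutator_matrix t $ 2 $ 1 = 0" "commutator_matrix t $ 1 $ 3 = 0"
    unfolding * by (simp_all add: mat_def)
  then have 1: "- 32 * t^2 + 12 * t + 2 = 0" and 2: "- 8 * t^2 + 14 * t + 13 = 0"
    unfolding commutator_matrix_entries[OF assms] commutator_numerator_def using assms by simp_all
  then have "t = - 25 / 22" by simp
  then show False using 1 by (simp add: power2_eq_square)
qed

text \<open>The first assumption says \<open>(C - 1) (C\<^sup>2 - 2 cos \<theta> C + 1) = 0\<close>; it holds for the conjugates of the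
rotation by \<open>\<theta>\<close> about a line.\<close>

locale rotation_matrix =
  fixes C :: "real^3^3" and \<theta> :: real
  assumes fixes_E: "C ** (C ** C - (2 * cos \<theta>) *\<^sub>R C + mat 1) = C ** C - (2 * cos \<theta>) *\<^sub>R C + mat 1"
    and sin_pos: "0 < sin \<theta>" and nontrivial: "C \<noteq> mat 1"
begin

text \<open>The spectral projection for the eigenvalue \<open>1\<close>.\<close>

definition P :: "real^3^3" where
  "P = (1 / (2 - 2 * cos \<theta>)) *\<^sub>R (C ** C - (2 * cos \<theta>) *\<^sub>R C + mat 1)"

definition R :: "real^3^3" where "R = mat 1 - P"

lemma cos_bounds: "cos \<theta> < 1" "(cos \<theta>)\<^sup>2 < 1"
proof -
  show "(cos \<theta>)\<^sup>2 < 1" using sin_pos sin_cos_squared_add[of \<theta>] by (smt (verit) zero_less_power)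
  then have "cos \<theta> \<noteq> 1" by auto
  then show "cos \<theta> < 1" using cos_le_one[of \<theta>] by linarith
qed

lemma CP: "C ** P = P"
  unfolding P_def by (simp only: scaleR_matrix_mult fixes_E)

lemma PP: "P ** P = P"
proof -
  have "C ** C ** P = P" by (simp only: CP flip: matrix_mul_assoc)
  have "P ** P = (1 / (2 - 2 * cos \<theta>)) *\<^sub>R (C ** C ** P - (2 * cos \<theta>) *\<^sub>R (C ** P) + P)"
    by (subst P_def) (simp only: matrix_algebra matrix_mul_lid)
  also have "\<dots> = (1 / (2 - 2 * cos \<theta>)) *\<^sub>R ((2 - 2 * cos \<theta>) *\<^sub>R P)"
    unfolding CP \<open>C ** C ** P = P\<close> by (rule arg_cong[where f = "\<lambda>A. (1 / (2 - 2 * cos \<theta>)) *\<^sub>R A"])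
      (simp add: vec_eq_iff algebra_simps)
  also have "\<dots> = P" using cos_bounds by simp
  finally show ?thesis .
qed

lemma PR: "P ** R = 0" and RR: "R ** R = R"
  by (simp_all add: R_def matrix_algebra PP)

lemma CCR: "C ** (C ** R) = (2 * cos \<theta>) *\<^sub>R (C ** R) - R"
proof -
  have "(2 - 2 * cos \<theta>) *\<^sub>R P = C ** C - (2 * cos \<theta>) *\<^sub>R C + mat 1"
    using cos_bounds by (simp add: P_def)
  from this[symmetric]
  have "(C ** C - (2 * cos \<theta>) *\<^sub>R C + mat 1) ** R = (2 - 2 * cos \<theta>) *\<^sub>R (P ** R)"
    by (simp only: scaleR_matrix_mult)
  then have "C ** C ** R - (2 * cos \<theta>) *\<^sub>R (C ** R) + R = 0"
    by (simp only: PR matrix_algebra matrix_mul_lid scaleR_zero_right)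
  then show ?thesis by (simp add: matrix_mul_assoc algebra_simps eq_neg_iff_add_eq_0)
qed

lemma R_nonzero: "R \<noteq> 0"
proof
  assume "R = 0"
  then have "P = mat 1" by (simp add: R_def)
  then show False using CP nontrivial by simp
qed

text \<open>For \<open>z\<close> on the unit circle, the rotation by its argument: as \<open>C\<close> acts as the rotation by \<open>\<theta>\<close> on the
range of \<open>R\<close>, any other rotation is a linear combination of \<open>C\<close> and the identity there.\<close>

definition rotate :: "complex \<Rightarrow> real^3^3" where
  "rotate z = P + (1 / sin \<theta>) *\<^sub>R (Im z *\<^sub>R (C ** R) - (Im z * cos \<theta> - Re z * sin \<theta>) *\<^sub>R R)"

lemma rotate_1: "rotate 1 = mat 1"
  using sin_pos by (simp add: rotate_def R_def)

lemma matrix_power: "mat_prod (replicate n C) = rotate (cis (real n * \<theta>))"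
proof (induction n)
  case 0
  show ?case by (simp add: rotate_1)
next
  case (Suc n)
  let ?a = "sin (real n * \<theta>)" and ?b = "sin (real n * \<theta>) * cos \<theta> - cos (real n * \<theta>) * sin \<theta>"
  have "mat_prod (replicate (Suc n) C) = C ** rotate (cis (real n * \<theta>))" by (simp add: Suc)
  also have "\<dots> = P + (1 / sin \<theta>) *\<^sub>R (?a *\<^sub>R ((2 * cos \<theta>) *\<^sub>R (C ** R) - R) - ?b *\<^sub>R (C ** R))"
    by (simp add: rotate_def matrix_algebra CP CCR)
  also have "?a *\<^sub>R ((2 * cos \<theta>) *\<^sub>R (C ** R) - R) - ?b *\<^sub>R (C ** R) =
      (2 * cos \<theta> * ?a - ?b) *\<^sub>R (C ** R) - ?a *\<^sub>R R"
    by (simp add: vec_eq_iff algebra_simps)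
  also have "2 * cos \<theta> * ?a - ?b = sin (real (Suc n) * \<theta>)"
    by (simp add: distrib_right sin_add algebra_simps)
  also have "?a = sin (real (Suc n) * \<theta>) * cos \<theta> - cos (real (Suc n) * \<theta>) * sin \<theta>"
    using sin_diff[of "real (Suc n) * \<theta>" \<theta>] by (simp add: distrib_right)
  finally show ?case by (simp add: rotate_def)
qed

text \<open>Otherwise \<open>C\<close> would have a real eigenvalue on the range of \<open>R\<close>, a root of \<open>X\<^sup>2 - 2 cos \<theta> X + 1\<close>.\<close>

lemma rotate_scalar:
  assumes "rotate z = k *\<^sub>R mat 1"
  shows "Im z = 0"
proof (rule ccontr)
  assume z: "Im z \<noteq> 0"
  define b where "b = Im z * cos \<theta> - Re z * sin \<theta>"
  have "rotate z ** R = (1 / sin \<theta>) *\<^sub>R (Im z *\<^sub>R (C ** R) - b *\<^sub>R R)"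
    by (simp add: rotate_def matrix_algebra PR RR b_def flip: matrix_mul_assoc)
  then have "k *\<^sub>R R = (1 / sin \<theta>) *\<^sub>R (Im z *\<^sub>R (C ** R) - b *\<^sub>R R)"
    by (simp add: assms)
  then have "sin \<theta> *\<^sub>R k *\<^sub>R R = Im z *\<^sub>R (C ** R) - b *\<^sub>R R" using sin_pos by simp
  then have "Im z *\<^sub>R (C ** R) = (sin \<theta> * k + b) *\<^sub>R R" by (simp add: algebra_simps)
  then have "(1 / Im z) *\<^sub>R Im z *\<^sub>R (C ** R) = (1 / Im z) *\<^sub>R (sin \<theta> * k + b) *\<^sub>R R" by simp
  then obtain \<mu> where \<mu>: "C ** R = \<mu> *\<^sub>R R" using z by auto
  have "(\<mu> * \<mu> - 2 * cos \<theta> * \<mu> + 1) *\<^sub>R R = 0"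
    using CCR by (simp add: \<mu> scaleR_matrix_mult algebra_simps)
  moreover have "\<mu> * \<mu> - 2 * cos \<theta> * \<mu> + 1 = (\<mu> - cos \<theta>)\<^sup>2 + (1 - (cos \<theta>)\<^sup>2)"
    by (simp add: power2_eq_square algebra_simps)
  moreover have "(\<mu> - cos \<theta>)\<^sup>2 + (1 - (cos \<theta>)\<^sup>2) > 0" using cos_bounds by (simp add: add_nonneg_pos)
  ultimately show False using R_nonzero by simp
qed

lemma finite_order:
  assumes "\<theta> = q * pi" "q \<in> \<rat>"
  obtains n :: nat where "0 < n" "mat_prod (replicate n C) = mat 1"
proof -
  obtain i n where q: "q = real_of_int i / real n" "n \<noteq> 0"
    using assms(2) unfolding Rats_eq_int_div_nat by blast
  have "real (2 * n) * \<theta> = 2 * pi * of_int i" using q by (simp add: assms)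
  then have "cis (real (2 * n) * \<theta>) = 1" by (simp only: cis_multiple_2pi Ints_of_int)
  then have "mat_prod (replicate (2 * n) C) = mat 1" unfolding matrix_power by (simp add: rotate_1)
  then show thesis using that[of "2 * n"] q by simp
qed

lemma not_scalar_power:
  assumes "\<theta> \<notin> {q * pi | q. q \<in> \<rat>}" "0 < n"
  shows "mat_prod (replicate n C) \<noteq> k *\<^sub>R mat 1"
proof
  assume "mat_prod (replicate n C) = k *\<^sub>R mat 1"
  then have "sin (real n * \<theta>) = 0" using rotate_scalar[of "cis (real n * \<theta>)" k] by (simp add: matrix_power)
  then obtain i :: int where "real n * \<theta> = of_int i * pi" unfolding sin_zero_iff_int2 by blast
  then have "\<theta> = (of_int i / of_nat n) * pi" using assms(2) by (simp add: field_simps)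
  moreover have "(of_int i / of_nat n :: real) \<in> \<rat>" by simp
  ultimately show False using assms(1) by blast
qed

text \<open>By compactness of the circle two of the numbers \<open>cis (n \<theta>)\<close> are close to each other, hence their
quotient is close to \<open>1\<close>.\<close>

lemma power_near_identity:
  assumes T: "open T" "mat 1 \<in> T"
  obtains n where "0 < n" "mat_prod (replicate n C) \<in> T"
proof -
  have "continuous_on UNIV rotate"
    unfolding rotate_def by (intro continuous_intros)
  then have "open (rotate -` T)" using T by (simp add: open_vimage)
  then obtain e where e: "0 < e" "\<And>z. dist z 1 < e \<Longrightarrow> rotate z \<in> T"
    using T rotate_1 unfolding open_dist by (metis UNIV_I vimage_eq)
  have "\<forall>n. cis (real n * \<theta>) \<in> sphere 0 1" by simp
  then obtain l r where lr: "strict_mono r" "((\<lambda>n. cis (real n * \<theta>)) \<circ> r) \<longlonglongrightarrow> l"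
    using compact_sphere[of "0::complex" 1] unfolding compact_def by meson
  then obtain N where N: "\<And>m n. N \<le> m \<Longrightarrow> N \<le> n \<Longrightarrow> dist (cis (real (r m) * \<theta>)) (cis (real (r n) * \<theta>)) < e"
    using LIMSEQ_imp_Cauchy[OF lr(2)] e(1) unfolding Cauchy_def by (metis comp_apply)
  define n where "n = r (Suc N) - r N"
  have rN: "r N < r (Suc N)" using lr(1) by (simp add: strict_mono_Suc_iff)
  have "dist (cis (real (r (Suc N)) * \<theta>)) (cis (real (r N) * \<theta>)) < e" by (rule N) auto
  also have "cis (real (r (Suc N)) * \<theta>) = cis (real (r N) * \<theta>) * cis (real n * \<theta>)"
    using rN by (simp add: cis_mult n_def of_nat_diff flip: distrib_right)
  also have "dist (cis (real (r N) * \<theta>) * cis (real n * \<theta>)) (cis (real (r N) * \<theta>)) =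
      norm (cis (real (r N) * \<theta>) * (cis (real n * \<theta>) - 1))"
    by (simp add: dist_norm algebra_simps)
  also have "\<dots> = dist (cis (real n * \<theta>)) 1" by (simp add: norm_mult dist_norm)
  finally have "rotate (cis (real n * \<theta>)) \<in> T" by (rule e(2))
  then show thesis using that[of n] rN by (simp add: n_def matrix_power)
qed

end

lemma comm_cos_less_one:
  assumes "t \<noteq> 0" "comm_cos t \<in> {-1..1}"
  shows "comm_cos t < 1"
proof (rule ccontr)
  assume "\<not> ?thesis"
  then have "comm_cos t = 1" using assms by simp
  then have eq: "- 35 + 306 * t - 32 * t\<^sup>2 = 256 * t" using assms by (simp add: comm_cos_def field_simps)
  have "32 * (t - 25 / 32)\<^sup>2 + 495 / 32 = 0"
    using eq by (simp add: power2_eq_square algebra_simps)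
  moreover have "0 \<le> 32 * (t - 25 / 32)\<^sup>2" by simp
  ultimately show False by linarith
qed

lemma comm_cos_eq_minus_one:
  assumes "t \<noteq> 0" "comm_cos t = -1"
  shows "t = 1/16 \<or> t = 35/2"
proof -
  have "- 35 + 306 * t - 32 * t\<^sup>2 = - 256 * t" using assms by (simp add: comm_cos_def field_simps)
  then have "(16 * t - 1) * (2 * t - 35) = 0" by (simp add: power2_eq_square algebra_simps)
  then show ?thesis by auto
qed

lemma commutator_rotation:
  assumes "t \<noteq> 0" "-1 < comm_cos t" "comm_cos t < 1"
  shows "rotation_matrix (commutator_matrix t) (arccos (comm_cos t))"
proof
  have "cos (arccos (comm_cos t)) = comm_cos t" using assms by simp
  then show "commutator_matrix t ** (commutator_matrix t ** commutator_matrix t -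
      (2 * cos (arccos (comm_cos t))) *\<^sub>R commutator_matrix t + mat 1) = commutator_matrix t ** commutator_matrix t -
      (2 * cos (arccos (comm_cos t))) *\<^sub>R commutator_matrix t + mat 1"
    using commutator_matrix_cubic[OF assms(1)] by simp
  show "0 < sin (arccos (comm_cos t))"
    using arccos_lt_bounded[OF assms(2,3)] by (intro sin_gt_zero) auto
qed (rule commutator_matrix_nontrivial[OF assms(1)])

section \<open>Projective transformations preserving a conic\<close>

definition lorentz_form :: "real^3^3" where "lorentz_form = mat3 1 0 0 0 1 0 0 0 (-1)"

lemma O21_iff: "A \<in> O21 \<longleftrightarrow> transpose A ** lorentz_form ** A = lorentz_form"
  by (simp add: O21_def lorentz_form_def Let_def)

lemma lorentz_form_invertible: "invertible lorentz_form"
  unfolding invertible_det_nz by (simp add: lorentz_form_def det_3)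

lemma O21_invertible:
  assumes "A \<in> O21"
  shows "invertible A"
proof -
  have "det A * det lorentz_form * det A = det lorentz_form"
    using arg_cong[OF assms[unfolded O21_iff], of det] by (simp only: det_mul det_transpose)
  then show ?thesis using lorentz_form_invertible unfolding invertible_det_nz by auto
qed

text \<open>Comparing entries, the diagonal matrix leaves only the coefficients of \<open>y\<^sup>2\<close> and \<open>x z\<close>, since the form
is nondegenerate.  The mixed entry for \<open>mat_b t\<close> then forces \<open>\<alpha> = - 2 \<beta>\<close>, unless \<open>t = 1/2\<close> or
\<open>t = - 1/2\<close>; these two values are excluded by the other entries.\<close>

lemma common_form_parameter:
  fixes Q :: "real^3^3"
  assumes sym: "transpose Q = Q" and det: "det Q \<noteq> 0"
    and a: "transpose mat_a ** Q ** mat_a = c *\<^sub>R Q"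
    and b: "transpose (mat_b t) ** Q ** mat_b t = d *\<^sub>R Q"
  shows "t = 2"
proof -
  have s: "Q$2$1 = Q$1$2" "Q$3$1 = Q$1$3" "Q$3$2 = Q$2$3"
  proof -
    have "Q$j$i = Q$i$j" for i j
      using arg_cong[OF sym, of "\<lambda>M. M $ i $ j"] by (simp only: transpose_def vec_lambda_beta)
    then show "Q$2$1 = Q$1$2" "Q$3$1 = Q$1$3" "Q$3$2 = Q$2$3" by this+
  qed
  have eqs: "Q$1$1 = c * 4 * Q$1$1" "Q$1$2 = c * 2 * Q$1$2" "Q$1$3 = c * Q$1$3"
    "Q$2$2 = c * Q$2$2" "2 * Q$2$3 = c * Q$2$3" "4 * Q$3$3 = c * Q$3$3"
  proof -
    have e: "(transpose mat_a ** Q ** mat_a) $ i $ j = c * Q $ i $ j" for i j unfolding a by simp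
    show "Q$1$1 = c * 4 * Q$1$1" "Q$1$2 = c * 2 * Q$1$2" "Q$1$3 = c * Q$1$3"
      "Q$2$2 = c * Q$2$2" "2 * Q$2$3 = c * Q$2$3" "4 * Q$3$3 = c * Q$3$3"
      using e[of 1 1] e[of 1 2] e[of 1 3] e[of 2 2] e[of 2 3] e[of 3 3]
      by (simp_all add: transpose_def matrix_matrix_mult_def sum_3 mat_a_def)
  qed
  have detQ: "det Q = Q$1$1 * (Q$2$2 * Q$3$3 - (Q$2$3)\<^sup>2) - Q$1$2 * (Q$1$2 * Q$3$3 - Q$1$3 * Q$2$3) +
      Q$1$3 * (Q$1$2 * Q$2$3 - Q$2$2 * Q$1$3)"
    by (simp add: det_3 s power2_eq_square algebra_simps)
  have "c = 1"
  proof (rule ccontr)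
    assume "c \<noteq> 1"
    then have z: "Q$1$3 = 0" "Q$2$2 = 0" using eqs(3,4) by auto
    have "Q$1$1 = 0 \<or> c * 4 = 1" "Q$1$2 = 0 \<or> c * 2 = 1" "Q$2$3 = 0 \<or> c = 2" "Q$3$3 = 0 \<or> c = 4"
      using eqs(1,2,5,6) by auto
    then have p: "Q$1$1 * (Q$2$3)\<^sup>2 = 0" "Q$1$2 * (Q$1$2 * Q$3$3) = 0" by auto
    have "det Q = - (Q$1$1 * (Q$2$3)\<^sup>2) - Q$1$2 * (Q$1$2 * Q$3$3)"
      unfolding detQ z by simp
    then show False using det unfolding p by simp
  qed
  then have z: "Q$1$1 = 0" "Q$1$2 = 0" "Q$2$3 = 0" "Q$3$3 = 0" using eqs by auto
  define \<alpha> \<beta> where "\<alpha> = Q$2$2" and "\<beta> = Q$1$3"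
  have \<beta>: "\<beta> \<noteq> 0" using det unfolding detQ z \<beta>_def by auto
  have b11: "\<alpha> * (1 - 2 * t)\<^sup>2 + 2 * \<beta> * (2 * t + 5) * (2 * t - 3) = 0"
    and b12: "(1 - 2 * t) * (4 * t + 2) * (\<alpha> + 2 * \<beta>) = 0"
    and b13: "\<alpha> * (1 - 2 * t)\<^sup>2 + \<beta> * ((2 * t + 5)\<^sup>2 + (2 * t - 3)\<^sup>2) = d * \<beta>"
    and b22: "\<alpha> * (4 * t + 2)\<^sup>2 + 2 * \<beta> * (2 - 4 * t)\<^sup>2 = d * \<alpha>"
  proof -
    let ?L = "transpose (mat_b t) ** Q ** mat_b t"
    have e: "?L $ i $ j = d * Q $ i $ j" for i j unfolding b by simp
    show "\<alpha> * (1 - 2 * t)\<^sup>2 + 2 * \<beta> * (2 * t + 5) * (2 * t - 3) = 0"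
      using e[of 1 1] by (simp add: transpose_def matrix_matrix_mult_def sum_3 mat_b_def s z \<alpha>_def \<beta>_def
          power2_eq_square algebra_simps)
    show "(1 - 2 * t) * (4 * t + 2) * (\<alpha> + 2 * \<beta>) = 0"
    proof -
      have "?L $ 1 $ 2 = (1 - 2 * t) * (4 * t + 2) * (\<alpha> + 2 * \<beta>)"
        by (simp add: transpose_def matrix_matrix_mult_def sum_3 mat_b_def s z \<alpha>_def \<beta>_def algebra_simps)
      then show ?thesis using e[of 1 2] z by simp
    qed
    show "\<alpha> * (1 - 2 * t)\<^sup>2 + \<beta> * ((2 * t + 5)\<^sup>2 + (2 * t - 3)\<^sup>2) = d * \<beta>"
      using e[of 1 3] by (simp add: transpose_def matrix_matrix_mult_def sum_3 mat_b_def s z \<alpha>_def \<beta>_def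
          power2_eq_square algebra_simps)
    show "\<alpha> * (4 * t + 2)\<^sup>2 + 2 * \<beta> * (2 - 4 * t)\<^sup>2 = d * \<alpha>"
      using e[of 2 2] by (simp add: transpose_def matrix_matrix_mult_def sum_3 mat_b_def s z \<alpha>_def \<beta>_def
          power2_eq_square algebra_simps)
  qed
  consider "t = 1/2" | "t = -1/2" | "\<alpha> = - 2 * \<beta>"
    using b12 unfolding mult_eq_0_iff by linarith
  then show ?thesis
  proof cases
    case 1
    show ?thesis using b11 \<beta> unfolding 1 by simp
  next
    case 2
    then have "\<alpha> = 8 * \<beta>" "4 * \<alpha> + 32 * \<beta> = d * \<beta>" "32 * \<beta> = d * \<alpha>"
      using b11 b13 b22 by (simp_all add: power2_eq_square)
    then have "d = 64" "d = 4" using \<beta> by auto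
    then show ?thesis by simp
  next
    case 3
    have "2 * \<beta> * (8 * t - 16) = 0" using b11 unfolding 3 by (simp add: power2_eq_square algebra_simps)
    then show ?thesis using \<beta> by simp
  qed
qed

lemma proj_closed: "invertible A \<Longrightarrow> proj A \<in> carrier PGL3"
  by (simp add: carrier_PGL3 GL3_def)

lemma proj_mult:
  assumes "invertible A" "invertible B"
  shows "proj A \<otimes>\<^bsub>PGL3\<^esub> proj B = proj (A ** B)"
  using normal.rcos_sum[OF normal_scalars3, of A B] assms
  by (simp add: PGL3_def FactGroup_def proj_def GL3_def)

lemma proj_one: "proj (mat 1) = \<one>\<^bsub>PGL3\<^esub>"
proof -
  have "scalars3 #>\<^bsub>GL3\<^esub> \<one>\<^bsub>GL3\<^esub> = scalars3"
    by (rule group.coset_mult_one[OF group_GL3]) (auto simp: scalars3_def GL3_def invertible_scaleR_mat)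
  then show ?thesis by (simp add: PGL3_def FactGroup_def proj_def GL3_def)
qed

lemma proj_inverse:
  assumes "A ** B = mat 1"
  shows "inv\<^bsub>PGL3\<^esub> (proj A) = proj B"
proof -
  have BA: "B ** A = mat 1" using assms matrix_left_right_inverse by blast
  have inv: "invertible A" "invertible B" using assms BA unfolding invertible_def by blast+
  have "proj B \<otimes>\<^bsub>PGL3\<^esub> proj A = \<one>\<^bsub>PGL3\<^esub>" unfolding proj_mult[OF inv(2,1)] BA by (rule proj_one)
  then show ?thesis
    by (rule group.inv_equality[OF group_PGL3]) (simp_all add: proj_closed inv)
qed

lemma proj_eqD:
  assumes "proj A = proj B"
  obtains c where "c \<noteq> 0" "A = c *\<^sub>R B"
proof -
  have "A \<in> proj A" unfolding proj_eq by (intro CollectI exI[of _ 1]) simp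
  then show thesis using that unfolding assms by (auto simp: proj_eq)
qed

lemma conjugate_PO21_form:
  assumes g: "g \<in> carrier PGL3"
  obtains Q :: "real^3^3" where "transpose Q = Q" "det Q \<noteq> 0"
    "\<And>A. proj A \<in> conjugate_PGL3 g PO21 \<Longrightarrow> \<exists>c. transpose A ** Q ** A = c *\<^sub>R Q"
proof -
  obtain M where M: "invertible M" "g = proj M" using g by (auto simp: carrier_PGL3 GL3_def)
  obtain N where MN: "M ** N = mat 1" "N ** M = mat 1" using M(1) by (auto simp: invertible_def)
  have N: "invertible N" using MN unfolding invertible_def by blast
  define Q where "Q = transpose N ** lorentz_form ** N"
  show thesis
  proof (rule that[of Q])
    have "transpose lorentz_form = lorentz_form"
      by (simp add: lorentz_form_def vec_eq_iff forall_3 transpose_def)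
    then show "transpose Q = Q" by (simp add: Q_def matrix_transpose_mul matrix_mul_assoc)
    show "det Q \<noteq> 0"
      using N lorentz_form_invertible unfolding invertible_det_nz by (simp add: Q_def det_mul)
  next
    fix A assume "proj A \<in> conjugate_PGL3 g PO21"
    then obtain h where h: "h \<in> O21" "proj A = g \<otimes>\<^bsub>PGL3\<^esub> proj h \<otimes>\<^bsub>PGL3\<^esub> inv\<^bsub>PGL3\<^esub> g"
      by (auto simp: conjugate_PGL3_def PO21_def)
    have "proj A = proj (M ** h ** N)"
      unfolding h(2) M(2) proj_inverse[OF MN(1)]
      by (simp add: proj_mult M(1) N O21_invertible[OF h(1)] invertible_mult)
    then obtain c where c: "A = c *\<^sub>R (M ** h ** N)" by (rule proj_eqD)
    have "transpose (M ** h ** N) ** Q ** (M ** h ** N) =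
        transpose N ** (transpose h ** (transpose M ** transpose N) ** lorentz_form ** (N ** M) ** h) ** N"
      by (simp add: Q_def matrix_transpose_mul matrix_mul_assoc)
    also have "transpose M ** transpose N = mat 1"
      unfolding matrix_transpose_mul[symmetric] MN(2) by (simp add: transpose_mat)
    also have "transpose N ** (transpose h ** mat 1 ** lorentz_form ** (N ** M) ** h) ** N = Q"
      using h(1) unfolding O21_iff MN(2) by (simp add: Q_def)
    finally have form: "transpose (M ** h ** N) ** Q ** (M ** h ** N) = Q" .
    have scale: "transpose (c *\<^sub>R B) ** Q ** (c *\<^sub>R B) = (c * c) *\<^sub>R (transpose B ** Q ** B)" for B
      by (simp add: vec_eq_iff matrix_matrix_mult_def transpose_def sum_distrib_left sum_distrib_right mult_ac)
    show "\<exists>c. transpose A ** Q ** A = c *\<^sub>R Q"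
      unfolding c scale form by blast
  qed
qed

section \<open>The representation\<close>

lemma invertible_mat_powers:
  "invertible (mat_a_power s)" "t \<noteq> 0 \<Longrightarrow> invertible (mat_b_power t s)"
  using mat_a_power_inverse[of s] mat_b_power_inverse[of t s] matrix_left_right_inverse
  unfolding invertible_def by blast+

lemma invertible_mat_prod: "(\<And>A. A \<in> set As \<Longrightarrow> invertible A) \<Longrightarrow> invertible (mat_prod As)"
proof (induction As)
  case Nil
  then show ?case using invertible_scaleR_mat[of 1] by simp
qed (simp add: invertible_mult)

locale representation = group_hom F PGL3 \<rho> for F (structure) and \<rho> +
  fixes x y :: 'a and t :: real
  assumes xy: "x \<in> carrier F" "y \<in> carrier F" and t: "t \<noteq> 0"
    and \<rho>x: "\<rho> x = proj mat_a" and \<rho>y: "\<rho> y = proj (mat_b t)"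
begin

lemma \<rho>_letters:
  "\<rho> (if s then inv x else x) = proj (mat_a_power s)"
  "\<rho> (if s then inv y else y) = proj (mat_b_power t s)"
proof -
  have "inv\<^bsub>PGL3\<^esub> (proj mat_a) = proj (mat_a_power True)"
    using proj_inverse[OF mat_a_power_inverse[of False]] by (simp add: mat_a_power_def)
  then show "\<rho> (if s then inv x else x) = proj (mat_a_power s)"
    using xy by (simp add: \<rho>x mat_a_power_def)
  have "inv\<^bsub>PGL3\<^esub> (proj (mat_b t)) = proj (mat_b_power t True)"
    using proj_inverse[OF mat_b_power_inverse[OF t, of False]] by (simp add: mat_b_power_def)
  then show "\<rho> (if s then inv y else y) = proj (mat_b_power t s)"
    using xy by (simp add: \<rho>y mat_b_power_def)
qed

lemma \<rho>_ray:
  assumes "\<eta> 0 = \<one>" "\<And>i. \<eta> i \<in> carrier F"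
    and step: "\<And>i. \<exists>l\<in>{if s then inv x else x, if r then inv y else y}. \<eta> (Suc i) = \<eta> i \<otimes> l"
  shows "\<exists>As. length As = i \<and> set As \<subseteq> {mat_a_power s, mat_b_power t r} \<and> \<rho> (\<eta> i) = proj (mat_prod As)"
proof (induction i)
  case 0
  show ?case by (intro exI[of _ "[]"]) (simp add: assms(1) proj_one)
next
  case (Suc i)
  then obtain As where As: "length As = i" "set As \<subseteq> {mat_a_power s, mat_b_power t r}"
    "\<rho> (\<eta> i) = proj (mat_prod As)" by blast
  obtain l where l: "l \<in> {if s then inv x else x, if r then inv y else y}" "\<eta> (Suc i) = \<eta> i \<otimes> l"
    using step by blast
  have lc: "l \<in> carrier F" using l(1) xy by auto
  obtain A where A: "A \<in> {mat_a_power s, mat_b_power t r}" "\<rho> l = proj A"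
    using l(1) \<rho>_letters[of s] \<rho>_letters[of r] by blast
  have inv: "invertible A" "invertible (mat_prod As)"
    using A(1) As(2) invertible_mat_powers t by (auto intro!: invertible_mat_prod)
  have "\<rho> (\<eta> (Suc i)) = proj (mat_prod (As @ [A]))"
    unfolding l(2) hom_mult[OF assms(2) lc] As(3) A(2) proj_mult[OF inv(2,1)] by (simp add: mat_prod_append)
  then show ?case using As A by (intro exI[of _ "As @ [A]"]) auto
qed

lemma \<rho>_comm_power: "\<rho> (G.comm x y [^] n) = proj (mat_prod (replicate n (commutator_matrix t)))"
proof (induction n)
  case 0
  show ?case by (simp add: proj_one)
next
  case (Suc n)
  have inv: "invertible (commutator_matrix t)"
    unfolding commutator_matrix_def by (intro invertible_mult invertible_mat_powers t)
  have inv_n: "invertible (mat_prod (replicate n (commutator_matrix t)))"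
    by (rule invertible_mat_prod) (simp add: inv)
  have "\<rho> (G.comm x y) = proj (commutator_matrix t)"
    unfolding G.comm_def commutator_matrix_def
    using \<rho>_letters[of False] \<rho>_letters[of True] xy
    by (simp add: proj_mult invertible_mult invertible_mat_powers t)
  then show ?case
    using Suc G.nat_pow_Suc2[of "G.comm x y" n] xy inv
    by (simp add: proj_mult inv_n)
qed

end

theorem proposition5p14:
  fixes F :: "('g, 'm) monoid_scheme"
    and \<gamma>\<^sub>1 \<gamma>\<^sub>2 :: 'g
    and t :: real
    and \<rho> :: "'g \<Rightarrow> (real^3^3) set"
    and ip :: "real^3 \<Rightarrow> real^3 \<Rightarrow> real"
  assumes "inner_product ip"
    and "t \<noteq> 0"
    and "free_group_rank_two F"
    and "generating_set F {\<gamma>\<^sub>1, \<gamma>\<^sub>2}"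
    and "\<rho> \<in> hom F PGL3"
    and "\<rho> \<gamma>\<^sub>1 = proj mat_a"
    and "\<rho> \<gamma>\<^sub>2 = proj (mat_b t)"
  shows "(t > 1 \<longrightarrow> primitive_stable ip F \<rho>) \<and>
    (t < 35/2 \<and> comm_cos t \<in> {-1..1} \<and> t \<noteq> 1/16 \<and>
       arccos (comm_cos t) \<in> {q * pi | q. q \<in> \<rat>} \<longrightarrow>
       \<not> inj_on \<rho> (carrier F)) \<and>
    (t < 35/2 \<and> comm_cos t \<in> {-1..1} \<and>
       arccos (comm_cos t) \<notin> {q * pi | q. q \<in> \<rat>} \<longrightarrow>
       \<not> discrete_subgroup_PGL3 (\<rho> ` carrier F)) \<and>
    (t \<noteq> 2 \<longrightarrow>
       \<not> (\<exists>g\<in>carrier PGL3. \<rho> ` carrier F \<subseteq> conjugate_PGL3 g PO21))"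
proof -
  obtain B where F: "group F" "card B = 2" "free_basis F B"
    using assms(3) by (auto simp: free_group_rank_two_def)
  interpret F: free_group F B
    by (intro free_group.intro free_group_axioms.intro F)
  have gens: "\<gamma>\<^sub>1 \<in> carrier F" "\<gamma>\<^sub>2 \<in> carrier F" "generate F {\<gamma>\<^sub>1, \<gamma>\<^sub>2} = carrier F"
    using assms(4) by (auto simp: generating_set_def)
  interpret \<rho>: representation F \<rho> \<gamma>\<^sub>1 \<gamma>\<^sub>2 t
    using F(1) group_PGL3 assms gens
    by (intro representation.intro representation_axioms.intro group_hom.intro group_hom_axioms.intro)
  define C where "C = commutator_matrix t"
  define \<theta> where "\<theta> = arccos (comm_cos t)"
  have rotation: "rotation_matrix C \<theta>" if "-1 < comm_cos t" "comm_cos t \<in> {-1..1}"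
    unfolding C_def \<theta>_def using that comm_cos_less_one[OF assms(2)]
    by (intro commutator_rotation assms(2)) auto
  have "primitive_stable ip F \<rho>" if t: "t > 1"
  proof -
    interpret inner_product_R3 ip by unfold_locales (rule assms(1))
    obtain \<kappa> \<kappa>' where \<kappa>: "0 < \<kappa>" "0 < \<kappa>'"
      "\<And>s r As k. \<lbrakk>set As \<subseteq> {mat_a_power s, mat_b_power t r}; k \<in> {1, 2}\<rbrakk> \<Longrightarrow>
        simple_root k (cartan_proj ip (proj (mat_prod As))) \<ge> \<kappa> * real (length As) - \<kappa>'"
      using cartan_proj_gap[OF t] by blast
    obtain \<phi> \<psi> where "generating_pair F \<gamma>\<^sub>1 \<gamma>\<^sub>2 \<phi> \<psi>"
      using F.generating_pair_facts(2)[OF F(2) gens] by blast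
    then interpret pair: generating_pair F \<gamma>\<^sub>1 \<gamma>\<^sub>2 \<phi> \<psi> .
    have "simple_root k (cartan_proj ip (\<rho> (\<eta> i))) \<ge> \<kappa> * real i - \<kappa>'"
      if ray: "rooted_primitive_ray F {\<gamma>\<^sub>1, \<gamma>\<^sub>2} \<eta>" and k: "k \<in> {1, 2}" for \<eta> i k
    proof -
      note \<eta> = pair.rooted_ray_steps[OF ray]
      obtain p q where pq: "p \<in> {\<gamma>\<^sub>1, inv\<^bsub>F\<^esub> \<gamma>\<^sub>1}" "q \<in> {\<gamma>\<^sub>2, inv\<^bsub>F\<^esub> \<gamma>\<^sub>2}"
        "\<And>i. \<exists>l\<in>{p, q}. \<eta> (Suc i) = \<eta> i \<otimes>\<^bsub>F\<^esub> l"
        using \<eta>(3) by blast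
      obtain s where s: "p = (if s then inv\<^bsub>F\<^esub> \<gamma>\<^sub>1 else \<gamma>\<^sub>1)" using pq(1) by (metis insertE singletonD)
      obtain r where r: "q = (if r then inv\<^bsub>F\<^esub> \<gamma>\<^sub>2 else \<gamma>\<^sub>2)" using pq(2) by (metis insertE singletonD)
      obtain As where As: "length As = i" "set As \<subseteq> {mat_a_power s, mat_b_power t r}"
        "\<rho> (\<eta> i) = proj (mat_prod As)"
        using \<rho>.\<rho>_ray[OF \<eta>(1,2) pq(3)[unfolded s r]] by blast
      show ?thesis using \<kappa>(3)[OF As(2) k] by (simp only: As(1,3))
    qed
    then show ?thesis
      unfolding primitive_stable_def using \<kappa>(1,2) assms(4)
      by (intro exI[of _ "{\<gamma>\<^sub>1, \<gamma>\<^sub>2}"] conjI exI[of _ \<kappa>] exI[of _ \<kappa>']) auto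
  qed
  moreover have "\<not> inj_on \<rho> (carrier F)"
    if "t < 35/2" "comm_cos t \<in> {-1..1}" "t \<noteq> 1/16" and rat: "\<theta> \<in> {q * pi | q. q \<in> \<rat>}"
  proof
    assume inj: "inj_on \<rho> (carrier F)"
    have "comm_cos t \<noteq> -1" using comm_cos_eq_minus_one[OF assms(2)] that(1,3) by auto
    then interpret rotation_matrix C \<theta> using that by (intro rotation) auto
    obtain q where q: "\<theta> = q * pi" "q \<in> \<rat>" using rat by blast
    obtain n :: nat where n: "0 < n" "mat_prod (replicate n C) = mat 1" by (rule finite_order[OF q])
    have "\<rho> (F.comm \<gamma>\<^sub>1 \<gamma>\<^sub>2 [^]\<^bsub>F\<^esub> n) = \<rho> \<one>\<^bsub>F\<^esub>"
      using \<rho>.\<rho>_comm_power[of n] n(2) by (simp add: C_def proj_one)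
    then have "F.comm \<gamma>\<^sub>1 \<gamma>\<^sub>2 [^]\<^bsub>F\<^esub> n = \<one>\<^bsub>F\<^esub>"
      by (rule inj_onD[OF inj]) (use gens in simp_all)
    then show False
      using F.generating_pair_facts(1)[OF F(2) gens] n(1) by (simp add: F.infinite_order_def)
  qed
  moreover have "\<not> discrete_subgroup_PGL3 (\<rho> ` carrier F)"
    if "comm_cos t \<in> {-1..1}" and irr: "\<theta> \<notin> {q * pi | q. q \<in> \<rat>}"
  proof
    define H where "H = \<rho> ` carrier F"
    assume "discrete_subgroup_PGL3 (\<rho> ` carrier F)"
    then have disc: "subtopology PGL3_topology H = discrete_topology H"
      by (simp add: discrete_subgroup_PGL3_def H_def)
    have "comm_cos t \<noteq> -1"
    proof
      assume "comm_cos t = -1"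
      then have "\<theta> = 1 * pi" by (simp add: \<theta>_def)
      then show False using irr Rats_1 by blast
    qed
    then interpret rotation_matrix C \<theta> using that by (intro rotation) auto
    have "\<one>\<^bsub>PGL3\<^esub> \<in> H" unfolding H_def using \<rho>.hom_one by (metis F.one_closed imageI)
    then have "openin (subtopology PGL3_topology H) {\<one>\<^bsub>PGL3\<^esub>}" by (simp add: disc)
    then obtain U where U: "openin PGL3_topology U" "{\<one>\<^bsub>PGL3\<^esub>} = U \<inter> H"
      by (auto simp: openin_subtopology)
    obtain T where T: "open T" "{A \<in> carrier GL3. proj A \<in> U} = carrier GL3 \<inter> T"
      using U(1) unfolding openin_PGL3_topology openin_open by blast
    have "mat 1 \<in> carrier GL3" using invertible_scaleR_mat[of 1] by (simp add: GL3_def)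
    moreover have "proj (mat 1) \<in> U" using U(2) by (auto simp: proj_one)
    ultimately have "mat 1 \<in> T" using T(2) by blast
    then obtain n where n: "0 < n" "mat_prod (replicate n C) \<in> T"
      using power_near_identity[OF T(1)] by blast
    have "invertible (mat_prod (replicate n C))"
      by (rule invertible_mat_prod)
        (auto simp: C_def commutator_matrix_def intro!: invertible_mult invertible_mat_powers assms(2))
    then have "proj (mat_prod (replicate n C)) \<in> U" using n(2) T(2) by (auto simp: GL3_def)
    moreover have "proj (mat_prod (replicate n C)) \<in> H"
      unfolding H_def C_def \<rho>.\<rho>_comm_power[symmetric] using gens by simp
    ultimately have "proj (mat_prod (replicate n C)) = proj (mat 1)" using U(2) by (auto simp: proj_one)
    then obtain k where "mat_prod (replicate n C) = k *\<^sub>R mat 1" by (rule proj_eqD)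
    then show False using not_scalar_power[OF irr n(1)] by blast
  qed
  moreover have "t = 2" if g: "g \<in> carrier PGL3" and sub: "\<rho> ` carrier F \<subseteq> conjugate_PGL3 g PO21" for g
  proof -
    obtain Q :: "real^3^3" where Q: "transpose Q = Q" "det Q \<noteq> 0"
      "\<And>A. proj A \<in> conjugate_PGL3 g PO21 \<Longrightarrow> \<exists>c. transpose A ** Q ** A = c *\<^sub>R Q"
      by (rule conjugate_PO21_form[OF g]) (rule that)
    have "proj mat_a \<in> conjugate_PGL3 g PO21" "proj (mat_b t) \<in> conjugate_PGL3 g PO21"
      using sub gens unfolding assms(6)[symmetric] assms(7)[symmetric] by blast+
    then obtain c d where "transpose mat_a ** Q ** mat_a = c *\<^sub>R Q"
      "transpose (mat_b t) ** Q ** mat_b t = d *\<^sub>R Q"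
      using Q(3) by blast
    then show ?thesis by (rule common_form_parameter[OF Q(1,2)])
  qed
  ultimately show ?thesis unfolding \<theta>_def by blast
qed

end
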